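(* There is a universal constant $C>0$ such that the following holds. Let $\pi\colon\mathrm{GL}(n)\to\mathrm{GL}(V)$ be a rational representation on a finite-dimensional complex vector space $V$ with a $U(n)$-invariant Hermitian inner product, let $v\in V$ be a unit vector, let $p\in\mathbb Q^n$ with $p_1\ge\dots\ge p_n$ be such that $\operatorname{cap}_p(v)>0$, and let $\varepsilon>0$. Put $N^2:=N(\pi)^2+\|p\|_2$. Then the algorithm described in the context, run with $$T=\max\Bigl\{1,\Bigl\lceil C\,\frac{N^2}{\varepsilon^2}\,\bigl|\log\operatorname{cap}_p(v)\bigr|\Bigr\rceil\Bigr\}$$ iterations, outputs a group element $g\in\mathrm{GL}(n)$ satisfying $\|\operatorname{spec}(\mu(\pi(g)v))-p\|_2\le\varepsilon$.
   Context: Rational representation: a group homomorphism whose matrix entries are polynomials in the $g_{i,j}$ and $\det(g)^{-1}$; the inner product is such that $\pi(U(n))$ acts by unitary maps, and $\|\cdot\|$ is its norm. $\operatorname{spec}(H)\in\mathbb R^n$ lists the eigenvalues of a Hermitian matrix in nonincreasing order. Moment map: $\mu\colon V\setminus\{0\}\to \mathrm{Herm}(n)$ is defined by $\operatorname{tr}[\mu(v)H]=\partial_{t=0}\log\|\pi(e^{tH})v\|$ for all Hermitian $H$. Weight norm: $N(\pi)$ is the maximum of $\|\lambda\|_2$ over the highest weights $\lambda\in\mathbb Z^n$ of the irreducible subrepresentations of $\pi$. $p$-capacity: let $\ell>0$ be the least integer with $\lambda:=\ell p\in\mathbb Z^n$, and let $\lambda^*:=(-\lambda_n,\dots,-\lambda_1)$.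 Let $\pi_{\lambda^*}\colon\mathrm{GL}(n)\to\mathrm{GL}(V_{\lambda^*})$ be the irreducible representation with highest weight $\lambda^*$, with a $U(n)$-invariant inner product, and let $v_{\lambda^*}$ be a unit highest weight vector (fixed by unitriangular upper triangular matrices and of weight $\lambda^*$ for diagonal matrices). Then $$\operatorname{cap}_p(v):=\inf_{g\in\mathrm{GL}(n)}\bigl\|(\pi(g)v)^{\otimes\ell}\otimes \pi_{\lambda^*}(g)v_{\lambda^*}\bigr\|^{1/\ell}=\inf_{g}\ \|\pi(g)v\|\cdot\|\pi_{\lambda^*}(g)v_{\lambda^*}\|^{1/\ell}.$$ Algorithm (with $T\ge1$ iterations): let $\Lambda$ be the diagonal matrix with $\Lambda_{i,i}=p_{n-i+1}$. Set $g_0=I$ and $\eta=1/(2N^2)$ (arbitrary if $N=0$). For $t=0,\dots,T-1$ write $g_t=Q_tR_t$ with $Q_t$ unitary and $R_t$ upper triangular, and set $g_{t+1}=e^{-\eta(\mu(\pi(g_t)v)-Q_t\Lambda Q_t^\dagger)}g_t$. Return $g_t$ for some $t\in\{0,\dots,T-1\}$ minimizing $\|\mu(\pi(g_t)v)-Q_t\Lambda Q_t^\dagger\|_F$. *)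

theory Defs
  imports Complex_Main
    "Jordan_Normal_Form.Char_Poly"
    "Jordan_Normal_Form.Schur_Decomposition"
    "Jordan_Normal_Form.VS_Connect"
begin

text \<open>
  The constant of the theorem must be uniform in \<open>n\<close> and in the representation, so all dimensions
  are natural numbers: matrices and vectors are those of \<open>Jordan_Normal_Form\<close>, with carriers
  \<open>carrier_mat n n\<close> and \<open>carrier_vec d\<close>.  A representation space of dimension \<open>d\<close> is \<open>carrier_vec d\<close>
  (coordinates in some basis) with an arbitrary Hermitian inner product \<open>ip\<close>, so the basis need not
  be orthonormal.  Indices start at \<open>0\<close>.
\<close>

definition GL :: "nat \<Rightarrow> complex mat set" where
  "GL n = {g \<in> carrier_mat n n. invertible_mat g}"

definition unitary_group :: "nat \<Rightarrow> complex mat set" where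
  "unitary_group n = {g \<in> carrier_mat n n. mat_adjoint g * g = 1\<^sub>m n}"

definition Herm :: "nat \<Rightarrow> complex mat set" where
  "Herm n = {H \<in> carrier_mat n n. mat_adjoint H = H}"

definition tr :: "complex mat \<Rightarrow> complex" where
  "tr A = (\<Sum>i<dim_row A. A $$ (i, i))"

definition frobenius_norm :: "complex mat \<Rightarrow> real" where
  "frobenius_norm A = sqrt (\<Sum>i<dim_row A. \<Sum>j<dim_col A. (cmod (A $$ (i, j)))\<^sup>2)"

definition mat_exp :: "complex mat \<Rightarrow> complex mat" where
  "mat_exp A = mat (dim_row A) (dim_row A) (\<lambda>(i, j). \<Sum>k. (A ^\<^sub>m k) $$ (i, j) / fact k)"

definition l2_norm :: "real vec \<Rightarrow> real" where
  "l2_norm x = sqrt (\<Sum>i<dim_vec x. (x $ i)\<^sup>2)"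

text \<open>Eigenvalues with algebraic multiplicity in nonincreasing order.  Meant for Hermitian matrices,
  whose eigenvalues are real, so that \<open>Re\<close> loses nothing.\<close>

definition spec :: "complex mat \<Rightarrow> real vec" where
  "spec H = vec_of_list (rev (sorted_list_of_multiset (image_mset Re (proots (char_poly H)))))"

text \<open>Functions on \<open>GL n\<close> given by a polynomial in the entries \<open>g\<^sub>i\<^sub>j\<close> and \<open>det(g)\<inverse>\<close>: a pair \<open>(m, k)\<close>
  encodes the monomial with exponents \<open>m (i, j)\<close> for the entries and \<open>k\<close> for \<open>det(g)\<inverse>\<close>.\<close>

definition rational_function_on_GL :: "nat \<Rightarrow> (complex mat \<Rightarrow> complex) \<Rightarrow> bool" where
  "rational_function_on_GL n f \<longleftrightarrow>
     (\<exists>(S :: ((nat \<times> nat \<Rightarrow> nat) \<times> nat) set) c. finite S \<and>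
        (\<forall>g\<in>GL n. f g = (\<Sum>(m, k)\<in>S. c (m, k) *
            (\<Prod>i<n. \<Prod>j<n. (g $$ (i, j)) ^ m (i, j)) * (inverse (det g)) ^ k)))"

definition rational_representation :: "nat \<Rightarrow> nat \<Rightarrow> (complex mat \<Rightarrow> complex mat) \<Rightarrow> bool" where
  "rational_representation n d \<pi> \<longleftrightarrow>
     (\<forall>g\<in>GL n. \<pi> g \<in> GL d) \<and>
     (\<forall>g\<in>GL n. \<forall>h\<in>GL n. \<pi> (g * h) = \<pi> g * \<pi> h) \<and>
     (\<forall>a<d. \<forall>b<d. rational_function_on_GL n (\<lambda>g. \<pi> g $$ (a, b)))"

definition hermitian_inner_product ::
    "nat \<Rightarrow> (complex vec \<Rightarrow> complex vec \<Rightarrow> complex) \<Rightarrow> bool" where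
  "hermitian_inner_product d ip \<longleftrightarrow>
     (\<forall>x\<in>carrier_vec d. \<forall>y\<in>carrier_vec d. \<forall>z\<in>carrier_vec d. ip x (y + z) = ip x y + ip x z) \<and>
     (\<forall>x\<in>carrier_vec d. \<forall>y\<in>carrier_vec d. \<forall>a. ip x (a \<cdot>\<^sub>v y) = a * ip x y) \<and>
     (\<forall>x\<in>carrier_vec d. \<forall>y\<in>carrier_vec d. ip y x = cnj (ip x y)) \<and>
     (\<forall>x\<in>carrier_vec d. x \<noteq> 0\<^sub>v d \<longrightarrow> Re (ip x x) > 0)"

definition unitary_invariant ::
    "nat \<Rightarrow> nat \<Rightarrow> (complex mat \<Rightarrow> complex mat) \<Rightarrow> (complex vec \<Rightarrow> complex vec \<Rightarrow> complex) \<Rightarrow> bool" where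
  "unitary_invariant n d \<pi> ip \<longleftrightarrow>
     (\<forall>u\<in>unitary_group n. \<forall>x\<in>carrier_vec d. \<forall>y\<in>carrier_vec d.
        ip (\<pi> u *\<^sub>v x) (\<pi> u *\<^sub>v y) = ip x y)"

definition ip_norm :: "(complex vec \<Rightarrow> complex vec \<Rightarrow> complex) \<Rightarrow> complex vec \<Rightarrow> real" where
  "ip_norm ip x = sqrt (Re (ip x x))"

definition moment_map ::
    "nat \<Rightarrow> (complex mat \<Rightarrow> complex mat) \<Rightarrow> (complex vec \<Rightarrow> complex vec \<Rightarrow> complex) \<Rightarrow>
     complex vec \<Rightarrow> complex mat" where
  "moment_map n \<pi> ip v = (THE M. M \<in> Herm n \<and>
     (\<forall>H\<in>Herm n. \<exists>D.
        ((\<lambda>t. ln (ip_norm ip (\<pi> (mat_exp (complex_of_real t \<cdot>\<^sub>m H)) *\<^sub>v v)))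
           has_real_derivative D) (at 0) \<and>
        tr (M * H) = complex_of_real D))"

definition invariant_subspace ::
    "nat \<Rightarrow> nat \<Rightarrow> (complex mat \<Rightarrow> complex mat) \<Rightarrow> complex vec set \<Rightarrow> bool" where
  "invariant_subspace n d \<pi> W \<longleftrightarrow>
     VectorSpace.subspace class_ring W (module_vec TYPE(complex) d) \<and>
     (\<forall>g\<in>GL n. \<forall>w\<in>W. \<pi> g *\<^sub>v w \<in> W)"

definition irreducible_subrepresentation ::
    "nat \<Rightarrow> nat \<Rightarrow> (complex mat \<Rightarrow> complex mat) \<Rightarrow> complex vec set \<Rightarrow> bool" where
  "irreducible_subrepresentation n d \<pi> W \<longleftrightarrow>
     invariant_subspace n d \<pi> W \<and> W \<noteq> {0\<^sub>v d} \<and>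
     (\<forall>U. invariant_subspace n d \<pi> U \<and> U \<subseteq> W \<longrightarrow> U = {0\<^sub>v d} \<or> U = W)"

definition highest_weight_vector ::
    "nat \<Rightarrow> nat \<Rightarrow> (complex mat \<Rightarrow> complex mat) \<Rightarrow> int vec \<Rightarrow> complex vec \<Rightarrow> bool" where
  "highest_weight_vector n d \<pi> \<omega> w \<longleftrightarrow>
     \<omega> \<in> carrier_vec n \<and> w \<in> carrier_vec d \<and> w \<noteq> 0\<^sub>v d \<and>
     (\<forall>u\<in>carrier_mat n n. upper_triangular u \<and> (\<forall>i<n. u $$ (i, i) = 1) \<longrightarrow> \<pi> u *\<^sub>v w = w) \<and>
     (\<forall>h\<in>GL n. diagonal_mat h \<longrightarrow> \<pi> h *\<^sub>v w = (\<Prod>i<n. (h $$ (i, i)) powi (\<omega> $ i)) \<cdot>\<^sub>v w)"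

definition highest_weights :: "nat \<Rightarrow> nat \<Rightarrow> (complex mat \<Rightarrow> complex mat) \<Rightarrow> int vec set" where
  "highest_weights n d \<pi> =
     {\<omega>. \<exists>W. irreducible_subrepresentation n d \<pi> W \<and> (\<exists>w\<in>W. highest_weight_vector n d \<pi> \<omega> w)}"

definition weight_norm :: "nat \<Rightarrow> nat \<Rightarrow> (complex mat \<Rightarrow> complex mat) \<Rightarrow> real" where
  "weight_norm n d \<pi> = Max ((\<lambda>\<omega>. l2_norm (map_vec real_of_int \<omega>)) ` highest_weights n d \<pi>)"

definition common_denominator :: "rat vec \<Rightarrow> nat" where
  "common_denominator p = (LEAST l. l > 0 \<and> (\<forall>i<dim_vec p. of_nat l * p $ i \<in> \<int>))"

text \<open>The weight \<open>\<lambda>\<^sup>*\<close> for \<open>\<lambda> = \<ell> p\<close>; the floor is only a conversion, since \<open>\<ell> p\<close> is integral.\<close>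

definition dual_weight :: "rat vec \<Rightarrow> int vec" where
  "dual_weight p = vec (dim_vec p)
     (\<lambda>i. - \<lfloor>of_nat (common_denominator p) * p $ (dim_vec p - 1 - i)\<rfloor>)"

text \<open>\<open>\<rho>\<close>, \<open>ip\<close>, \<open>w\<close> on \<open>carrier_vec e\<close> are a model of the irreducible representation
  of highest weight \<open>\<omega>\<close>, an invariant inner product on it and a
  unit highest weight vector.  These data are unique up to isometric isomorphism, scaling of the
  inner product and a phase of \<open>w\<close>, none of which affects the capacity below.\<close>

definition highest_weight_model ::
    "nat \<Rightarrow> int vec \<Rightarrow> nat \<Rightarrow> (complex mat \<Rightarrow> complex mat) \<Rightarrow>
     (complex vec \<Rightarrow> complex vec \<Rightarrow> complex) \<Rightarrow> complex vec \<Rightarrow> bool" where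
  "highest_weight_model n \<omega> e \<rho> ip w \<longleftrightarrow>
     rational_representation n e \<rho> \<and>
     irreducible_subrepresentation n e \<rho> (carrier_vec e) \<and>
     hermitian_inner_product e ip \<and> unitary_invariant n e \<rho> ip \<and>
     highest_weight_vector n e \<rho> \<omega> w \<and> ip_norm ip w = 1"

text \<open>To be used with \<open>\<rho>\<close>, \<open>ip'\<close>, \<open>w\<close> a model of highest weight \<open>dual_weight p\<close>.\<close>

definition capacity ::
    "nat \<Rightarrow> (complex mat \<Rightarrow> complex mat) \<Rightarrow> (complex vec \<Rightarrow> complex vec \<Rightarrow> complex) \<Rightarrow>
     (complex mat \<Rightarrow> complex mat) \<Rightarrow> (complex vec \<Rightarrow> complex vec \<Rightarrow> complex) \<Rightarrow> complex vec \<Rightarrow>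
     rat vec \<Rightarrow> complex vec \<Rightarrow> real" where
  "capacity n \<pi> ip \<rho> ip' w p v =
     (INF g\<in>GL n. ip_norm ip (\<pi> g *\<^sub>v v) *
                  ip_norm ip' (\<rho> g *\<^sub>v w) powr (1 / real (common_denominator p)))"

definition target_diag :: "rat vec \<Rightarrow> complex mat" where
  "target_diag p = mat_diag (dim_vec p) (\<lambda>i. of_rat (p $ (dim_vec p - 1 - i)))"

definition gradient ::
    "nat \<Rightarrow> (complex mat \<Rightarrow> complex mat) \<Rightarrow> (complex vec \<Rightarrow> complex vec \<Rightarrow> complex) \<Rightarrow>
     rat vec \<Rightarrow> complex vec \<Rightarrow> complex mat \<Rightarrow> complex mat \<Rightarrow> complex mat" where
  "gradient n \<pi> ip p v g Q =
     moment_map n \<pi> ip (\<pi> g *\<^sub>v v) - Q * target_diag p * mat_adjoint Q"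

text \<open>Neither the decompositions \<open>g\<^sub>t = Q\<^sub>t R\<^sub>t\<close> nor the minimizing index \<open>t\<close> are unique, so runs and
  outputs are given as relations.\<close>

definition algorithm_run ::
    "nat \<Rightarrow> (complex mat \<Rightarrow> complex mat) \<Rightarrow> (complex vec \<Rightarrow> complex vec \<Rightarrow> complex) \<Rightarrow>
     rat vec \<Rightarrow> complex vec \<Rightarrow> real \<Rightarrow> nat \<Rightarrow>
     (nat \<Rightarrow> complex mat) \<Rightarrow> (nat \<Rightarrow> complex mat) \<Rightarrow> (nat \<Rightarrow> complex mat) \<Rightarrow> bool" where
  "algorithm_run n \<pi> ip p v \<eta> T g Q R \<longleftrightarrow>
     g 0 = 1\<^sub>m n \<and>
     (\<forall>t<T. Q t \<in> unitary_group n \<and> R t \<in> carrier_mat n n \<and> upper_triangular (R t) \<and>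
        g t = Q t * R t \<and>
        g (Suc t) = mat_exp (complex_of_real (- \<eta>) \<cdot>\<^sub>m gradient n \<pi> ip p v (g t) (Q t)) * g t)"

definition algorithm_output ::
    "nat \<Rightarrow> (complex mat \<Rightarrow> complex mat) \<Rightarrow> (complex vec \<Rightarrow> complex vec \<Rightarrow> complex) \<Rightarrow>
     rat vec \<Rightarrow> complex vec \<Rightarrow> real \<Rightarrow> nat \<Rightarrow> complex mat \<Rightarrow> bool" where
  "algorithm_output n \<pi> ip p v \<eta> T g' \<longleftrightarrow>
     (\<exists>g Q R. algorithm_run n \<pi> ip p v \<eta> T g Q R \<and>
        (\<exists>t<T. g' = g t \<and>
           (\<forall>s<T. frobenius_norm (gradient n \<pi> ip p v (g t) (Q t))
                   \<le> frobenius_norm (gradient n \<pi> ip p v (g s) (Q s)))))"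

end

theory Submission
  imports Defs
begin

text \<open>The algorithm is gradient descent for the potential
  \<open>\<Phi>(g) = log \<parallel>\<pi>(g) v\<parallel> + log \<parallel>\<rho>(g) w\<parallel> / l\<close>, where \<open>l\<close> is the common denominator of \<open>p\<close>.  It
  vanishes at the identity, and its infimum over \<open>GL n\<close> is the logarithm of the capacity.  Along a curve
  \<open>s \<mapsto> exp(s H) g\<close> with \<open>H\<close> Hermitian, diagonalising \<open>H\<close> and splitting the vector into weight components shows
  that both summands have the form \<open>log (\<Sum> c\<^sub>\<omega> exp (2 s \<langle>\<omega>, D\<rangle>)) / 2\<close> with \<open>c\<^sub>\<omega> \<ge> 0\<close>, where \<open>D\<close> are the eigenvalues of \<open>H\<close>
  and \<open>\<omega>\<close> runs through the weights (\<open>ln_norm_exp\<close>).  The first derivative of such a function is the mean of the exponents, the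
  second one twice their variance.

  The derivative of the first summand is \<open>tr (\<mu> H)\<close> by definition of the moment map.  The moment map exists because the matrix
  coefficients of \<open>\<pi>\<close> are rational functions, so that the derivative is linear in \<open>H\<close> (\<open>has_moment_exists\<close>).  The second
  derivative is at most \<open>2 N\<^sup>2 \<parallel>H\<parallel>\<^sup>2\<close>, where \<open>N\<close> is the weight norm, once every weight is known to be at most as long as
  some highest weight (\<open>weight_norm_bound\<close>).  For this, take a weight of maximal length and permute it into a dominant one.
  A unitriangular matrix can only add positive roots to it, which produces longer weights; hence its weight vectors are fixed
  by unitriangular matrices, and the span of the orbit of such a vector is irreducible
  (\<open>extremal_orbit_span_irreducible\<close>).

  For the second summand write \<open>g = Q R\<close>.  A highest weight vector \<open>w\<close> is an eigenvector of \<open>\<rho>(R)\<close>, so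
  \<open>log \<parallel>\<rho>(g) w\<parallel>\<close> is the combination of the \<open>log \<bar>R\<^sub>i\<^sub>i\<bar>\<close> whose coefficients are the entries of the highest weight.  Since
  \<open>\<bar>R\<^sub>i\<^sub>i\<bar>\<close> is at most the norm of the \<open>i\<close>-th column and the product of all of them is \<open>\<bar>det g\<bar>\<close>, dominance of the weight
  gives an upper bound in terms of column norms along the curve that is attained at \<open>s = 0\<close>
  (\<open>coherent_upper_bound\<close>).  Comparing the first two derivatives there, and moving the base point along the curve, yields the derivative
  \<open>- tr (Q \<Lambda> Q\<^sup>\<dagger> H)\<close> of the second summand of \<open>\<Phi>\<close> and the bound \<open>2 (p\<^sub>1 - p\<^sub>n) \<parallel>H\<parallel>\<^sup>2 \<le> 3 \<parallel>p\<parallel> \<parallel>H\<parallel>\<^sup>2\<close> for its second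
  derivative, linear in \<open>p\<close> (\<open>coherent_quadratic_bound\<close>).

  Hence \<open>G = \<mu> - Q \<Lambda> Q\<^sup>\<dagger>\<close> is the gradient of \<open>\<Phi>\<close>, and a step of size \<open>1 / (2 N2)\<close>, with \<open>N2 = N\<^sup>2 + \<parallel>p\<parallel>\<close>, decreases \<open>\<Phi>\<close> by at
  least \<open>\<parallel>G\<parallel>\<^sup>2 / (8 N2)\<close>.  The total decrease is at most \<open>\<bar>log cap\<bar>\<close>, so \<open>8 N2 \<bar>log cap\<bar> / \<epsilon>\<^sup>2\<close> steps produce a gradient of
  norm at most \<open>\<epsilon>\<close> (\<open>min_gradient_bound\<close>).  As \<open>Q \<Lambda> Q\<^sup>\<dagger>\<close> has spectrum \<open>p\<close>, the Hoffman--Wielandt inequality turns this into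
  the bound on the spectrum of the moment map.\<close>

section \<open>Unitary, triangular and Hermitian matrices\<close>

text \<open>Matrix products are expanded into sums over indices instead of scalar products of rows and
  columns.\<close>

declare index_mult_mat(1) [simp del] index_mult_mat_vec [simp del]

lemma index_mult_sum:
  assumes "A \<in> carrier_mat nr n" "B \<in> carrier_mat n nc" "i < nr" "j < nc"
  shows "(A * B) $$ (i, j) = (\<Sum>k<n. A $$ (i, k) * B $$ (k, j))"
  using assms by (simp add: scalar_prod_def atLeast0LessThan index_mult_mat(1))

lemma index_mult_vec_sum:
  assumes "A \<in> carrier_mat nr n" "x \<in> carrier_vec n" "i < nr"
  shows "(A *\<^sub>v x) $ i = (\<Sum>k<n. A $$ (i, k) * x $ k)"
  using assms by (simp add: scalar_prod_def atLeast0LessThan index_mult_mat_vec)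

lemma mult_carrier_square [simp]:
  "A \<in> carrier_mat n n \<Longrightarrow> B \<in> carrier_mat n n \<Longrightarrow> A * B \<in> carrier_mat n n"
  by auto

lemma mat_adjoint_dim [simp]:
  "dim_row (mat_adjoint (A :: complex mat)) = dim_col A"
  "dim_col (mat_adjoint (A :: complex mat)) = dim_row A"
  unfolding mat_adjoint_def by auto

lemma mat_adjoint_carrier [simp]:
  "A \<in> carrier_mat n m \<Longrightarrow> mat_adjoint (A :: complex mat) \<in> carrier_mat m n"
  by auto

lemma mat_adjoint_index [simp]:
  assumes "i < dim_col A" "j < dim_row A"
  shows "mat_adjoint A $$ (i, j) = cnj (A $$ (j, i) :: complex)"
  using assms unfolding mat_adjoint_def by (simp add: mat_of_rows_def)

lemma mat_adjoint_adjoint [simp]: "mat_adjoint (mat_adjoint A) = (A :: complex mat)"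
  by (rule eq_matI) auto

lemma mat_adjoint_mult:
  assumes "A \<in> carrier_mat n m" "B \<in> carrier_mat m l"
  shows "mat_adjoint (A * B) = mat_adjoint B * mat_adjoint (A :: complex mat)"
proof (rule eq_matI)
  fix i j assume "i < dim_row (mat_adjoint B * mat_adjoint A)" "j < dim_col (mat_adjoint B * mat_adjoint A)"
  then have ij: "i < l" "j < n" using assms by auto
  have "mat_adjoint (A * B) $$ (i, j) = cnj (\<Sum>k<m. A $$ (j, k) * B $$ (k, i))"
    using assms ij by (simp add: index_mult_sum[OF assms])
  moreover have "(mat_adjoint B * mat_adjoint A) $$ (i, j) = (\<Sum>k<m. mat_adjoint B $$ (i, k) * mat_adjoint A $$ (k, j))"
    using assms ij by (intro index_mult_sum[of _ l m _ n]) auto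
  ultimately show "mat_adjoint (A * B) $$ (i, j) = (mat_adjoint B * mat_adjoint A) $$ (i, j)"
    using assms ij by (simp add: mult.commute)
qed (use assms in auto)

lemma mat_diag_index [simp]:
  "i < n \<Longrightarrow> j < n \<Longrightarrow> mat_diag n f $$ (i, j) = (if i = j then f j else 0)"
  "dim_row (mat_diag n f) = n" "dim_col (mat_diag n f) = n"
  by (auto simp: mat_diag_def)

lemma mat_adjoint_diag [simp]:
  "mat_adjoint (mat_diag n f) = mat_diag n (\<lambda>i. cnj (f i))"
  by (rule eq_matI) auto

lemma mat_adjoint_one [simp]: "mat_adjoint (1\<^sub>m n) = (1\<^sub>m n :: complex mat)"
  using mat_adjoint_diag[of n "\<lambda>_. 1"] by simp

lemma GL_carrier: "g \<in> GL n \<Longrightarrow> g \<in> carrier_mat n n"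
  by (simp add: GL_def)

lemma GL_I:
  assumes "g \<in> carrier_mat n n" "h \<in> carrier_mat n n" "g * h = 1\<^sub>m n"
  shows "g \<in> GL n"
  using assms mat_mult_left_right_inverse[OF assms] unfolding GL_def invertible_mat_def inverts_mat_def
  by (auto simp: square_mat.simps)

lemma GL_I':
  assumes "g \<in> carrier_mat n n" "h \<in> carrier_mat n n" "h * g = 1\<^sub>m n"
  shows "g \<in> GL n"
  using GL_I[OF assms(1,2)] mat_mult_left_right_inverse[OF assms(2,1,3)] by blast

lemma GL_obtain_inverse:
  assumes "g \<in> GL n"
  obtains h where "h \<in> GL n" "g * h = 1\<^sub>m n" "h * g = 1\<^sub>m n"
proof -
  obtain h where h: "inverts_mat g h" "inverts_mat h g" and g: "g \<in> carrier_mat n n"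
    using assms unfolding GL_def invertible_mat_def by auto
  have "h \<in> carrier_mat n n"
    using h g unfolding inverts_mat_def
    by (metis carrier_matD carrier_matI index_mult_mat(2,3) index_one_mat(2,3))
  moreover have "g * h = 1\<^sub>m n" "h * g = 1\<^sub>m n"
    using h g calculation unfolding inverts_mat_def by auto
  ultimately show ?thesis using that GL_I g by metis
qed

lemma GL_one [simp]: "1\<^sub>m n \<in> GL n"
  by (rule GL_I[of _ _ "1\<^sub>m n"]) auto

lemma GL_mult:
  assumes "g \<in> GL n" "h \<in> GL n"
  shows "g * h \<in> GL n"
proof -
  obtain g' where g': "g' \<in> GL n" "g * g' = 1\<^sub>m n" using GL_obtain_inverse[OF assms(1)] by metis
  obtain h' where h': "h' \<in> GL n" "h * h' = 1\<^sub>m n" using GL_obtain_inverse[OF assms(2)] by metis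
  note c = GL_carrier[OF assms(1)] GL_carrier[OF assms(2)] GL_carrier[OF g'(1)] GL_carrier[OF h'(1)]
  have "g * h * (h' * g') = g * (h * (h' * g'))"
    using c by (intro assoc_mult_mat) auto
  also have "h * (h' * g') = (h * h') * g'"
    using c by (intro assoc_mult_mat[symmetric]) auto
  finally have "g * h * (h' * g') = 1\<^sub>m n" using c g' h' by simp
  then show ?thesis using c by (intro GL_I[of _ _ "h' * g'"]) auto
qed

lemma GL_det: "g \<in> GL n \<Longrightarrow> det g \<noteq> (0 :: complex)"
  by (metis GL_obtain_inverse GL_carrier det_mult det_one mult_zero_left zero_neq_one)

lemma GL_diag:
  assumes "\<And>i. i < n \<Longrightarrow> f i \<noteq> 0"
  shows "mat_diag n f \<in> GL n"
proof (rule GL_I[of _ _ "mat_diag n (\<lambda>i. inverse (f i))"])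
  show "mat_diag n f * mat_diag n (\<lambda>i. inverse (f i)) = 1\<^sub>m n"
    using assms by (intro eq_matI) auto
qed auto

lemma unitary_carrier: "u \<in> unitary_group n \<Longrightarrow> u \<in> carrier_mat n n"
  by (simp add: unitary_group_def)

lemma unitary_adj_mult: "u \<in> unitary_group n \<Longrightarrow> mat_adjoint u * u = 1\<^sub>m n"
  by (simp add: unitary_group_def)

lemma unitary_mult_adj: "u \<in> unitary_group n \<Longrightarrow> u * mat_adjoint u = 1\<^sub>m n"
  unfolding unitary_group_def by (auto intro!: mat_mult_left_right_inverse)

lemma unitary_GL: "u \<in> unitary_group n \<Longrightarrow> u \<in> GL n"
  using unitary_carrier unitary_adj_mult by (blast intro: GL_I' mat_adjoint_carrier)

lemma unitary_adjoint: "u \<in> unitary_group n \<Longrightarrow> mat_adjoint u \<in> unitary_group n"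
  using unitary_mult_adj unitary_carrier[of u n]
  by (auto simp: unitary_group_def)

lemma unitary_one [simp]: "1\<^sub>m n \<in> unitary_group n"
  by (simp add: unitary_group_def)

lemma unitary_cancel:
  assumes "u \<in> unitary_group n" "A \<in> carrier_mat n m"
  shows "mat_adjoint u * (u * A) = A" "u * (mat_adjoint u * A) = A"
proof -
  note c = unitary_carrier[OF assms(1)] mat_adjoint_carrier[OF unitary_carrier[OF assms(1)]] assms(2)
  show "mat_adjoint u * (u * A) = A"
    using assoc_mult_mat[OF c(2,1,3)] unitary_adj_mult[OF assms(1)] c by simp
  show "u * (mat_adjoint u * A) = A"
    using assoc_mult_mat[OF c(1,2,3)] unitary_mult_adj[OF assms(1)] c by simp
qed

lemma unitary_mult:
  assumes "u \<in> unitary_group n" "v \<in> unitary_group n"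
  shows "u * v \<in> unitary_group n"
proof -
  note c = unitary_carrier[OF assms(1)] unitary_carrier[OF assms(2)]
  have "mat_adjoint (u * v) * (u * v) = mat_adjoint v * (mat_adjoint u * (u * v))"
    using c by (simp add: mat_adjoint_mult[of u n n v n] assoc_mult_mat[of _ n n _ n _ n])
  also have "\<dots> = 1\<^sub>m n"
    using unitary_cancel[OF assms(1) c(2)] unitary_adj_mult[OF assms(2)] by simp
  finally show ?thesis using c by (simp add: unitary_group_def)
qed

lemma GL_adjoint:
  assumes "g \<in> GL n"
  shows "mat_adjoint g \<in> GL n"
proof -
  obtain h where h: "h \<in> GL n" "h * g = 1\<^sub>m n" using GL_obtain_inverse[OF assms] by metis
  note c = GL_carrier[OF assms] GL_carrier[OF h(1)]
  have "mat_adjoint g * mat_adjoint h = 1\<^sub>m n"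
    using mat_adjoint_mult[OF c(2,1)] h by simp
  then show ?thesis using c by (intro GL_I[of _ _ "mat_adjoint h"]) auto
qed

text \<open>The unitary factor of a QR decomposition is built column by column.  The Householder
  reflection for column \<open>k\<close> is along a vector supported on the coordinates from \<open>k\<close> on; it
  therefore fixes the earlier columns, which are already supported before \<open>k\<close>.\<close>

lemma householder_step:
  fixes A :: "complex mat"
  assumes A: "A \<in> carrier_mat n n" and k: "k < n"
    and tri: "\<And>i j. j < k \<Longrightarrow> i < n \<Longrightarrow> j < i \<Longrightarrow> A $$ (i, j) = 0"
  shows "\<exists>P\<in>unitary_group n. \<forall>j\<le>k. \<forall>i<n. j < i \<longrightarrow> (P * A) $$ (i, j) = 0"
proof (cases "\<forall>i<n. k < i \<longrightarrow> A $$ (i, k) = 0")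
  case True
  then show ?thesis using A tri by (intro bexI[of _ "1\<^sub>m n"]) (auto simp: le_less)
next
  case False
  then obtain i0 where i0: "i0 < n" "k < i0" "A $$ (i0, k) \<noteq> 0" by auto
  define x where "x i = (if k \<le> i then A $$ (i, k) else 0)" for i
  define r where "r = sqrt (\<Sum>i<n. (cmod (x i))\<^sup>2)"
  have r2: "r\<^sup>2 = (\<Sum>i<n. (cmod (x i))\<^sup>2)" unfolding r_def by (simp add: sum_nonneg)
  have "(cmod (x i0))\<^sup>2 \<le> (\<Sum>i<n. (cmod (x i))\<^sup>2)"
    using i0 by (intro member_le_sum) auto
  moreover have "cmod (x i0) > 0" using i0 unfolding x_def by simp
  ultimately have "r\<^sup>2 > 0" unfolding r2 by (smt (verit) zero_less_power)
  then have r: "r > 0" using r_def by (smt (verit) real_sqrt_ge_zero r2 zero_less_power2 sum_nonneg zero_le_power2)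
  \<comment> \<open>\<open>c\<close> has the phase of \<open>x k\<close>, so that nothing cancels in \<open>v\<close>; \<open>\<beta>\<close> is half the squared norm of \<open>v\<close>\<close>
  define c where "c = (if x k = 0 then 1 else x k / cmod (x k))"
  have c: "cnj c * c = 1" "cnj c * x k = cmod (x k)"
    proof -
    show "cnj c * c = 1"
      using complex_norm_square[of c] by (simp add: c_def norm_divide mult.commute split: if_splits)
    show "cnj c * x k = cmod (x k)"
      using complex_norm_square[of "x k"] by (auto simp: c_def field_simps power2_eq_square)
  qed
  define \<beta> where "\<beta> = r * (r + cmod (x k))"
  have \<beta>: "\<beta> > 0" unfolding \<beta>_def using r by (simp add: add_pos_nonneg)
  define v where "v i = x i + (if i = k then c * r else 0)" for i
  have vsupp: "v i = 0" if "i < k" for i using that by (simp add: v_def x_def)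
  have cxk: "c * cnj (x k) = cmod (x k)" using arg_cong[OF c(2), of cnj] by simp
  have xk2: "(\<Sum>i<n. cnj (x i) * x i) = r\<^sup>2"
  proof -
    have "(\<Sum>i<n. cnj (x i) * x i) = (\<Sum>i<n. of_real ((cmod (x i))\<^sup>2))"
      by (intro sum.cong refl) (simp add: complex_norm_square mult.commute del: of_real_power)
    then show ?thesis unfolding r2 by simp
  qed
  have vx: "(\<Sum>i<n. cnj (v i) * x i) = \<beta>"
  proof -
    have "(\<Sum>i<n. cnj (v i) * x i) = (\<Sum>i<n. cnj (x i) * x i + (if i = k then cnj c * r * x i else 0))"
      by (intro sum.cong refl) (simp add: v_def algebra_simps)
    also have "\<dots> = r\<^sup>2 + cnj c * x k * r"
      using k xk2 by (simp add: sum.distrib)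
    also have "\<dots> = \<beta>" unfolding c \<beta>_def by (simp add: algebra_simps power2_eq_square)
    finally show ?thesis .
  qed
  have vv: "(\<Sum>i<n. cnj (v i) * v i) = 2 * \<beta>"
  proof -
    have "(\<Sum>i<n. cnj (v i) * v i) = (\<Sum>i<n. cnj (v i) * x i + (if i = k then cnj (v i) * (c * r) else 0))"
      by (intro sum.cong refl) (simp add: v_def algebra_simps)
    also have "\<dots> = \<beta> + cnj (v k) * (c * r)"
      using k vx by (simp add: sum.distrib)
    also have "cnj (v k) * (c * r) = c * cnj (x k) * r + cnj c * c * r * r"
      by (simp add: v_def algebra_simps)
    also have "\<beta> + \<dots> = 2 * \<beta>" unfolding c cxk \<beta>_def by (simp add: algebra_simps)
    finally show ?thesis .
  qed
  define P where "P = mat n n (\<lambda>(i, j). (if i = j then 1 else 0) - v i * cnj (v j) / \<beta>)"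
  have P: "P \<in> carrier_mat n n" unfolding P_def by simp
  have PA: "(P * A) $$ (i, j) = A $$ (i, j) - v i * (\<Sum>l<n. cnj (v l) * A $$ (l, j)) / \<beta>"
    if "i < n" "j < n" for i j
  proof -
    have "(P * A) $$ (i, j) = (\<Sum>l<n. (if l = i then A $$ (l, j) else 0) - v i * (cnj (v l) * A $$ (l, j)) / \<beta>)"
      unfolding index_mult_sum[OF P A that] using that
      by (intro sum.cong refl) (auto simp: P_def algebra_simps)
    then show ?thesis using that
      by (simp add: sum_subtractf sum_distrib_left sum_divide_distrib)
  qed
  have "P \<in> unitary_group n"
  proof -
    have adj: "mat_adjoint P = P"
      by (rule eq_matI) (use P mat_adjoint_carrier[OF P] in \<open>auto simp: P_def\<close>)
    have "P * P = 1\<^sub>m n"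
    proof (rule eq_matI)
      fix i j assume "i < dim_row (1\<^sub>m n :: complex mat)" "j < dim_col (1\<^sub>m n :: complex mat)"
      then have ij: "i < n" "j < n" by auto
      have "(P * P) $$ (i, j) = (\<Sum>l<n. (if l = i then P $$ (l, j) else 0)
          - v i / \<beta> * ((if l = j then cnj (v l) else 0) - (cnj (v l) * v l) * cnj (v j) / \<beta>))"
        unfolding index_mult_sum[OF P P ij] using ij
        by (intro sum.cong refl) (auto simp: P_def algebra_simps)
      also have "\<dots> = P $$ (i, j) - v i / \<beta> * (cnj (v j) - (\<Sum>l<n. cnj (v l) * v l) * cnj (v j) / \<beta>)"
        using ij by (simp add: sum_subtractf sum_distrib_left[symmetric] sum_divide_distrib[symmetric] sum_distrib_right[symmetric])
      also have "\<dots> = 1\<^sub>m n $$ (i, j)"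
        unfolding vv using \<beta> ij by (auto simp: P_def field_simps)
      finally show "(P * P) $$ (i, j) = 1\<^sub>m n $$ (i, j)" .
    qed (use P in auto)
    then show ?thesis using P adj by (simp add: unitary_group_def)
  qed
  moreover have "(P * A) $$ (i, j) = 0" if ij: "j \<le> k" "i < n" "j < i" for i j
  proof (cases "j = k")
    case True
    have "(\<Sum>l<n. cnj (v l) * A $$ (l, j)) = (\<Sum>l<n. cnj (v l) * x l)"
      using vsupp True by (intro sum.cong refl) (auto simp: x_def)
    then show ?thesis using PA[of i j] ij k \<beta> vx True by (simp add: v_def x_def)
  next
    case False
    have "(\<Sum>l<n. cnj (v l) * A $$ (l, j)) = 0"
    proof (rule sum.neutral, rule ballI)
      fix l assume "l \<in> {..<n}"
      then show "cnj (v l) * A $$ (l, j) = 0"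
        using vsupp[of l] tri[of j l] False ij by (cases "l < k") auto
    qed
    then show ?thesis using PA[of i j] tri[of j i] ij k False by simp
  qed
  ultimately show ?thesis by blast
qed

lemma QR_exists:
  fixes A :: "complex mat"
  assumes A: "A \<in> carrier_mat n n"
  shows "\<exists>Q R. Q \<in> unitary_group n \<and> R \<in> carrier_mat n n \<and> upper_triangular R \<and> A = Q * R"
proof -
  have "k \<le> n \<Longrightarrow> \<exists>P\<in>unitary_group n. \<forall>j<k. \<forall>i<n. j < i \<longrightarrow> (P * A) $$ (i, j) = 0" for k
  proof (induction k)
    case (Suc k)
    then obtain P where P: "P \<in> unitary_group n" "\<forall>j<k. \<forall>i<n. j < i \<longrightarrow> (P * A) $$ (i, j) = 0"
      by auto
    have "P * A \<in> carrier_mat n n" using unitary_carrier[OF P(1)] A by simp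
    from householder_step[OF this, of k] Suc.prems P
    obtain P' where P': "P' \<in> unitary_group n" "\<forall>j\<le>k. \<forall>i<n. j < i \<longrightarrow> (P' * (P * A)) $$ (i, j) = 0"
      by auto
    have "P' * (P * A) = (P' * P) * A"
      using unitary_carrier[OF P(1)] unitary_carrier[OF P'(1)] A by simp
    then show ?case using P' unitary_mult[OF P'(1) P(1)]
      by (intro bexI[of _ "P' * P"]) (auto simp: less_Suc_eq_le)
  qed (use unitary_one in blast)
  then obtain P where P: "P \<in> unitary_group n" "\<forall>j<n. \<forall>i<n. j < i \<longrightarrow> (P * A) $$ (i, j) = 0"
    by blast
  have PA: "P * A \<in> carrier_mat n n" using unitary_carrier[OF P(1)] A by simp
  have "upper_triangular (P * A)" using P PA by (intro upper_triangularI) auto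
  moreover have "A = mat_adjoint P * (P * A)" using unitary_cancel[OF P(1) A] by simp
  ultimately show ?thesis using unitary_adjoint[OF P(1)] PA by blast
qed

lemma upper_triangularD0:
  "upper_triangular R \<Longrightarrow> R \<in> carrier_mat n n \<Longrightarrow> i < n \<Longrightarrow> j < i \<Longrightarrow> R $$ (i, j) = 0"
  by auto

text \<open>For a product \<open>T * R\<close> equal to the identity this says that the inverse of a triangular matrix is
  triangular; in general it follows by comparing the columns from left to right.\<close>

lemma upper_triangular_right_cancel:
  fixes T :: "complex mat"
  assumes T: "T \<in> carrier_mat n n" and R: "R \<in> carrier_mat n n" "upper_triangular R"
    and nz: "\<And>i. i < n \<Longrightarrow> R $$ (i, i) \<noteq> 0" and TR: "upper_triangular (T * R)"
  shows "upper_triangular T"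
proof -
  have "j < i \<Longrightarrow> i < n \<Longrightarrow> T $$ (i, j) = 0" for i j
  proof (induction j rule: less_induct)
    case (less j)
    have "0 = (T * R) $$ (i, j)" using TR T R less.prems by auto
    also have "\<dots> = (\<Sum>k<n. T $$ (i, k) * R $$ (k, j))"
      using less.prems by (intro index_mult_sum[OF T R(1)]) auto
    also have "\<dots> = (\<Sum>k<n. if k = j then T $$ (i, j) * R $$ (j, j) else 0)"
    proof (rule sum.cong[OF refl])
      fix k assume k: "k \<in> {..<n}"
      show "T $$ (i, k) * R $$ (k, j) = (if k = j then T $$ (i, j) * R $$ (j, j) else 0)"
        using less.IH[of k] less.prems upper_triangularD0[OF R(2,1), of k j] k
        by (cases "k < j"; cases "k = j") auto
    qed
    also have "\<dots> = T $$ (i, j) * R $$ (j, j)" using less.prems by simp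
    finally show ?case using nz[of j] less.prems by simp
  qed
  then show ?thesis using T by (intro upper_triangularI) auto
qed

lemma upper_triangular_mult:
  fixes A :: "complex mat"
  assumes A: "A \<in> carrier_mat n n" "upper_triangular A" and B: "B \<in> carrier_mat n n" "upper_triangular B"
  shows "upper_triangular (A * B)" and "i < n \<Longrightarrow> (A * B) $$ (i, i) = A $$ (i, i) * B $$ (i, i)"
proof -
  show "upper_triangular (A * B)"
  proof (rule upper_triangularI)
    fix i j assume ij: "j < i" "i < dim_row (A * B)"
    then have i: "i < n" using A by simp
    have "(A * B) $$ (i, j) = (\<Sum>k<n. A $$ (i, k) * B $$ (k, j))"
      using i ij by (intro index_mult_sum[OF A(1) B(1)]) auto
    also have "\<dots> = 0"
    proof (rule sum.neutral, rule ballI)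
      fix k assume "k \<in> {..<n}"
      then show "A $$ (i, k) * B $$ (k, j) = 0"
        using upper_triangularD0[OF A(2,1), of i k] upper_triangularD0[OF B(2,1), of k j] i ij
        by (cases "k < i") auto
    qed
    finally show "(A * B) $$ (i, j) = 0" .
  qed
  assume i: "i < n"
  have "(A * B) $$ (i, i) = (\<Sum>k<n. A $$ (i, k) * B $$ (k, i))"
    using i by (intro index_mult_sum[OF A(1) B(1)]) auto
  also have "\<dots> = (\<Sum>k<n. if k = i then A $$ (i, i) * B $$ (i, i) else 0)"
  proof (rule sum.cong[OF refl])
    fix k assume k: "k \<in> {..<n}"
    show "A $$ (i, k) * B $$ (k, i) = (if k = i then A $$ (i, i) * B $$ (i, i) else 0)"
      using upper_triangularD0[OF A(2,1), of i k] upper_triangularD0[OF B(2,1), of k i] i k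
      by (cases "k < i"; cases "k = i") auto
  qed
  finally show "(A * B) $$ (i, i) = A $$ (i, i) * B $$ (i, i)" using i by simp
qed

lemma upper_triangular_GL_diag:
  assumes "R \<in> GL n" "upper_triangular R" "i < n"
  shows "R $$ (i, i) \<noteq> 0"
  using GL_det[OF assms(1)] upper_triangular_imp_det_eq_0_iff[OF GL_carrier[OF assms(1)] assms(2)]
    assms(3) GL_carrier[OF assms(1)] by (auto simp: diag_mat_def)

text \<open>Orthonormalising the columns of the base change that triangularises a matrix preserves
  triangularity.\<close>

lemma unitary_schur:
  fixes A :: "complex mat"
  assumes A: "A \<in> carrier_mat n n"
  shows "\<exists>u T. u \<in> unitary_group n \<and> T \<in> carrier_mat n n \<and> upper_triangular T \<and> A = u * T * mat_adjoint u"
proof -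
  obtain as where "char_poly A = (\<Prod>a\<leftarrow>as. [:- a, 1:])" using char_poly_factorized[OF A] by auto
  from schur_decomposition_exists[OF A this]
  obtain B where B: "B \<in> carrier_mat n n" "upper_triangular B" "similar_mat A B" by auto
  obtain m P P' where m: "{A, B, P, P'} \<subseteq> carrier_mat m m"
    and P: "P * P' = 1\<^sub>m m" "P' * P = 1\<^sub>m m" "A = P * B * P'"
    using similar_matD[OF B(3)] by auto
  have "m = n" using m A by auto
  note PC = m[unfolded this] and P = P[unfolded \<open>m = n\<close>]
  have Pc: "P \<in> carrier_mat n n" "P' \<in> carrier_mat n n" using PC by auto
  obtain u R where u: "u \<in> unitary_group n" and R: "R \<in> carrier_mat n n" "upper_triangular R"
    and PuR: "P = u * R" using QR_exists[OF Pc(1)] by auto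
  note uc = unitary_carrier[OF u] mat_adjoint_carrier[OF unitary_carrier[OF u]]
  have RP: "R = mat_adjoint u * P" using PuR unitary_cancel[OF u R(1)] by simp
  have PG: "P \<in> GL n" using GL_I[OF Pc P(1)] .
  have RG: "R \<in> GL n"
    unfolding RP using PG unitary_GL[OF unitary_adjoint[OF u]] by (rule GL_mult[rotated])
  define T where "T = mat_adjoint u * A * u"
  have T: "T \<in> carrier_mat n n" unfolding T_def using uc A by simp
  have "T * R = mat_adjoint u * A * (u * R)"
    unfolding T_def using uc A R(1) by (simp add: assoc_mult_mat[of _ n n _ n _ n])
  also have "\<dots> = mat_adjoint u * (P * B * (P' * P))"
    unfolding PuR[symmetric] P(3) using uc Pc B(1) by (simp add: assoc_mult_mat[of _ n n _ n _ n])
  also have "\<dots> = R * B"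
    unfolding RP P(2) using uc Pc B(1) by (simp add: assoc_mult_mat[of _ n n _ n _ n])
  finally have "T * R = R * B" .
  then have "upper_triangular (T * R)" using upper_triangular_mult(1)[OF R B(1,2)] by simp
  from upper_triangular_right_cancel[OF T R upper_triangular_GL_diag[OF RG R(2)] this]
  have "upper_triangular T" by simp
  moreover have "A = u * T * mat_adjoint u"
  proof -
    have "u * T * mat_adjoint u = u * (mat_adjoint u * (A * (u * mat_adjoint u)))"
      unfolding T_def using uc A by (simp add: assoc_mult_mat[of _ n n _ n _ n])
    then show ?thesis using unitary_cancel(2)[OF u A] unitary_mult_adj[OF u] A by simp
  qed
  ultimately show ?thesis using u T by blast
qed

lemma triangular_both_diag:
  fixes T :: "complex mat"
  assumes T: "T \<in> carrier_mat n n" "upper_triangular T" and T': "upper_triangular (mat_adjoint T)"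
  shows "T = mat_diag n (\<lambda>i. T $$ (i, i))"
proof (rule eq_matI)
  fix i j assume "i < dim_row (mat_diag n (\<lambda>i. T $$ (i, i)))" "j < dim_col (mat_diag n (\<lambda>i. T $$ (i, i)))"
  then have ij: "i < n" "j < n" by (auto simp: mat_diag_def)
  show "T $$ (i, j) = mat_diag n (\<lambda>i. T $$ (i, i)) $$ (i, j)"
  proof (cases i j rule: linorder_cases)
    case less
    have "mat_adjoint T $$ (j, i) = 0" using upper_triangularD0[OF T' mat_adjoint_carrier[OF T(1)]] less ij by auto
    then show ?thesis using less ij mat_adjoint_index[of j T i] T by simp
  qed (use T ij in \<open>auto simp: mat_diag_def\<close>)
qed (use T in \<open>auto simp: mat_diag_def\<close>)

lemma Herm_carrier: "H \<in> Herm n \<Longrightarrow> H \<in> carrier_mat n n"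
  by (simp add: Herm_def)

lemma Herm_adjoint: "H \<in> Herm n \<Longrightarrow> mat_adjoint H = H"
  by (simp add: Herm_def)

lemma adjoint_conj:
  assumes "u \<in> carrier_mat n n" "A \<in> carrier_mat n n"
  shows "mat_adjoint (u * A * mat_adjoint u) = u * mat_adjoint A * mat_adjoint (u :: complex mat)"
  using assms by (simp add: mat_adjoint_mult[of _ n n _ n] assoc_mult_mat[of _ n n _ n _ n])

lemma unitary_conj_cancel:
  assumes u: "u \<in> unitary_group n" and "A \<in> carrier_mat n n" "B \<in> carrier_mat n n"
    "u * A * mat_adjoint u = u * B * mat_adjoint u"
  shows "A = B"
proof -
  note uc = unitary_carrier[OF u] mat_adjoint_carrier[OF unitary_carrier[OF u]]
  have *: "mat_adjoint u * (u * C * mat_adjoint u) * u = C" if C: "C \<in> carrier_mat n n" for C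
  proof -
    have "mat_adjoint u * (u * C * mat_adjoint u) * u = mat_adjoint u * (u * (C * (mat_adjoint u * u)))"
      using uc C by (simp add: assoc_mult_mat[of _ n n _ n _ n])
    then show ?thesis using unitary_cancel(1)[OF u C] unitary_adj_mult[OF u] C by simp
  qed
  show ?thesis using *[OF assms(2), unfolded assms(4)] *[OF assms(3)] by (rule trans[OF sym])
qed

lemma Herm_spectral:
  assumes "H \<in> Herm n"
  shows "\<exists>u D. u \<in> unitary_group n \<and> H = u * mat_diag n (\<lambda>i. complex_of_real (D i)) * mat_adjoint u"
proof -
  obtain u T where u: "u \<in> unitary_group n" and T: "T \<in> carrier_mat n n" "upper_triangular T"
    and H: "H = u * T * mat_adjoint u" using unitary_schur[OF Herm_carrier[OF assms]] by auto
  have "u * mat_adjoint T * mat_adjoint u = u * T * mat_adjoint u"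
    using Herm_adjoint[OF assms] adjoint_conj[OF unitary_carrier[OF u] T(1)] H by simp
  then have TT: "mat_adjoint T = T"
    using unitary_conj_cancel[OF u mat_adjoint_carrier[OF T(1)] T(1)] by simp
  then have Td: "T = mat_diag n (\<lambda>i. T $$ (i, i))" by (intro triangular_both_diag T) (simp only: T)
  have "cnj (T $$ (i, i)) = T $$ (i, i)" if "i < n" for i
    using mat_adjoint_index[of i T i] T TT that by simp
  then have "T $$ (i, i) = of_real (Re (T $$ (i, i)))" if "i < n" for i
    using that by (metis Reals_cnj_iff of_real_Re)
  then have "mat_diag n (\<lambda>i. T $$ (i, i)) = mat_diag n (\<lambda>i. of_real (Re (T $$ (i, i))))"
    by (intro eq_matI) auto
  with Td have "T = mat_diag n (\<lambda>i. of_real (Re (T $$ (i, i))))" by (rule trans)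
  then show ?thesis using u H by metis
qed

text \<open>The triangular factor in the Schur form of a unitary matrix is unitary, so its adjoint is its inverse and therefore
  triangular as well.\<close>

lemma unitary_spectral:
  assumes "g \<in> unitary_group n"
  shows "\<exists>u z. u \<in> unitary_group n \<and> (\<forall>i<n. z i \<noteq> 0) \<and> g = u * mat_diag n z * mat_adjoint u"
proof -
  obtain u T where u: "u \<in> unitary_group n" and T: "T \<in> carrier_mat n n" "upper_triangular T"
    and g: "g = u * T * mat_adjoint u" using unitary_schur[OF unitary_carrier[OF assms]] by auto
  note uc = unitary_carrier[OF u] mat_adjoint_carrier[OF unitary_carrier[OF u]]
  have "u * (mat_adjoint T * T) * mat_adjoint u = u * mat_adjoint T * (mat_adjoint u * (u * (T * mat_adjoint u)))"
    using unitary_cancel(1)[OF u, of "T * mat_adjoint u" n] uc T(1)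
    by (simp add: assoc_mult_mat[of _ n n _ n _ n])
  also have "\<dots> = mat_adjoint g * g"
    unfolding g adjoint_conj[OF uc(1) T(1)] using uc T(1) by (simp add: assoc_mult_mat[of _ n n _ n _ n])
  also have "\<dots> = u * 1\<^sub>m n * mat_adjoint u"
    using unitary_adj_mult[OF assms] unitary_mult_adj[OF u] uc by simp
  finally have conj: "u * (mat_adjoint T * T) * mat_adjoint u = u * 1\<^sub>m n * mat_adjoint u" .
  have TT: "mat_adjoint T * T = 1\<^sub>m n"
    by (rule unitary_conj_cancel[OF u _ one_carrier_mat conj]) (simp add: T(1))
  have TG: "T \<in> GL n" using GL_I'[OF T(1) mat_adjoint_carrier[OF T(1)] TT] .
  have "upper_triangular (mat_adjoint T * T)" unfolding TT by simp
  with upper_triangular_GL_diag[OF TG T(2)] have "upper_triangular (mat_adjoint T)"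
    by (rule upper_triangular_right_cancel[OF mat_adjoint_carrier[OF T(1)] T])
  from triangular_both_diag[OF T this] obtain z where z: "T = mat_diag n z" by blast
  have "z i \<noteq> 0" if "i < n" for i
    using upper_triangular_GL_diag[OF TG T(2) that] that unfolding z by simp
  then show ?thesis using u g unfolding z by blast
qed

section \<open>Functions of Hermitian matrices\<close>

text \<open>The normal matrix with eigenvectors the columns of \<open>u\<close> and eigenvalues \<open>f\<close>.  Exponentials, square roots
  and products of commuting matrices act on \<open>f\<close> alone.\<close>

definition udiag :: "nat \<Rightarrow> complex mat \<Rightarrow> (nat \<Rightarrow> complex) \<Rightarrow> complex mat" where
  "udiag n u f = u * mat_diag n f * mat_adjoint u"

abbreviation hdiag :: "nat \<Rightarrow> complex mat \<Rightarrow> (nat \<Rightarrow> real) \<Rightarrow> complex mat" where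
  "hdiag n u D \<equiv> udiag n u (\<lambda>i. complex_of_real (D i))"

lemma udiag_carrier [simp]: "u \<in> unitary_group n \<Longrightarrow> udiag n u f \<in> carrier_mat n n"
  unfolding udiag_def using unitary_carrier[of u n] by simp

lemma udiag_index:
  assumes "u \<in> carrier_mat n n" "i < n" "j < n"
  shows "udiag n u f $$ (i, j) = (\<Sum>k<n. u $$ (i, k) * f k * cnj (u $$ (j, k)))"
proof -
  have *: "u * mat_diag n f \<in> carrier_mat n n" using assms by simp
  have "udiag n u f $$ (i, j) = (\<Sum>k<n. (u * mat_diag n f) $$ (i, k) * mat_adjoint u $$ (k, j))"
    unfolding udiag_def using assms by (intro index_mult_sum[OF *]) auto
  then show ?thesis using assms by (simp add: mat_diag_mult_right[OF assms(1)])
qed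

lemma udiag_cong: "(\<And>i. i < n \<Longrightarrow> f i = g i) \<Longrightarrow> udiag n u f = udiag n u g"
  unfolding udiag_def by (intro arg_cong[of _ _ "\<lambda>x. u * x * mat_adjoint u"] eq_matI) auto

lemma udiag_mult:
  assumes u: "u \<in> unitary_group n"
  shows "udiag n u f * udiag n u g = udiag n u (\<lambda>i. f i * g i)"
proof -
  note c = unitary_carrier[OF u] mat_adjoint_carrier[OF unitary_carrier[OF u]]
  have "udiag n u f * udiag n u g = u * (mat_diag n f * (mat_adjoint u * (u * (mat_diag n g * mat_adjoint u))))"
    unfolding udiag_def using c by (simp add: assoc_mult_mat[of _ n n _ n _ n])
  also have "\<dots> = u * ((mat_diag n f * mat_diag n g) * mat_adjoint u)"
    using c unitary_cancel(1)[OF u, of "mat_diag n g * mat_adjoint u" n]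
    by (simp add: assoc_mult_mat[of _ n n _ n _ n] del: mat_diag_diag)
  also have "\<dots> = udiag n u (\<lambda>i. f i * g i)"
    unfolding udiag_def using c by (simp add: assoc_mult_mat[of _ n n _ n _ n])
  finally show ?thesis .
qed

lemma udiag_one: "u \<in> unitary_group n \<Longrightarrow> udiag n u (\<lambda>_. 1) = 1\<^sub>m n"
  unfolding udiag_def using unitary_mult_adj[of u n] unitary_carrier[of u n] by simp

lemma udiag_GL:
  assumes "u \<in> unitary_group n" "\<And>i. i < n \<Longrightarrow> f i \<noteq> 0"
  shows "udiag n u f \<in> GL n"
proof (rule GL_I)
  show "udiag n u f * udiag n u (\<lambda>i. inverse (f i)) = 1\<^sub>m n"
    unfolding udiag_mult[OF assms(1)] udiag_one[OF assms(1), symmetric]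
    using assms(2) by (intro udiag_cong) auto
qed (use assms in auto)

lemma udiag_adjoint: "u \<in> unitary_group n \<Longrightarrow> mat_adjoint (udiag n u f) = udiag n u (\<lambda>i. cnj (f i))"
  unfolding udiag_def using adjoint_conj[OF unitary_carrier mat_diag_dim] by simp

lemma udiag_real_Herm: "u \<in> unitary_group n \<Longrightarrow> hdiag n u D \<in> Herm n"
  by (simp add: Herm_def udiag_adjoint)

lemma udiag_smult:
  assumes u: "u \<in> unitary_group n"
  shows "c \<cdot>\<^sub>m udiag n u f = udiag n u (\<lambda>i. c * f i)"
proof (rule eq_matI)
  note dims = carrier_matD[OF udiag_carrier[OF u]]
  fix i j assume "i < dim_row (udiag n u (\<lambda>i. c * f i))" "j < dim_col (udiag n u (\<lambda>i. c * f i))"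
  then have "i < n" "j < n" using dims by auto
  then show "(c \<cdot>\<^sub>m udiag n u f) $$ (i, j) = udiag n u (\<lambda>i. c * f i) $$ (i, j)"
    using dims udiag_index[OF unitary_carrier[OF u]]
    by (simp add: sum_distrib_left algebra_simps)
qed (use carrier_matD[OF udiag_carrier[OF u]] in auto)

lemma udiag_pow: "u \<in> unitary_group n \<Longrightarrow> udiag n u f ^\<^sub>m k = udiag n u (\<lambda>i. f i ^ k)"
proof (induction k)
  case (Suc k)
  then show ?case by (simp add: udiag_mult mult.commute)
qed (use udiag_one[of u n] carrier_matD[OF udiag_carrier[of u n f]] in simp)

lemma mat_exp_udiag:
  assumes u: "u \<in> unitary_group n"
  shows "mat_exp (udiag n u f) = udiag n u (\<lambda>i. exp (f i))"
proof (rule eq_matI)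
  note dims = carrier_matD[OF udiag_carrier[OF u]]
  note uc = unitary_carrier[OF u]
  fix i j assume "i < dim_row (udiag n u (\<lambda>i. exp (f i)))" "j < dim_col (udiag n u (\<lambda>i. exp (f i)))"
  then have ij: "i < n" "j < n" using dims by auto
  have "(\<lambda>k. \<Sum>l<n. u $$ (i, l) * (f l ^ k /\<^sub>R fact k) * cnj (u $$ (j, l)))
      sums (\<Sum>l<n. u $$ (i, l) * exp (f l) * cnj (u $$ (j, l)))"
    by (intro sums_sum sums_mult sums_mult2 exp_converges)
  moreover have "(\<Sum>l<n. u $$ (i, l) * (f l ^ k /\<^sub>R fact k) * cnj (u $$ (j, l)))
      = (udiag n u f ^\<^sub>m k) $$ (i, j) / fact k" for k
    unfolding udiag_pow[OF u] udiag_index[OF uc ij]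
    by (simp add: sum_divide_distrib scaleR_conv_of_real field_simps)
  ultimately have "(\<Sum>k. (udiag n u f ^\<^sub>m k) $$ (i, j) / fact k) = udiag n u (\<lambda>i. exp (f i)) $$ (i, j)"
    unfolding udiag_index[OF uc ij] by (simp add: sums_iff)
  then show "mat_exp (udiag n u f) $$ (i, j) = udiag n u (\<lambda>i. exp (f i)) $$ (i, j)"
    unfolding mat_exp_def using dims ij by simp
qed (use carrier_matD[OF udiag_carrier[OF u]] in \<open>auto simp: mat_exp_def\<close>)

lemma mat_exp_smult_udiag:
  assumes "u \<in> unitary_group n"
  shows "mat_exp (c \<cdot>\<^sub>m udiag n u f) = udiag n u (\<lambda>i. exp (c * f i))"
  using assms by (simp add: udiag_smult mat_exp_udiag)

lemma Herm_obtain_udiag: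
  assumes "H \<in> Herm n"
  obtains u D where "u \<in> unitary_group n" "H = hdiag n u D"
  using Herm_spectral[OF assms] unfolding udiag_def by blast

lemma tr_mult_sum:
  assumes "A \<in> carrier_mat n m" "B \<in> carrier_mat m n"
  shows "tr (A * B) = (\<Sum>i<n. \<Sum>k<m. A $$ (i, k) * B $$ (k, i))"
  using assms unfolding tr_def by (simp add: index_mult_sum[OF assms])

lemma tr_commute:
  assumes "A \<in> carrier_mat n m" "B \<in> carrier_mat m n"
  shows "tr (A * B) = tr (B * A)"
  unfolding tr_mult_sum[OF assms] tr_mult_sum[OF assms(2,1)]
  by (subst sum.swap) (simp add: mult.commute)

lemma tr_unitary_conj:
  assumes u: "u \<in> unitary_group n" and A: "A \<in> carrier_mat n n"
  shows "tr (u * A * mat_adjoint u) = tr A"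
proof -
  note c = unitary_carrier[OF u] mat_adjoint_carrier[OF unitary_carrier[OF u]] A
  have "tr (u * A * mat_adjoint u) = tr (mat_adjoint u * (u * A))"
    using c by (intro tr_commute[of _ n n]) auto
  then show ?thesis using unitary_cancel(1)[OF u A] by simp
qed

lemma tr_udiag: "u \<in> unitary_group n \<Longrightarrow> tr (udiag n u f) = (\<Sum>i<n. f i)"
  unfolding udiag_def by (subst tr_unitary_conj) (auto simp: tr_def)

lemma Herm_frobenius:
  assumes H: "H \<in> Herm n"
  shows "tr (H * H) = complex_of_real ((frobenius_norm H)\<^sup>2)"
proof -
  note c = Herm_carrier[OF H]
  have "tr (H * H) = (\<Sum>i<n. \<Sum>k<n. complex_of_real ((cmod (H $$ (i, k)))\<^sup>2))"
    unfolding tr_mult_sum[OF c c]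
  proof (intro sum.cong refl)
    fix i k assume "i \<in> {..<n}" "k \<in> {..<n}"
    then have "H $$ (k, i) = cnj (H $$ (i, k))"
      using mat_adjoint_index[of k H i] Herm_adjoint[OF H] c by simp
    then show "H $$ (i, k) * H $$ (k, i) = complex_of_real ((cmod (H $$ (i, k)))\<^sup>2)"
      using complex_norm_square by simp
  qed
  also have "\<dots> = complex_of_real ((frobenius_norm H)\<^sup>2)"
    using c by (simp add: frobenius_norm_def sum_nonneg)
  finally show ?thesis .
qed

lemma frobenius_nonneg [simp]: "frobenius_norm A \<ge> 0"
  unfolding frobenius_norm_def by (simp add: sum_nonneg)

lemma frobenius_udiag:
  assumes u: "u \<in> unitary_group n"
  shows "(frobenius_norm (hdiag n u D))\<^sup>2 = (\<Sum>i<n. (D i)\<^sup>2)"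
proof -
  have "complex_of_real ((frobenius_norm (hdiag n u D))\<^sup>2)
      = complex_of_real (\<Sum>i<n. (D i)\<^sup>2)"
    unfolding Herm_frobenius[OF udiag_real_Herm[OF u], symmetric] udiag_mult[OF u] tr_udiag[OF u]
    by (simp add: power2_eq_square)
  then show ?thesis using of_real_eq_iff by blast
qed

lemma GL_column_nonzero:
  assumes "g \<in> GL n" "i < n"
  shows "\<exists>k<n. g $$ (k, i) \<noteq> 0"
proof (rule ccontr)
  assume a: "\<not> ?thesis"
  obtain h where h: "h \<in> GL n" "h * g = 1\<^sub>m n" using GL_obtain_inverse[OF assms(1)] by metis
  have "(h * g) $$ (i, i) = (\<Sum>k<n. h $$ (i, k) * g $$ (k, i))"
    using assms by (intro index_mult_sum[OF GL_carrier[OF h(1)] GL_carrier[OF assms(1)]]) auto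
  also have "\<dots> = 0" using a by simp
  finally show False using h assms by simp
qed

text \<open>The positive factor is the square root of the positive definite matrix \<open>g\<^sup>\<dagger> g\<close>, formed in an eigenbasis.\<close>

lemma polar_decomposition:
  assumes g: "g \<in> GL n"
  shows "\<exists>q u D. q \<in> unitary_group n \<and> u \<in> unitary_group n \<and> (\<forall>i<n. D i > (0 :: real))
    \<and> g = q * hdiag n u D"
proof -
  note gc = GL_carrier[OF g] mat_adjoint_carrier[OF GL_carrier[OF g]]
  have "mat_adjoint g * g \<in> Herm n"
    using gc by (simp add: Herm_def mat_adjoint_mult[OF gc(2,1)])
  then obtain u E where u: "u \<in> unitary_group n" and E: "mat_adjoint g * g = hdiag n u E"
    by (rule Herm_obtain_udiag)
  note uc = unitary_carrier[OF u] mat_adjoint_carrier[OF unitary_carrier[OF u]]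
  have gu: "g * u \<in> GL n" using g unitary_GL[OF u] by (rule GL_mult)
  have E0: "E i > 0" if i: "i < n" for i
  proof -
    have "mat_adjoint (g * u) * (g * u) = mat_adjoint u * (mat_adjoint g * g) * u"
      unfolding mat_adjoint_mult[OF gc(1) uc(1)] using gc uc by (simp add: assoc_mult_mat[of _ n n _ n _ n])
    also have "\<dots> = mat_diag n (\<lambda>i. complex_of_real (E i))"
    proof -
      have "mat_adjoint u * (u * mat_diag n (\<lambda>i. complex_of_real (E i)) * mat_adjoint u) * u
        = (mat_adjoint u * (u * (mat_diag n (\<lambda>i. complex_of_real (E i)) * (mat_adjoint u * u))))"
        using uc by (simp add: assoc_mult_mat[of _ n n _ n _ n])
      then show ?thesis
        unfolding E udiag_def unitary_adj_mult[OF u] using unitary_cancel(1)[OF u mat_diag_dim] uc by simp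
    qed
    finally have eq: "mat_adjoint (g * u) * (g * u) = mat_diag n (\<lambda>i. complex_of_real (E i))" .
    have guc: "g * u \<in> carrier_mat n n" "mat_adjoint (g * u) \<in> carrier_mat n n"
      using GL_carrier[OF gu] by auto
    have "complex_of_real (E i) = (mat_adjoint (g * u) * (g * u)) $$ (i, i)" unfolding eq using i by simp
    also have "\<dots> = (\<Sum>k<n. complex_of_real ((cmod ((g * u) $$ (k, i)))\<^sup>2))"
      unfolding index_mult_sum[OF guc(2,1) i i] using guc i uc gc
      by (intro sum.cong refl, subst complex_norm_square) (simp add: mult.commute)
    finally have "E i = (\<Sum>k<n. (cmod ((g * u) $$ (k, i)))\<^sup>2)"
      using of_real_eq_iff by (metis of_real_sum)
    moreover obtain k where "k < n" "(g * u) $$ (k, i) \<noteq> 0" using GL_column_nonzero[OF gu i] by auto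
    ultimately show ?thesis by (auto intro!: sum_pos2[of _ k])
  qed
  define D where "D i = sqrt (E i)" for i
  define S where "S = hdiag n u (\<lambda>i. inverse (D i))"
  have D0: "D i > 0" if "i < n" for i using E0[OF that] by (simp add: D_def)
  have S: "S \<in> carrier_mat n n" "mat_adjoint S = S"
    unfolding S_def using u by (auto simp: udiag_adjoint)
  have "mat_adjoint (g * S) * (g * S) = S * (mat_adjoint g * g) * S"
    unfolding mat_adjoint_mult[OF gc(1) S(1)] S(2) using gc S(1)
    by (simp add: assoc_mult_mat[of _ n n _ n _ n])
  also have "\<dots> = 1\<^sub>m n"
    unfolding S_def E udiag_mult[OF u] udiag_one[OF u, symmetric]
  proof (intro udiag_cong)
    fix i assume "i < n"
    then have "inverse (D i) * E i * inverse (D i) = 1"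
      using D0[of i] E0[of i] unfolding D_def by (simp add: field_simps)
    then show "complex_of_real (inverse (D i)) * complex_of_real (E i) * complex_of_real (inverse (D i)) = 1"
      by (metis of_real_mult of_real_1)
  qed
  finally have q: "g * S \<in> unitary_group n" using gc S by (simp add: unitary_group_def)
  have "g * S * hdiag n u D = g * (S * hdiag n u D)"
    using gc S u by (simp add: assoc_mult_mat[of _ n n _ n _ n])
  also have "S * hdiag n u D = 1\<^sub>m n"
    unfolding S_def udiag_mult[OF u] udiag_one[OF u, symmetric]
    using D0 by (intro udiag_cong) (auto, metis less_irrefl of_real_1 of_real_inverse of_real_mult left_inverse)
  finally show ?thesis using q u D0 gc by (metis right_mult_one_mat)
qed

text \<open>The triangular factor of the square root of a positive definite matrix is its Cholesky factor.\<close>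

lemma cholesky_udiag:
  assumes u: "u \<in> unitary_group n" and z: "\<And>i. i < n \<Longrightarrow> z i > (0 :: real)"
  shows "\<exists>B\<in>GL n. upper_triangular B \<and> hdiag n u z = mat_adjoint B * B"
proof -
  define S where "S = hdiag n u (\<lambda>i. sqrt (z i))"
  have S: "S \<in> carrier_mat n n" "mat_adjoint S = S"
    unfolding S_def using u by (auto simp: udiag_adjoint)
  obtain Q B where Q: "Q \<in> unitary_group n" and B: "B \<in> carrier_mat n n" "upper_triangular B" and SQB: "S = Q * B"
    using QR_exists[OF S(1)] by auto
  note qc = unitary_carrier[OF Q] mat_adjoint_carrier[OF unitary_carrier[OF Q]]
  have "hdiag n u z = S * S"
    unfolding S_def udiag_mult[OF u]
  proof (intro udiag_cong)
    fix i assume "i < n"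
    then have "z i = sqrt (z i) * sqrt (z i)" using z[of i] by simp
    then show "complex_of_real (z i) = complex_of_real (sqrt (z i)) * complex_of_real (sqrt (z i))"
      by (metis of_real_mult)
  qed
  also have "\<dots> = mat_adjoint (Q * B) * (Q * B)" using S SQB by simp
  also have "\<dots> = mat_adjoint B * (mat_adjoint Q * (Q * B))"
    unfolding mat_adjoint_mult[OF qc(1) B(1)] using qc B(1) by (simp add: assoc_mult_mat[of _ n n _ n _ n])
  also have "\<dots> = mat_adjoint B * B" using unitary_cancel(1)[OF Q B(1)] by simp
  finally have eq: "hdiag n u z = mat_adjoint B * B" .
  have "S \<in> GL n" unfolding S_def using u z by (intro udiag_GL) force+
  then have "mat_adjoint Q * S \<in> GL n" using unitary_GL[OF unitary_adjoint[OF Q]] by (rule GL_mult[rotated])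
  then have "B \<in> GL n" using SQB unitary_cancel(1)[OF Q B(1)] by simp
  then show ?thesis using eq B by blast
qed

section \<open>Logarithms of exponential sums\<close>

text \<open>If a squared norm is the sum of \<open>c \<omega> exp (2 t b \<omega>)\<close>, then this is the logarithm of the norm.  Its
  first two derivatives are the mean and twice the variance of \<open>b\<close> under the Gibbs weights \<open>c \<omega> exp (2 t b \<omega>)\<close>, which
  bounds them by the range of \<open>b\<close>.\<close>

definition half_log_sum_exp :: "'a set \<Rightarrow> ('a \<Rightarrow> real) \<Rightarrow> ('a \<Rightarrow> real) \<Rightarrow> real \<Rightarrow> real" where
  "half_log_sum_exp S c b t = ln (\<Sum>\<omega>\<in>S. c \<omega> * exp (2 * t * b \<omega>)) / 2"

definition exp_moment :: "'a set \<Rightarrow> ('a \<Rightarrow> real) \<Rightarrow> ('a \<Rightarrow> real) \<Rightarrow> nat \<Rightarrow> real \<Rightarrow> real" where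
  "exp_moment S c b k t = (\<Sum>\<omega>\<in>S. c \<omega> * b \<omega> ^ k * exp (2 * t * b \<omega>))"

definition gibbs_mean :: "'a set \<Rightarrow> ('a \<Rightarrow> real) \<Rightarrow> ('a \<Rightarrow> real) \<Rightarrow> real \<Rightarrow> real" where
  "gibbs_mean S c b t = exp_moment S c b 1 t / exp_moment S c b 0 t"

definition gibbs_variance :: "'a set \<Rightarrow> ('a \<Rightarrow> real) \<Rightarrow> ('a \<Rightarrow> real) \<Rightarrow> real \<Rightarrow> real" where
  "gibbs_variance S c b t = exp_moment S c b 2 t / exp_moment S c b 0 t - (gibbs_mean S c b t)\<^sup>2"

lemma exp_moment_deriv:
  "(exp_moment S c b k has_real_derivative 2 * exp_moment S c b (Suc k) t) (at t)"
proof -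
  have "((\<lambda>t. \<Sum>\<omega>\<in>S. c \<omega> * b \<omega> ^ k * exp (2 * t * b \<omega>)) has_real_derivative
      (\<Sum>\<omega>\<in>S. c \<omega> * b \<omega> ^ k * (exp (2 * t * b \<omega>) * (2 * b \<omega>)))) (at t)"
    by (intro DERIV_sum) (auto intro!: derivative_eq_intros)
  moreover have "(\<Sum>\<omega>\<in>S. c \<omega> * b \<omega> ^ k * (exp (2 * t * b \<omega>) * (2 * b \<omega>))) = 2 * exp_moment S c b (Suc k) t"
    unfolding exp_moment_def sum_distrib_left by (intro sum.cong) (auto simp: algebra_simps)
  ultimately show ?thesis unfolding exp_moment_def[abs_def] by simp
qed

locale exp_sum =
  fixes S :: "'a set" and c b :: "'a \<Rightarrow> real"
  assumes fin: "finite S" and c_nonneg: "\<And>\<omega>. \<omega> \<in> S \<Longrightarrow> c \<omega> \<ge> 0" and c_pos: "(\<Sum>\<omega>\<in>S. c \<omega>) > 0"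
begin

lemma Z_pos: "exp_moment S c b 0 t > 0"
proof -
  obtain \<omega> where "\<omega> \<in> S" "c \<omega> > 0" using c_pos c_nonneg
    by (metis less_eq_real_def not_less sum_nonpos)
  then have "(\<Sum>\<omega>\<in>S. c \<omega> * b \<omega> ^ 0 * exp (2 * t * b \<omega>)) > 0"
    using c_nonneg fin by (intro sum_pos2[of _ \<omega>]) auto
  then show ?thesis by (simp add: exp_moment_def)
qed

lemma half_log_sum_exp_eq: "half_log_sum_exp S c b t = ln (exp_moment S c b 0 t) / 2"
  by (simp add: half_log_sum_exp_def exp_moment_def)

lemma half_log_sum_exp_deriv:
  "(half_log_sum_exp S c b has_real_derivative gibbs_mean S c b t) (at t)"
  unfolding half_log_sum_exp_eq[abs_def] gibbs_mean_def
  using Z_pos[of t] by (auto intro!: derivative_eq_intros exp_moment_deriv)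

lemma gibbs_mean_deriv:
  "(gibbs_mean S c b has_real_derivative 2 * gibbs_variance S c b t) (at t)"
proof -
  have "(gibbs_mean S c b has_real_derivative
      (2 * exp_moment S c b (Suc 1) t * exp_moment S c b 0 t - exp_moment S c b 1 t * (2 * exp_moment S c b (Suc 0) t))
        / (exp_moment S c b 0 t * exp_moment S c b 0 t)) (at t)"
    unfolding gibbs_mean_def[abs_def] using Z_pos[of t]
    by (intro DERIV_divide exp_moment_deriv) auto
  moreover have "(2 * exp_moment S c b (Suc 1) t * exp_moment S c b 0 t - exp_moment S c b 1 t * (2 * exp_moment S c b (Suc 0) t))
        / (exp_moment S c b 0 t * exp_moment S c b 0 t) = 2 * gibbs_variance S c b t"
    using Z_pos[of t] by (simp add: gibbs_variance_def gibbs_mean_def field_simps power2_eq_square eval_nat_numeral)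
  ultimately show ?thesis by simp
qed

lemma gibbs_variance_le:
  assumes "\<And>\<omega>. \<omega> \<in> S \<Longrightarrow> \<bar>b \<omega>\<bar> \<le> K"
  shows "gibbs_variance S c b t \<le> K\<^sup>2"
proof -
  have "exp_moment S c b 2 t \<le> (\<Sum>\<omega>\<in>S. c \<omega> * K\<^sup>2 * exp (2 * t * b \<omega>))"
    unfolding exp_moment_def using assms c_nonneg abs_le_square_iff[of _ K]
    by (intro sum_mono mult_right_mono mult_left_mono) (force simp: abs_le_square_iff[symmetric])+
  also have "\<dots> = K\<^sup>2 * exp_moment S c b 0 t"
    unfolding exp_moment_def by (simp add: sum_distrib_left algebra_simps)
  finally have "exp_moment S c b 2 t / exp_moment S c b 0 t \<le> K\<^sup>2"
    using Z_pos[of t] by (simp add: field_simps)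
  then show ?thesis unfolding gibbs_variance_def by (smt (verit) zero_le_power2)
qed

lemma abs_gibbs_mean_le:
  assumes "\<And>\<omega>. \<omega> \<in> S \<Longrightarrow> \<bar>b \<omega>\<bar> \<le> K"
  shows "\<bar>gibbs_mean S c b t\<bar> \<le> K"
proof -
  have "\<bar>exp_moment S c b 1 t\<bar> \<le> (\<Sum>\<omega>\<in>S. \<bar>c \<omega> * b \<omega> ^ 1 * exp (2 * t * b \<omega>)\<bar>)"
    unfolding exp_moment_def by (rule sum_abs)
  also have "\<dots> \<le> (\<Sum>\<omega>\<in>S. c \<omega> * K * exp (2 * t * b \<omega>))"
    using assms c_nonneg by (intro sum_mono) (auto simp: abs_mult intro!: mult_right_mono mult_left_mono)
  also have "\<dots> = K * exp_moment S c b 0 t"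
    unfolding exp_moment_def by (simp add: sum_distrib_left algebra_simps)
  finally show ?thesis using Z_pos[of t] by (simp add: gibbs_mean_def abs_divide divide_le_eq)
qed

end

lemma quadratic_upper_bound:
  fixes f f' f'' :: "real \<Rightarrow> real"
  assumes "\<And>t. (f has_real_derivative f' t) (at t)" "\<And>t. (f' has_real_derivative f'' t) (at t)"
    and "\<And>t. f'' t \<le> 2 * K"
  shows "f s \<le> f 0 + s * f' 0 + K * s\<^sup>2"
proof -
  define diff where "diff m = (if m = 0 then f else if m = 1 then f' else f'')" for m :: nat
  have "\<exists>t. \<bar>t\<bar> \<le> \<bar>s\<bar> \<and> f s = (\<Sum>m<2. diff m 0 / fact m * s ^ m) + diff 2 t / fact 2 * s ^ 2"
    using assms by (intro Maclaurin_bi_le) (auto simp: diff_def less_Suc_eq eval_nat_numeral)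
  then obtain t where "f s = f 0 + s * f' 0 + f'' t / 2 * s\<^sup>2"
    by (auto simp: diff_def eval_nat_numeral algebra_simps)
  moreover have "f'' t / 2 * s\<^sup>2 \<le> K * s\<^sup>2" using assms(3)[of t] by (intro mult_right_mono) auto
  ultimately show ?thesis by simp
qed

text \<open>The difference \<open>U - q\<close> has a minimum at \<open>0\<close>.\<close>

lemma touching_second_order:
  fixes q U :: "real \<Rightarrow> real"
  assumes q: "\<And>t. (q has_real_derivative q' t) (at t)" "(q' has_real_derivative q'') (at 0)"
    and U: "\<And>t. (U has_real_derivative U' t) (at t)" "(U' has_real_derivative U'') (at 0)"
    and le: "\<And>t. q t \<le> U t" and eq: "q 0 = U 0"
  shows "q' 0 = U' 0" "q'' \<le> U''"
proof -
  define h where "h t = U t - q t" for t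
  have h: "(h has_real_derivative U' t - q' t) (at t)" for t
    unfolding h_def[abs_def] by (intro DERIV_diff q U)
  have "U' 0 - q' 0 = 0"
    using DERIV_local_min[OF h[of 0], of 1] le eq by (auto simp: h_def)
  then show e: "q' 0 = U' 0" by simp
  have h': "((\<lambda>t. U' t - q' t) has_real_derivative U'' - q'') (at 0)"
    by (intro DERIV_diff q U)
  show "q'' \<le> U''"
  proof (rule ccontr)
    assume "\<not> ?thesis"
    then obtain d where d: "d > 0" "\<And>k. 0 < k \<Longrightarrow> k < d \<Longrightarrow> U' k - q' k < U' 0 - q' 0"
      using DERIV_neg_dec_right[OF h'] by auto
    have "\<exists>z. 0 < z \<and> z < d / 2 \<and> h (d / 2) - h 0 = (d / 2 - 0) * (U' z - q' z)"
      using d h by (intro MVT2) auto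
    then obtain z where z: "0 < z" "z < d / 2" "h (d / 2) - h 0 = (d / 2) * (U' z - q' z)" by auto
    have "(d / 2) * (U' z - q' z) < 0" using d(1) d(2)[of z] z e by (simp add: mult_pos_neg)
    then show False using z le[of "d / 2"] eq by (simp add: h_def)
  qed
qed

section \<open>Laurent polynomials on the diagonal torus\<close>

text \<open>The character \<open>h \<mapsto> h\<^sup>\<omega>\<close> of the diagonal torus.\<close>

definition wchar :: "nat \<Rightarrow> int vec \<Rightarrow> (nat \<Rightarrow> complex) \<Rightarrow> complex" where
  "wchar n \<omega> h = (\<Prod>i<n. h i powi (\<omega> $ i))"

lemma wchar_mult: "wchar n \<omega> (\<lambda>i. h i * k i) = wchar n \<omega> h * wchar n \<omega> k"
  by (simp add: wchar_def power_int_mult_distrib prod.distrib)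

lemma wchar_nonzero: "(\<And>i. i < n \<Longrightarrow> h i \<noteq> 0) \<Longrightarrow> wchar n \<omega> h \<noteq> 0"
  by (simp add: wchar_def)

lemma wchar_add:
  assumes "\<omega> \<in> carrier_vec n" "\<omega>' \<in> carrier_vec n" "\<And>i. i < n \<Longrightarrow> h i \<noteq> 0"
  shows "wchar n (\<omega> + \<omega>') h = wchar n \<omega> h * wchar n \<omega>' h"
  unfolding wchar_def prod.distrib[symmetric] using assms
  by (intro prod.cong) (auto simp: power_int_add)

lemma wchar_zero [simp]: "wchar n (0\<^sub>v n) h = 1"
  by (simp add: wchar_def)

lemma wchar_one [simp]: "wchar n \<omega> (\<lambda>_. 1) = 1"
  by (simp add: wchar_def)

lemma wchar_single:
  assumes "i < n"
  shows "wchar n \<omega> (\<lambda>j. if j = i then z else 1) = z powi (\<omega> $ i)"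
proof -
  have "wchar n \<omega> (\<lambda>j. if j = i then z else 1) = (\<Prod>j<n. if j = i then z powi (\<omega> $ i) else 1)"
    unfolding wchar_def by (intro prod.cong) auto
  then show ?thesis using assms by simp
qed

lemma wchar_cnj: "wchar n \<omega> (\<lambda>i. cnj (h i)) = cnj (wchar n \<omega> h)"
  by (simp add: wchar_def)

lemma wchar_separates:
  assumes "\<omega> \<in> carrier_vec n" "\<omega>' \<in> carrier_vec n" "\<omega> \<noteq> \<omega>'"
  obtains t :: "nat \<Rightarrow> real" where "\<And>i. t i > 0"
    "wchar n \<omega> (\<lambda>i. complex_of_real (t i)) \<noteq> wchar n \<omega>' (\<lambda>i. complex_of_real (t i))"
proof -
  obtain i where i: "i < n" "\<omega> $ i \<noteq> \<omega>' $ i" using assms by (metis carrier_vecD eq_vecI)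
  define t where "t j = (if j = i then 2 else 1 :: real)" for j
  have "(\<lambda>j. complex_of_real (t j)) = (\<lambda>j. if j = i then complex_of_real 2 else 1)"
    by (auto simp: t_def)
  then have eq: "wchar n \<alpha> (\<lambda>j. complex_of_real (t j)) = complex_of_real (2 powi (\<alpha> $ i))" for \<alpha>
    using wchar_single[OF i(1), of \<alpha> "complex_of_real 2"] by (simp only: of_real_power_int)
  have "(2::real) powi (\<omega> $ i) \<noteq> 2 powi (\<omega>' $ i)"
    using i(2) power_int_strict_increasing[of "\<omega> $ i" "\<omega>' $ i" "2::real"]
      power_int_strict_increasing[of "\<omega>' $ i" "\<omega> $ i" "2::real"] by linarith
  then show ?thesis using that[of t] unfolding eq of_real_eq_iff by (auto simp: t_def)
qed

text \<open>Dedekind's argument: translating by a point that separates two characters and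
  subtracting removes one term of a vanishing combination.  The separating points are positive, so positive
  arguments determine the coefficients.\<close>

lemma wchar_independent:
  assumes "finite W" "W \<subseteq> carrier_vec n"
    and "\<And>h :: nat \<Rightarrow> real. (\<And>i. h i > 0) \<Longrightarrow> (\<Sum>\<omega>\<in>W. c \<omega> * wchar n \<omega> (\<lambda>i. complex_of_real (h i))) = 0"
    and "\<omega> \<in> W"
  shows "c \<omega> = 0"
  using assms
proof (induction W arbitrary: c \<omega> rule: finite_induct)
  case (insert \<omega>0 W)
  let ?\<chi> = "\<lambda>\<omega> h. wchar n \<omega> (\<lambda>i. complex_of_real (h i))"
  have ins: "(\<Sum>\<omega>\<in>insert \<omega>0 W. c \<omega> * ?\<chi> \<omega> h) = c \<omega>0 * ?\<chi> \<omega>0 h + (\<Sum>\<omega>\<in>W. c \<omega> * ?\<chi> \<omega> h)" for h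
    using insert.hyps by simp
  have zero: "c \<omega>1 = 0" if \<omega>1: "\<omega>1 \<in> W" for \<omega>1
  proof -
    have "\<omega>1 \<noteq> \<omega>0" using \<omega>1 insert.hyps by auto
    then obtain t :: "nat \<Rightarrow> real" where t: "\<And>i. t i > 0" "?\<chi> \<omega>1 t \<noteq> ?\<chi> \<omega>0 t"
      using wchar_separates[of \<omega>1 n \<omega>0] \<omega>1 insert.prems(1) by auto
    have "c \<omega>1 * (?\<chi> \<omega>1 t - ?\<chi> \<omega>0 t) = 0"
    proof (rule insert.IH[of "\<lambda>\<omega>. c \<omega> * (?\<chi> \<omega> t - ?\<chi> \<omega>0 t)" \<omega>1])
      fix h :: "nat \<Rightarrow> real" assume h: "\<And>i. h i > 0"
      have mult: "?\<chi> \<omega> (\<lambda>i. t i * h i) = ?\<chi> \<omega> t * ?\<chi> \<omega> h" for \<omega>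
        unfolding wchar_mult[symmetric] by simp
      have "(\<Sum>\<omega>\<in>insert \<omega>0 W. c \<omega> * (?\<chi> \<omega> t - ?\<chi> \<omega>0 t) * ?\<chi> \<omega> h)
        = (\<Sum>\<omega>\<in>insert \<omega>0 W. c \<omega> * ?\<chi> \<omega> (\<lambda>i. t i * h i)) - ?\<chi> \<omega>0 t * (\<Sum>\<omega>\<in>insert \<omega>0 W. c \<omega> * ?\<chi> \<omega> h)"
        unfolding sum_distrib_left sum_subtractf[symmetric] mult by (intro sum.cong) (auto simp: algebra_simps)
      also have "\<dots> = 0" using insert.prems(2)[OF h] insert.prems(2)[of "\<lambda>i. t i * h i"] t h by simp
      finally show "(\<Sum>\<omega>\<in>W. c \<omega> * (?\<chi> \<omega> t - ?\<chi> \<omega>0 t) * ?\<chi> \<omega> h) = 0"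
        using insert.hyps by simp
    qed (use insert.prems \<omega>1 in auto)
    then show ?thesis using t(2) by simp
  qed
  have "c \<omega>0 * ?\<chi> \<omega>0 (\<lambda>_. 1) = 0"
    using insert.prems(2)[of "\<lambda>_. 1"] zero by (simp add: ins[of "\<lambda>_. 1", simplified])
  then have "c \<omega>0 = 0" by simp
  then show ?case using zero insert.prems(3) by auto
qed simp

text \<open>The set \<open>C\<close> restricts the exponents.  If it is closed under addition, the class is closed under
  products; a half-space of exponents records on which side of a hyperplane the weights of a vector lie.\<close>

definition laurent :: "nat \<Rightarrow> int vec set \<Rightarrow> ((nat \<Rightarrow> complex) \<Rightarrow> complex) \<Rightarrow> bool" where
  "laurent n C f \<longleftrightarrow> (\<exists>W c. finite W \<and> W \<subseteq> C \<and> W \<subseteq> carrier_vec n \<and>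
     (\<forall>h. (\<forall>i<n. h i \<noteq> 0) \<longrightarrow> f h = (\<Sum>\<omega>\<in>W. c \<omega> * wchar n \<omega> h)))"

lemma laurent_cong:
  assumes "laurent n C f" "\<And>h. (\<forall>i<n. h i \<noteq> 0) \<Longrightarrow> g h = f h"
  shows "laurent n C g"
  using assms unfolding laurent_def by metis

lemma laurent_monomial:
  assumes "\<omega> \<in> C" "\<omega> \<in> carrier_vec n"
  shows "laurent n C (\<lambda>h. a * wchar n \<omega> h)"
  unfolding laurent_def by (rule exI[of _ "{\<omega>}"], rule exI[of _ "\<lambda>_. a"]) (use assms in auto)

lemma laurent_0: "laurent n C (\<lambda>h. 0)"
  unfolding laurent_def by (rule exI[of _ "{}"]) auto

lemma laurent_add:
  assumes "laurent n C f" "laurent n C g"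
  shows "laurent n C (\<lambda>h. f h + g h)"
proof -
  obtain W c where W: "finite W" "W \<subseteq> C" "W \<subseteq> carrier_vec n"
    and f: "\<And>h. (\<forall>i<n. h i \<noteq> 0) \<Longrightarrow> f h = (\<Sum>\<omega>\<in>W. c \<omega> * wchar n \<omega> h)"
    using assms(1) unfolding laurent_def by blast
  obtain W' c' where W': "finite W'" "W' \<subseteq> C" "W' \<subseteq> carrier_vec n"
    and g: "\<And>h. (\<forall>i<n. h i \<noteq> 0) \<Longrightarrow> g h = (\<Sum>\<omega>\<in>W'. c' \<omega> * wchar n \<omega> h)"
    using assms(2) unfolding laurent_def by blast
  define k where "k \<omega> = (if \<omega> \<in> W then c \<omega> else 0) + (if \<omega> \<in> W' then c' \<omega> else 0)" for \<omega>
  have "f h + g h = (\<Sum>\<omega>\<in>W \<union> W'. k \<omega> * wchar n \<omega> h)" if "\<forall>i<n. h i \<noteq> 0" for h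
  proof -
    have "f h = (\<Sum>\<omega>\<in>W \<union> W'. (if \<omega> \<in> W then c \<omega> else 0) * wchar n \<omega> h)"
      unfolding f[OF that] using W(1) W'(1) by (intro sum.mono_neutral_cong_left) auto
    moreover have "g h = (\<Sum>\<omega>\<in>W \<union> W'. (if \<omega> \<in> W' then c' \<omega> else 0) * wchar n \<omega> h)"
      unfolding g[OF that] using W(1) W'(1) by (intro sum.mono_neutral_cong_left) auto
    ultimately show ?thesis unfolding k_def distrib_right sum.distrib by simp
  qed
  then show ?thesis unfolding laurent_def
    using W W' by (intro exI[of _ "W \<union> W'"] exI[of _ k]) auto
qed

lemma laurent_sum:
  "(\<And>a. a \<in> A \<Longrightarrow> laurent n C (f a)) \<Longrightarrow> laurent n C (\<lambda>h. \<Sum>a\<in>A. f a h)"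
  by (induction A rule: infinite_finite_induct) (auto intro: laurent_0 laurent_add)

lemma laurent_mult:
  assumes "laurent n C f" "laurent n C g" and C: "\<And>\<alpha> \<beta>. \<alpha> \<in> C \<Longrightarrow> \<beta> \<in> C \<Longrightarrow> \<alpha> + \<beta> \<in> C"
  shows "laurent n C (\<lambda>h. f h * g h)"
proof -
  obtain W c where W: "finite W" "W \<subseteq> C" "W \<subseteq> carrier_vec n"
    and f: "\<And>h. (\<forall>i<n. h i \<noteq> 0) \<Longrightarrow> f h = (\<Sum>\<omega>\<in>W. c \<omega> * wchar n \<omega> h)"
    using assms(1) unfolding laurent_def by blast
  obtain W' c' where W': "finite W'" "W' \<subseteq> C" "W' \<subseteq> carrier_vec n"
    and g: "\<And>h. (\<forall>i<n. h i \<noteq> 0) \<Longrightarrow> g h = (\<Sum>\<omega>\<in>W'. c' \<omega> * wchar n \<omega> h)"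
    using assms(2) unfolding laurent_def by blast
  show ?thesis
  proof (rule laurent_cong)
    show "laurent n C (\<lambda>h. \<Sum>\<alpha>\<in>W. \<Sum>\<beta>\<in>W'. (c \<alpha> * c' \<beta>) * wchar n (\<alpha> + \<beta>) h)"
      using W W' by (intro laurent_sum laurent_monomial) (auto intro: C add_carrier_vec)
    fix h :: "nat \<Rightarrow> complex" assume h: "\<forall>i<n. h i \<noteq> 0"
    have "f h * g h = (\<Sum>\<alpha>\<in>W. \<Sum>\<beta>\<in>W'. (c \<alpha> * wchar n \<alpha> h) * (c' \<beta> * wchar n \<beta> h))"
      unfolding f[OF h] g[OF h] by (rule sum_product)
    also have "\<dots> = (\<Sum>\<alpha>\<in>W. \<Sum>\<beta>\<in>W'. (c \<alpha> * c' \<beta>) * wchar n (\<alpha> + \<beta>) h)"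
    proof (intro sum.cong refl)
      fix \<alpha> \<beta> assume "\<alpha> \<in> W" "\<beta> \<in> W'"
      then have "\<alpha> \<in> carrier_vec n" "\<beta> \<in> carrier_vec n" using W W' by auto
      then show "(c \<alpha> * wchar n \<alpha> h) * (c' \<beta> * wchar n \<beta> h) = (c \<alpha> * c' \<beta>) * wchar n (\<alpha> + \<beta>) h"
        using wchar_add[of \<alpha> n \<beta> h] h by simp
    qed
    finally show "f h * g h = (\<Sum>\<alpha>\<in>W. \<Sum>\<beta>\<in>W'. (c \<alpha> * c' \<beta>) * wchar n (\<alpha> + \<beta>) h)" .
  qed
qed

lemma laurent_const: "0\<^sub>v n \<in> C \<Longrightarrow> laurent n C (\<lambda>h. a)"
  by (rule laurent_cong[OF laurent_monomial[of "0\<^sub>v n" C n a]]) auto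

lemma laurent_prod:
  assumes "\<And>\<alpha> \<beta>. \<alpha> \<in> C \<Longrightarrow> \<beta> \<in> C \<Longrightarrow> \<alpha> + \<beta> \<in> C" "0\<^sub>v n \<in> C"
    and "\<And>a. a \<in> A \<Longrightarrow> laurent n C (f a)"
  shows "laurent n C (\<lambda>h. \<Prod>a\<in>A. f a h)"
  using assms(3)
  by (induction A rule: infinite_finite_induct) (auto intro: laurent_const assms(2) laurent_mult assms(1))

lemma laurent_power:
  assumes "\<And>\<alpha> \<beta>. \<alpha> \<in> C \<Longrightarrow> \<beta> \<in> C \<Longrightarrow> \<alpha> + \<beta> \<in> C" "0\<^sub>v n \<in> C" "laurent n C f"
  shows "laurent n C (\<lambda>h. f h ^ k)"
  using laurent_prod[OF assms(1,2), of "{..<k}" "\<lambda>_. f"] assms(3) by simp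

lemma laurent_shift:
  assumes "laurent n C f" "\<omega> \<in> carrier_vec n"
  shows "laurent n ((+) \<omega> ` C) (\<lambda>h. wchar n \<omega> h * f h)"
proof -
  obtain W c where W: "finite W" "W \<subseteq> C" "W \<subseteq> carrier_vec n"
    and f: "\<And>h. (\<forall>i<n. h i \<noteq> 0) \<Longrightarrow> f h = (\<Sum>\<omega>\<in>W. c \<omega> * wchar n \<omega> h)"
    using assms(1) unfolding laurent_def by blast
  show ?thesis
  proof (rule laurent_cong)
    show "laurent n ((+) \<omega> ` C) (\<lambda>h. \<Sum>\<alpha>\<in>W. c \<alpha> * wchar n (\<omega> + \<alpha>) h)"
      using W assms(2) by (intro laurent_sum laurent_monomial) auto
    fix h :: "nat \<Rightarrow> complex" assume h: "\<forall>i<n. h i \<noteq> 0"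
    show "wchar n \<omega> h * f h = (\<Sum>\<alpha>\<in>W. c \<alpha> * wchar n (\<omega> + \<alpha>) h)"
      unfolding f[OF h] sum_distrib_left
    proof (intro sum.cong refl)
      fix \<alpha> assume "\<alpha> \<in> W"
      then show "wchar n \<omega> h * (c \<alpha> * wchar n \<alpha> h) = c \<alpha> * wchar n (\<omega> + \<alpha>) h"
        using wchar_add[OF assms(2), of \<alpha> h] h W by auto
    qed
  qed
qed

lemma laurent_coeff_zero:
  assumes "laurent n C f" "finite W" "W \<subseteq> carrier_vec n"
    and eq: "\<And>h :: nat \<Rightarrow> real. (\<And>i. h i > 0) \<Longrightarrow>
      f (\<lambda>i. complex_of_real (h i)) = (\<Sum>\<omega>\<in>W. c \<omega> * wchar n \<omega> (\<lambda>i. complex_of_real (h i)))"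
    and \<omega>: "\<omega> \<in> W" "\<omega> \<notin> C"
  shows "c \<omega> = 0"
proof -
  obtain W' c' where W': "finite W'" "W' \<subseteq> C" "W' \<subseteq> carrier_vec n"
    and f: "\<And>h. (\<forall>i<n. h i \<noteq> 0) \<Longrightarrow> f h = (\<Sum>\<omega>\<in>W'. c' \<omega> * wchar n \<omega> h)"
    using assms(1) unfolding laurent_def by blast
  define k where "k \<omega> = (if \<omega> \<in> W then c \<omega> else 0) - (if \<omega> \<in> W' then c' \<omega> else 0)" for \<omega>
  have "k \<omega> = 0"
  proof (rule wchar_independent[of "W \<union> W'" n])
    fix h :: "nat \<Rightarrow> real" assume h: "\<And>i. h i > 0"
    then have h': "\<forall>i<n. complex_of_real (h i) \<noteq> 0" by (simp add: less_imp_neq[symmetric])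
    let ?\<chi> = "\<lambda>\<omega>. wchar n \<omega> (\<lambda>i. complex_of_real (h i))"
    have "(\<Sum>\<omega>\<in>W. c \<omega> * ?\<chi> \<omega>) = (\<Sum>\<omega>\<in>W \<union> W'. (if \<omega> \<in> W then c \<omega> else 0) * ?\<chi> \<omega>)"
      using assms(2) W'(1) by (intro sum.mono_neutral_cong_left) auto
    moreover have "(\<Sum>\<omega>\<in>W'. c' \<omega> * ?\<chi> \<omega>) = (\<Sum>\<omega>\<in>W \<union> W'. (if \<omega> \<in> W' then c' \<omega> else 0) * ?\<chi> \<omega>)"
      using assms(2) W'(1) by (intro sum.mono_neutral_cong_left) auto
    ultimately show "(\<Sum>\<omega>\<in>W \<union> W'. k \<omega> * ?\<chi> \<omega>) = 0"
      using eq[OF h] f[OF h'] unfolding k_def by (simp add: left_diff_distrib sum_subtractf)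
  qed (use assms W' in auto)
  then show ?thesis using \<omega> W' unfolding k_def by auto
qed

lemma laurent_rational:
  assumes f: "rational_function_on_GL n f"
    and C: "\<And>\<alpha> \<beta>. \<alpha> \<in> C \<Longrightarrow> \<beta> \<in> C \<Longrightarrow> \<alpha> + \<beta> \<in> C" "0\<^sub>v n \<in> C"
    and g: "\<And>h. (\<And>i. i < n \<Longrightarrow> h i \<noteq> 0) \<Longrightarrow> g h \<in> GL n"
    and entries: "\<And>i j. i < n \<Longrightarrow> j < n \<Longrightarrow> laurent n C (\<lambda>h. g h $$ (i, j))"
    and dets: "laurent n C (\<lambda>h. inverse (det (g h)))"
  shows "laurent n C (\<lambda>h. f (g h))"
proof -
  obtain S :: "((nat \<times> nat \<Rightarrow> nat) \<times> nat) set" and c where S: "\<And>g. g \<in> GL n \<Longrightarrow> f g = (\<Sum>(m, k)\<in>S. c (m, k) *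
            (\<Prod>i<n. \<Prod>j<n. (g $$ (i, j)) ^ m (i, j)) * (inverse (det g)) ^ k)"
    using f unfolding rational_function_on_GL_def by blast
  show ?thesis
  proof (rule laurent_cong)
    show "laurent n C (\<lambda>h. \<Sum>mk\<in>S. c mk *
            (\<Prod>i<n. \<Prod>j<n. (g h $$ (i, j)) ^ fst mk (i, j)) * (inverse (det (g h))) ^ snd mk)"
      by (intro laurent_sum laurent_mult[OF _ _ C(1)] laurent_const C(2) laurent_prod[OF C] laurent_power[OF C] entries dets) auto
  qed (simp add: S g case_prod_beta)
qed

section \<open>Differentiation at the identity\<close>

text \<open>Differentiability at the identity of functions on \<open>GL n\<close>, tested along complex curves through the
  identity.  The point is that the differential \<open>L\<close> does not depend on the curve: this is what makes the derivative of a
  representation linear.\<close>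

definition curve_deriv :: "nat \<Rightarrow> (complex mat \<Rightarrow> complex) \<Rightarrow> (nat \<Rightarrow> nat \<Rightarrow> complex) \<Rightarrow> bool" where
  "curve_deriv n f L \<longleftrightarrow> (\<forall>\<gamma> H. (\<forall>s. \<gamma> s \<in> GL n) \<and> \<gamma> 0 = 1\<^sub>m n \<and>
     (\<forall>i<n. \<forall>j<n. ((\<lambda>s::complex. \<gamma> s $$ (i, j)) has_field_derivative H i j) (at 0)) \<longrightarrow>
     ((\<lambda>s. f (\<gamma> s)) has_field_derivative (\<Sum>i<n. \<Sum>j<n. L i j * H i j)) (at 0))"

definition lin_diff :: "nat \<Rightarrow> (complex mat \<Rightarrow> complex) \<Rightarrow> bool" where
  "lin_diff n f \<longleftrightarrow> (\<exists>L. curve_deriv n f L)"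

lemma curve_derivI:
  assumes "\<And>\<gamma> H. (\<And>s. \<gamma> s \<in> GL n) \<Longrightarrow> \<gamma> 0 = 1\<^sub>m n \<Longrightarrow>
     (\<And>i j. i < n \<Longrightarrow> j < n \<Longrightarrow> ((\<lambda>s::complex. \<gamma> s $$ (i, j)) has_field_derivative H i j) (at 0)) \<Longrightarrow>
     ((\<lambda>s. f (\<gamma> s)) has_field_derivative (\<Sum>i<n. \<Sum>j<n. L i j * H i j)) (at 0)"
  shows "curve_deriv n f L"
  unfolding curve_deriv_def using assms by blast

lemma curve_derivD:
  assumes "curve_deriv n f L" "\<And>s. \<gamma> s \<in> GL n" "\<gamma> 0 = 1\<^sub>m n"
    and "\<And>i j. i < n \<Longrightarrow> j < n \<Longrightarrow> ((\<lambda>s::complex. \<gamma> s $$ (i, j)) has_field_derivative H i j) (at 0)"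
  shows "((\<lambda>s. f (\<gamma> s)) has_field_derivative (\<Sum>i<n. \<Sum>j<n. L i j * H i j)) (at 0)"
  using assms unfolding curve_deriv_def by blast

lemma lin_diff_const: "lin_diff n (\<lambda>_. a)"
  unfolding lin_diff_def by (rule exI[of _ "\<lambda>_ _. 0"], rule curve_derivI) simp

lemma lin_diff_entry:
  assumes "k < n" "l < n"
  shows "lin_diff n (\<lambda>g. g $$ (k, l))"
  unfolding lin_diff_def
proof (rule exI[of _ "\<lambda>i j. if i = k then (if j = l then 1 else 0) else 0"], rule curve_derivI)
  fix \<gamma> :: "complex \<Rightarrow> complex mat" and H
  assume "\<And>i j. i < n \<Longrightarrow> j < n \<Longrightarrow> ((\<lambda>s. \<gamma> s $$ (i, j)) has_field_derivative H i j) (at 0)"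
  moreover have "(\<Sum>i<n. \<Sum>j<n. (if i = k then (if j = l then 1 else 0) else 0) * H i j) = H k l"
  proof -
    have "(\<Sum>j<n. (if i = k then (if j = l then 1 else 0) else 0) * H i j) = (if i = k then H k l else 0)" for i
    proof (cases "i = k")
      case True
      then have "(\<Sum>j<n. (if i = k then (if j = l then 1 else 0) else 0) * H i j) = (\<Sum>j<n. if j = l then H k j else 0)"
        by (intro sum.cong) auto
      then show ?thesis using assms True by simp
    qed simp
    then show ?thesis using assms by simp
  qed
  ultimately show "((\<lambda>s. \<gamma> s $$ (k, l)) has_field_derivative
      (\<Sum>i<n. \<Sum>j<n. (if i = k then (if j = l then 1 else 0) else 0) * H i j)) (at 0)"
    using assms by (simp only:)
qed

lemma curve_deriv_add:
  assumes "curve_deriv n f L" "curve_deriv n g K"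
  shows "curve_deriv n (\<lambda>x. f x + g x) (\<lambda>i j. L i j + K i j)"
proof (rule curve_derivI)
  fix \<gamma> :: "complex \<Rightarrow> complex mat" and H
  assume *: "\<And>s. \<gamma> s \<in> GL n" "\<gamma> 0 = 1\<^sub>m n" "\<And>i j. i < n \<Longrightarrow> j < n \<Longrightarrow> ((\<lambda>s. \<gamma> s $$ (i, j)) has_field_derivative H i j) (at 0)"
  show "((\<lambda>s. f (\<gamma> s) + g (\<gamma> s)) has_field_derivative (\<Sum>i<n. \<Sum>j<n. (L i j + K i j) * H i j)) (at 0)"
    using DERIV_add[OF curve_derivD[OF assms(1) *] curve_derivD[OF assms(2) *]]
    by (simp add: distrib_right sum.distrib)
qed

lemma curve_deriv_mult:
  assumes "curve_deriv n f L" "curve_deriv n g K"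
  shows "curve_deriv n (\<lambda>x. f x * g x) (\<lambda>i j. L i j * g (1\<^sub>m n) + K i j * f (1\<^sub>m n))"
proof (rule curve_derivI)
  fix \<gamma> :: "complex \<Rightarrow> complex mat" and H
  assume *: "\<And>s. \<gamma> s \<in> GL n" "\<gamma> 0 = 1\<^sub>m n" "\<And>i j. i < n \<Longrightarrow> j < n \<Longrightarrow> ((\<lambda>s. \<gamma> s $$ (i, j)) has_field_derivative H i j) (at 0)"
  show "((\<lambda>s. f (\<gamma> s) * g (\<gamma> s)) has_field_derivative
      (\<Sum>i<n. \<Sum>j<n. (L i j * g (1\<^sub>m n) + K i j * f (1\<^sub>m n)) * H i j)) (at 0)"
    using DERIV_mult[OF curve_derivD[OF assms(1) *] curve_derivD[OF assms(2) *]] *(2)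
    by (simp add: ring_distribs sum.distrib sum_distrib_left sum_distrib_right mult.assoc mult.left_commute mult.commute)
qed

lemma curve_deriv_inverse:
  assumes "curve_deriv n f L" "f (1\<^sub>m n) \<noteq> 0"
  shows "curve_deriv n (\<lambda>g. inverse (f g)) (\<lambda>i j. - (inverse (f (1\<^sub>m n)) * inverse (f (1\<^sub>m n))) * L i j)"
proof (rule curve_derivI)
  let ?c = "- (inverse (f (1\<^sub>m n)) * inverse (f (1\<^sub>m n)))"
  fix \<gamma> :: "complex \<Rightarrow> complex mat" and H
  assume *: "\<And>s. \<gamma> s \<in> GL n" "\<gamma> 0 = 1\<^sub>m n" "\<And>i j. i < n \<Longrightarrow> j < n \<Longrightarrow> ((\<lambda>s. \<gamma> s $$ (i, j)) has_field_derivative H i j) (at 0)"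
  have "((\<lambda>s. inverse (f (\<gamma> s))) has_field_derivative ?c * (\<Sum>i<n. \<Sum>j<n. L i j * H i j)) (at 0)"
    using DERIV_inverse'[OF curve_derivD[OF assms(1) *]] assms(2) *(2) by (simp add: algebra_simps)
  then show "((\<lambda>s. inverse (f (\<gamma> s))) has_field_derivative (\<Sum>i<n. \<Sum>j<n. ?c * L i j * H i j)) (at 0)"
    by (simp add: sum_distrib_left mult.assoc)
qed

lemma curve_deriv_cong:
  assumes "curve_deriv n f L" "\<And>g. g \<in> GL n \<Longrightarrow> f' g = f g"
  shows "curve_deriv n f' L"
  by (rule curve_derivI) (use curve_derivD[OF assms(1)] assms(2) in simp)

lemma lin_diff_add: "lin_diff n f \<Longrightarrow> lin_diff n g \<Longrightarrow> lin_diff n (\<lambda>x. f x + g x)"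
  and lin_diff_mult: "lin_diff n f \<Longrightarrow> lin_diff n g \<Longrightarrow> lin_diff n (\<lambda>x. f x * g x)"
  and lin_diff_inverse: "lin_diff n f \<Longrightarrow> f (1\<^sub>m n) \<noteq> 0 \<Longrightarrow> lin_diff n (\<lambda>g. inverse (f g))"
  and lin_diff_cong: "lin_diff n f \<Longrightarrow> (\<And>g. g \<in> GL n \<Longrightarrow> f' g = f g) \<Longrightarrow> lin_diff n f'"
  unfolding lin_diff_def
  using curve_deriv_add curve_deriv_mult curve_deriv_inverse curve_deriv_cong by blast+

lemma lin_diff_sum: "(\<And>a. a \<in> A \<Longrightarrow> lin_diff n (f a)) \<Longrightarrow> lin_diff n (\<lambda>g. \<Sum>a\<in>A. f a g)"
  by (induction A rule: infinite_finite_induct) (auto intro: lin_diff_const lin_diff_add)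

lemma lin_diff_prod: "(\<And>a. a \<in> A \<Longrightarrow> lin_diff n (f a)) \<Longrightarrow> lin_diff n (\<lambda>g. \<Prod>a\<in>A. f a g)"
  by (induction A rule: infinite_finite_induct) (auto intro: lin_diff_const lin_diff_mult)

lemma lin_diff_power: "lin_diff n f \<Longrightarrow> lin_diff n (\<lambda>g. f g ^ k)"
  using lin_diff_prod[of "{..<k}" n "\<lambda>_. f"] by simp

lemma lin_diff_det: "lin_diff n det"
proof (rule lin_diff_cong)
  show "lin_diff n (\<lambda>g. \<Sum>p | p permutes {0..<n}. signof p * (\<Prod>i = 0..<n. g $$ (i, p i)))"
    by (intro lin_diff_sum lin_diff_mult lin_diff_const lin_diff_prod lin_diff_entry)
      (auto dest: permutes_in_image)
qed (simp add: det_def' GL_carrier)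

lemma lin_diff_rational:
  assumes "rational_function_on_GL n f"
  shows "lin_diff n f"
proof -
  obtain S :: "((nat \<times> nat \<Rightarrow> nat) \<times> nat) set" and c where S: "\<And>g. g \<in> GL n \<Longrightarrow> f g = (\<Sum>(m, k)\<in>S. c (m, k) *
            (\<Prod>i<n. \<Prod>j<n. (g $$ (i, j)) ^ m (i, j)) * (inverse (det g)) ^ k)"
    using assms unfolding rational_function_on_GL_def by blast
  show ?thesis
  proof (rule lin_diff_cong)
    show "lin_diff n (\<lambda>g. \<Sum>mk\<in>S. c mk *
            (\<Prod>i<n. \<Prod>j<n. (g $$ (i, j)) ^ fst mk (i, j)) * (inverse (det g)) ^ snd mk)"
      by (intro lin_diff_sum lin_diff_mult lin_diff_const lin_diff_prod lin_diff_power lin_diff_entry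
          lin_diff_inverse lin_diff_det) auto
  qed (simp add: S case_prod_beta)
qed

section \<open>Hermitian inner products\<close>

locale herm_space =
  fixes d :: nat and ip :: "complex vec \<Rightarrow> complex vec \<Rightarrow> complex"
  assumes herm: "hermitian_inner_product d ip"
begin

lemma ip_add_right: "x \<in> carrier_vec d \<Longrightarrow> y \<in> carrier_vec d \<Longrightarrow> z \<in> carrier_vec d \<Longrightarrow> ip x (y + z) = ip x y + ip x z"
  and ip_smult_right: "x \<in> carrier_vec d \<Longrightarrow> y \<in> carrier_vec d \<Longrightarrow> ip x (a \<cdot>\<^sub>v y) = a * ip x y"
  and ip_cnj: "x \<in> carrier_vec d \<Longrightarrow> y \<in> carrier_vec d \<Longrightarrow> ip y x = cnj (ip x y)"
  and ip_pos: "x \<in> carrier_vec d \<Longrightarrow> x \<noteq> 0\<^sub>v d \<Longrightarrow> Re (ip x x) > 0"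
  using herm unfolding hermitian_inner_product_def by blast+

lemma ip_zero_right: "x \<in> carrier_vec d \<Longrightarrow> ip x (0\<^sub>v d) = 0"
  using ip_add_right[of x "0\<^sub>v d" "0\<^sub>v d"] by simp

lemma ip_smult_left: "x \<in> carrier_vec d \<Longrightarrow> y \<in> carrier_vec d \<Longrightarrow> ip (a \<cdot>\<^sub>v x) y = cnj a * ip x y"
  using ip_cnj[of y "a \<cdot>\<^sub>v x"] ip_cnj[of y x] by (simp add: ip_smult_right)

lemma ip_self_zero: "x \<in> carrier_vec d \<Longrightarrow> ip x x = 0 \<Longrightarrow> x = 0\<^sub>v d"
  using ip_pos[of x] by fastforce

lemma ip_self_nonneg: "x \<in> carrier_vec d \<Longrightarrow> Re (ip x x) \<ge> 0"
  using ip_pos[of x] ip_zero_right by (cases "x = 0\<^sub>v d") auto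

lemma ip_self_real: "x \<in> carrier_vec d \<Longrightarrow> ip x x = complex_of_real (Re (ip x x))"
  using ip_cnj[of x x] by (metis Reals_cnj_iff of_real_Re)

lemma ip_sum_right:
  assumes "finite F" "x \<in> carrier_vec d" "y \<in> carrier_vec d" "\<And>\<omega>. \<omega> \<in> F \<Longrightarrow> z \<omega> \<in> carrier_vec d"
    and "\<And>a. a < d \<Longrightarrow> y $ a = (\<Sum>\<omega>\<in>F. c \<omega> * z \<omega> $ a)"
  shows "ip x y = (\<Sum>\<omega>\<in>F. c \<omega> * ip x (z \<omega>))"
  using assms
proof (induction F arbitrary: y rule: finite_induct)
  case empty
  then have "y = 0\<^sub>v d" by auto
  then show ?case using empty ip_zero_right by simp
next
  case (insert \<omega> F)
  define y' where "y' = vec d (\<lambda>a. \<Sum>\<omega>\<in>F. c \<omega> * z \<omega> $ a)"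
  have y': "y' \<in> carrier_vec d" unfolding y'_def by simp
  have z: "z \<omega> \<in> carrier_vec d" using insert by auto
  have "y = c \<omega> \<cdot>\<^sub>v z \<omega> + y'"
  proof (intro eq_vecI)
    fix i assume "i < dim_vec (c \<omega> \<cdot>\<^sub>v z \<omega> + y')"
    then have i: "i < d" using y' by simp
    then show "y $ i = (c \<omega> \<cdot>\<^sub>v z \<omega> + y') $ i"
      using insert.prems(4)[OF i] insert.hyps z i by (simp add: y'_def carrier_vecD[OF z])
  qed (use insert.prems(2) y' in simp)
  then have "ip x y = c \<omega> * ip x (z \<omega>) + ip x y'"
    using z y' insert.prems(1) by (simp add: ip_add_right ip_smult_right)
  moreover have "ip x y' = (\<Sum>\<omega>\<in>F. c \<omega> * ip x (z \<omega>))"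
    using insert.prems y' by (intro insert.IH) (auto simp: y'_def)
  ultimately show ?case using insert.hyps by simp
qed

lemma ip_norm_pos: "x \<in> carrier_vec d \<Longrightarrow> x \<noteq> 0\<^sub>v d \<Longrightarrow> ip_norm ip x > 0"
  unfolding ip_norm_def using ip_pos by simp

lemma ip_norm_smult:
  assumes "x \<in> carrier_vec d"
  shows "ip_norm ip (a \<cdot>\<^sub>v x) = cmod a * ip_norm ip x"
proof -
  have "ip (a \<cdot>\<^sub>v x) (a \<cdot>\<^sub>v x) = (cnj a * a) * ip x x"
    using assms by (simp add: ip_smult_left ip_smult_right)
  also have "cnj a * a = complex_of_real ((cmod a)\<^sup>2)" using complex_norm_square[of a] by (simp add: mult.commute)
  finally show ?thesis unfolding ip_norm_def by (simp add: real_sqrt_mult)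
qed

end

section \<open>Weights of a unitary representation\<close>

lemma det_mat_diag: "det (mat_diag n h) = (\<Prod>i<n. h i :: complex)"
proof -
  have "det (mat_diag n h) = prod_list (diag_mat (mat_diag n h))"
    by (rule det_upper_triangular[of _ n]) (auto intro!: upper_triangularI)
  also have "diag_mat (mat_diag n h) = map h [0..<n]" by (auto simp: diag_mat_def intro: nth_equalityI)
  finally show ?thesis by (simp add: prod.distinct_set_conv_list[symmetric] atLeast0LessThan)
qed

lemma wchar_unit_vec:
  assumes "i < n"
  shows "wchar n (unit_vec n i) h = h i"
proof -
  have "wchar n (unit_vec n i) h = (\<Prod>j<n. if j = i then h j else 1)"
    unfolding wchar_def using assms by (intro prod.cong) auto
  then show ?thesis using assms by simp
qed

locale unitary_rep = herm_space d ip for d ip +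
  fixes n :: nat and \<pi> :: "complex mat \<Rightarrow> complex mat"
  assumes rep: "rational_representation n d \<pi>" and inv: "unitary_invariant n d \<pi> ip"
begin

lemma pi_GL: "g \<in> GL n \<Longrightarrow> \<pi> g \<in> GL d"
  and pi_mult: "g \<in> GL n \<Longrightarrow> h \<in> GL n \<Longrightarrow> \<pi> (g * h) = \<pi> g * \<pi> h"
  and pi_rational: "a < d \<Longrightarrow> b < d \<Longrightarrow> rational_function_on_GL n (\<lambda>g. \<pi> g $$ (a, b))"
  using rep unfolding rational_representation_def by blast+

lemma pi_carrier: "g \<in> GL n \<Longrightarrow> \<pi> g \<in> carrier_mat d d"
  using pi_GL GL_carrier by blast

lemma act_carrier [simp]: "g \<in> GL n \<Longrightarrow> x \<in> carrier_vec d \<Longrightarrow> \<pi> g *\<^sub>v x \<in> carrier_vec d"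
  using pi_carrier[of g] by simp

lemma act_mult: "g \<in> GL n \<Longrightarrow> h \<in> GL n \<Longrightarrow> x \<in> carrier_vec d \<Longrightarrow> \<pi> (g * h) *\<^sub>v x = \<pi> g *\<^sub>v (\<pi> h *\<^sub>v x)"
  using pi_mult[of g h] pi_carrier[of g] pi_carrier[of h] by (simp add: assoc_mult_mat_vec[of _ d d _ d])

lemma act_add: "g \<in> GL n \<Longrightarrow> x \<in> carrier_vec d \<Longrightarrow> y \<in> carrier_vec d \<Longrightarrow> \<pi> g *\<^sub>v (x + y) = \<pi> g *\<^sub>v x + \<pi> g *\<^sub>v y"
  using pi_carrier by (rule mult_add_distrib_mat_vec)

lemma act_smult: "g \<in> GL n \<Longrightarrow> x \<in> carrier_vec d \<Longrightarrow> \<pi> g *\<^sub>v (a \<cdot>\<^sub>v x) = a \<cdot>\<^sub>v (\<pi> g *\<^sub>v x)"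
  using pi_carrier by (rule mult_mat_vec)

lemma pi_one: "\<pi> (1\<^sub>m n) = 1\<^sub>m d"
proof -
  have G: "\<pi> (1\<^sub>m n) \<in> GL d" by (simp add: pi_GL)
  obtain h where h: "h \<in> GL d" "h * \<pi> (1\<^sub>m n) = 1\<^sub>m d" using GL_obtain_inverse[OF G] by metis
  note c = GL_carrier[OF G] GL_carrier[OF h(1)]
  have "\<pi> (1\<^sub>m n) * \<pi> (1\<^sub>m n) = \<pi> (1\<^sub>m n)" using pi_mult[of "1\<^sub>m n" "1\<^sub>m n"] by simp
  then have "h * (\<pi> (1\<^sub>m n) * \<pi> (1\<^sub>m n)) = 1\<^sub>m d" using h by simp
  moreover have "h * (\<pi> (1\<^sub>m n) * \<pi> (1\<^sub>m n)) = (h * \<pi> (1\<^sub>m n)) * \<pi> (1\<^sub>m n)"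
    using c by (simp add: assoc_mult_mat[of _ d d _ d _ d])
  ultimately show ?thesis using h c by simp
qed

lemma act_one: "x \<in> carrier_vec d \<Longrightarrow> \<pi> (1\<^sub>m n) *\<^sub>v x = x"
  by (simp add: pi_one)

lemma act_inverse:
  assumes "g \<in> GL n" "h \<in> GL n" "g * h = 1\<^sub>m n" "x \<in> carrier_vec d"
  shows "\<pi> g *\<^sub>v (\<pi> h *\<^sub>v x) = x"
  using act_mult[OF assms(1,2,4)] act_one[OF assms(4)] assms(3) by simp

lemma act_zero: "g \<in> GL n \<Longrightarrow> \<pi> g *\<^sub>v 0\<^sub>v d = 0\<^sub>v d"
  using pi_carrier[of g] by (intro eq_vecI) (auto simp: index_mult_vec_sum[of _ d d])

lemma act_nonzero:
  assumes "g \<in> GL n" "x \<in> carrier_vec d" "x \<noteq> 0\<^sub>v d"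
  shows "\<pi> g *\<^sub>v x \<noteq> 0\<^sub>v d"
proof
  assume a: "\<pi> g *\<^sub>v x = 0\<^sub>v d"
  obtain h where h: "h \<in> GL n" "h * g = 1\<^sub>m n" using GL_obtain_inverse[OF assms(1)] by metis
  show False using act_inverse[OF h(1) assms(1) h(2) assms(2)] a act_zero[OF h(1)] assms(3) by simp
qed

lemma ip_unitary:
  "u \<in> unitary_group n \<Longrightarrow> x \<in> carrier_vec d \<Longrightarrow> y \<in> carrier_vec d \<Longrightarrow> ip (\<pi> u *\<^sub>v x) (\<pi> u *\<^sub>v y) = ip x y"
  using inv unfolding unitary_invariant_def by blast

lemma torus_entry_laurent:
  assumes "a < d" "b < d"
  shows "laurent n UNIV (\<lambda>h. \<pi> (mat_diag n h) $$ (a, b))"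
proof (rule laurent_rational[OF pi_rational[OF assms]])
  show "mat_diag n h \<in> GL n" if "\<And>i. i < n \<Longrightarrow> h i \<noteq> 0" for h using that by (rule GL_diag)
  show "laurent n UNIV (\<lambda>h. mat_diag n h $$ (i, j))" if "i < n" "j < n" for i j
  proof (cases "i = j")
    case True
    have "laurent n UNIV (\<lambda>h. 1 * wchar n (unit_vec n i) h)" by (rule laurent_monomial) auto
    then show ?thesis by (rule laurent_cong) (use that True in \<open>simp add: wchar_unit_vec\<close>)
  next
    case False
    show ?thesis by (rule laurent_cong[OF laurent_0]) (use that False in simp)
  qed
  have "laurent n UNIV (\<lambda>h. 1 * wchar n (vec n (\<lambda>_. - 1)) h)" by (rule laurent_monomial) auto
  then show "laurent n UNIV (\<lambda>h. inverse (det (mat_diag n h)))"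
    by (rule laurent_cong) (simp add: det_mat_diag wchar_def power_int_minus prod_inversef[symmetric] o_def)
qed auto

text \<open>The operators \<open>P \<omega>\<close> turn out to be the projections onto the weight spaces; zero operators are excluded
  so that \<open>W\<close> consists of the weights that occur.\<close>

definition weight_expansion :: "int vec set \<Rightarrow> (int vec \<Rightarrow> complex mat) \<Rightarrow> bool" where
  "weight_expansion W P \<longleftrightarrow> finite W \<and> W \<subseteq> carrier_vec n \<and> (\<forall>\<omega>\<in>W. P \<omega> \<in> carrier_mat d d \<and> P \<omega> \<noteq> 0\<^sub>m d d) \<and>
    (\<forall>h. (\<forall>i<n. h i \<noteq> 0) \<longrightarrow> (\<forall>a<d. \<forall>b<d. \<pi> (mat_diag n h) $$ (a, b) = (\<Sum>\<omega>\<in>W. P \<omega> $$ (a, b) * wchar n \<omega> h)))"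

lemma weight_expansion_exists: "\<exists>W P. weight_expansion W P"
proof -
  define Q where "Q a b W c \<longleftrightarrow> finite W \<and> W \<subseteq> carrier_vec n \<and>
     (\<forall>h. (\<forall>i<n. h i \<noteq> 0) \<longrightarrow> \<pi> (mat_diag n h) $$ (a, b) = (\<Sum>\<omega>\<in>W. c \<omega> * wchar n \<omega> h))"
    for a b W c
  define Wf where "Wf a b = (SOME W. \<exists>c. Q a b W c)" for a b
  define cf where "cf a b = (SOME c. Q a b (Wf a b) c)" for a b
  have "\<exists>W c. Q a b W c" if "a < d" "b < d" for a b
    using torus_entry_laurent[OF that] unfolding laurent_def Q_def by blast
  then have "\<exists>c. Q a b (Wf a b) c" if "a < d" "b < d" for a b
    unfolding Wf_def using that by (intro someI_ex[of "\<lambda>W. \<exists>c. Q a b W c"])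
  then have "Q a b (Wf a b) (cf a b)" if "a < d" "b < d" for a b
    unfolding cf_def using that by (intro someI_ex[of "\<lambda>c. Q a b (Wf a b) c"])
  then have Wc: "finite (Wf a b) \<and> Wf a b \<subseteq> carrier_vec n \<and>
     (\<forall>h. (\<forall>i<n. h i \<noteq> 0) \<longrightarrow> \<pi> (mat_diag n h) $$ (a, b) = (\<Sum>\<omega>\<in>Wf a b. cf a b \<omega> * wchar n \<omega> h))"
    if "a < d" "b < d" for a b using that unfolding Q_def by blast
  define W0 where "W0 = (\<Union>a<d. \<Union>b<d. Wf a b)"
  define P where "P \<omega> = mat d d (\<lambda>(a, b). if \<omega> \<in> Wf a b then cf a b \<omega> else 0)" for \<omega>
  define W where "W = {\<omega>\<in>W0. P \<omega> \<noteq> 0\<^sub>m d d}"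
  have fin: "finite W0" unfolding W0_def using Wc by auto
  have sub: "W0 \<subseteq> carrier_vec n" unfolding W0_def using Wc by blast
  have "\<pi> (mat_diag n h) $$ (a, b) = (\<Sum>\<omega>\<in>W. P \<omega> $$ (a, b) * wchar n \<omega> h)"
    if h: "\<forall>i<n. h i \<noteq> 0" and ab: "a < d" "b < d" for h a b
  proof -
    have "\<pi> (mat_diag n h) $$ (a, b) = (\<Sum>\<omega>\<in>Wf a b. cf a b \<omega> * wchar n \<omega> h)"
      using Wc[OF ab] h by blast
    also have "\<dots> = (\<Sum>\<omega>\<in>W0. P \<omega> $$ (a, b) * wchar n \<omega> h)"
      using fin ab by (intro sum.mono_neutral_cong_left) (auto simp: W0_def P_def)
    also have "\<dots> = (\<Sum>\<omega>\<in>W. P \<omega> $$ (a, b) * wchar n \<omega> h)"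
      using fin ab by (intro sum.mono_neutral_right) (auto simp: W_def)
    finally show ?thesis .
  qed
  moreover have "finite W" unfolding W_def using fin by (rule finite_subset[rotated]) (rule Collect_restrict)
  moreover have "W \<subseteq> carrier_vec n" unfolding W_def using sub by (rule subset_trans[OF Collect_restrict])
  moreover have "\<forall>\<omega>\<in>W. P \<omega> \<in> carrier_mat d d \<and> P \<omega> \<noteq> 0\<^sub>m d d"
  proof
    fix \<omega> assume "\<omega> \<in> W"
    then have "P \<omega> \<noteq> 0\<^sub>m d d" unfolding W_def mem_Collect_eq by (rule conjunct2)
    moreover have "P \<omega> \<in> carrier_mat d d" unfolding P_def by (rule mat_carrier)
    ultimately show "P \<omega> \<in> carrier_mat d d \<and> P \<omega> \<noteq> 0\<^sub>m d d" by (rule conjI[rotated])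
  qed
  ultimately show ?thesis unfolding weight_expansion_def by (intro exI[of _ W] exI[of _ P] conjI allI impI) simp_all
qed

definition weight_data :: "int vec set \<times> (int vec \<Rightarrow> complex mat)" where
  "weight_data = (SOME WP. weight_expansion (fst WP) (snd WP))"

definition weights :: "int vec set" where "weights = fst weight_data"

definition wproj :: "int vec \<Rightarrow> complex mat" where "wproj = snd weight_data"

lemma weights_finite: "finite weights"
  and weights_carrier: "weights \<subseteq> carrier_vec n"
  and wproj_carrier: "\<omega> \<in> weights \<Longrightarrow> wproj \<omega> \<in> carrier_mat d d"
  and wproj_nonzero: "\<omega> \<in> weights \<Longrightarrow> wproj \<omega> \<noteq> 0\<^sub>m d d"
  and torus_entry: "\<forall>i<n. h i \<noteq> 0 \<Longrightarrow> a < d \<Longrightarrow> b < d \<Longrightarrow>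
    \<pi> (mat_diag n h) $$ (a, b) = (\<Sum>\<omega>\<in>weights. wproj \<omega> $$ (a, b) * wchar n \<omega> h)"
proof -
  have "\<exists>WP. weight_expansion (fst WP) (snd WP)" using weight_expansion_exists by auto
  from someI_ex[OF this, folded weight_data_def, folded weights_def wproj_def]
  have "weight_expansion weights wproj" .
  then show "finite weights" "weights \<subseteq> carrier_vec n" "\<omega> \<in> weights \<Longrightarrow> wproj \<omega> \<in> carrier_mat d d"
    "\<omega> \<in> weights \<Longrightarrow> wproj \<omega> \<noteq> 0\<^sub>m d d"
    "\<forall>i<n. h i \<noteq> 0 \<Longrightarrow> a < d \<Longrightarrow> b < d \<Longrightarrow>
    \<pi> (mat_diag n h) $$ (a, b) = (\<Sum>\<omega>\<in>weights. wproj \<omega> $$ (a, b) * wchar n \<omega> h)"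
    unfolding weight_expansion_def by blast+
qed

lemma wproj_vec_carrier [simp]: "\<omega> \<in> weights \<Longrightarrow> x \<in> carrier_vec d \<Longrightarrow> wproj \<omega> *\<^sub>v x \<in> carrier_vec d"
  by (rule mult_mat_vec_carrier[OF wproj_carrier])

lemma torus_act:
  assumes h: "\<forall>i<n. h i \<noteq> 0" and x: "x \<in> carrier_vec d" and a: "a < d"
  shows "(\<pi> (mat_diag n h) *\<^sub>v x) $ a = (\<Sum>\<omega>\<in>weights. wchar n \<omega> h * (wproj \<omega> *\<^sub>v x) $ a)"
proof -
  have G: "mat_diag n h \<in> GL n" using h by (intro GL_diag) auto
  have "(\<pi> (mat_diag n h) *\<^sub>v x) $ a = (\<Sum>b<d. \<Sum>\<omega>\<in>weights. wproj \<omega> $$ (a, b) * wchar n \<omega> h * x $ b)"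
    unfolding index_mult_vec_sum[OF pi_carrier[OF G] x a] using torus_entry[OF h a]
    by (simp add: sum_distrib_right)
  also have "\<dots> = (\<Sum>\<omega>\<in>weights. wchar n \<omega> h * (\<Sum>b<d. wproj \<omega> $$ (a, b) * x $ b))"
    by (subst sum.swap) (simp add: sum_distrib_left algebra_simps)
  also have "\<dots> = (\<Sum>\<omega>\<in>weights. wchar n \<omega> h * (wproj \<omega> *\<^sub>v x) $ a)"
    by (intro sum.cong refl) (simp add: index_mult_vec_sum[OF wproj_carrier x a])
  finally show ?thesis .
qed

lemma wproj_sum:
  assumes x: "x \<in> carrier_vec d" and a: "a < d"
  shows "x $ a = (\<Sum>\<omega>\<in>weights. (wproj \<omega> *\<^sub>v x) $ a)"
  using torus_act[of "\<lambda>_. 1", OF _ x a] by (simp add: act_one[OF x])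

lemma torus_mult_act:
  assumes "\<forall>i<n. h i \<noteq> 0" "\<forall>i<n. k i \<noteq> 0" "x \<in> carrier_vec d"
  shows "\<pi> (mat_diag n h) *\<^sub>v (\<pi> (mat_diag n k) *\<^sub>v x) = \<pi> (mat_diag n (\<lambda>i. h i * k i)) *\<^sub>v x"
  using act_mult[of "mat_diag n h" "mat_diag n k" x] GL_diag[of n h] GL_diag[of n k] assms by simp

text \<open>Both sides are the coefficient of the character \<open>\<omega>\<close> of \<open>k\<close> in \<open>\<pi>(k) \<pi>(h) x = \<pi>(k h) x\<close>; the same
  comparison in \<open>\<pi>(h) \<pi>(k) x\<close> shows that the components are weight vectors.\<close>

lemma wproj_torus:
  assumes \<omega>: "\<omega> \<in> weights" and h: "\<forall>i<n. h i \<noteq> 0" and x: "x \<in> carrier_vec d"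
  shows "wproj \<omega> *\<^sub>v (\<pi> (mat_diag n h) *\<^sub>v x) = wchar n \<omega> h \<cdot>\<^sub>v (wproj \<omega> *\<^sub>v x)"
proof (rule eq_vecI)
  have G: "mat_diag n h \<in> GL n" using h by (intro GL_diag) auto
  have hx: "\<pi> (mat_diag n h) *\<^sub>v x \<in> carrier_vec d" using G x by simp
  show "dim_vec (wproj \<omega> *\<^sub>v (\<pi> (mat_diag n h) *\<^sub>v x)) = dim_vec (wchar n \<omega> h \<cdot>\<^sub>v (wproj \<omega> *\<^sub>v x))"
    using wproj_carrier[OF \<omega>] by simp
  fix a assume "a < dim_vec (wchar n \<omega> h \<cdot>\<^sub>v (wproj \<omega> *\<^sub>v x))"
  then have a: "a < d" using wproj_carrier[OF \<omega>] by simp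
  have "(wproj \<omega> *\<^sub>v (\<pi> (mat_diag n h) *\<^sub>v x)) $ a - wchar n \<omega> h * (wproj \<omega> *\<^sub>v x) $ a = 0"
  proof (rule wchar_independent[OF weights_finite weights_carrier _ \<omega>])
    fix k :: "nat \<Rightarrow> real" assume "\<And>i. k i > 0"
    then have k: "\<forall>i<n. complex_of_real (k i) \<noteq> 0" by (simp add: less_imp_neq[symmetric])
    have kh: "\<forall>i<n. complex_of_real (k i) * h i \<noteq> 0" using k h by simp
    show "(\<Sum>\<omega>\<in>weights. ((wproj \<omega> *\<^sub>v (\<pi> (mat_diag n h) *\<^sub>v x)) $ a - wchar n \<omega> h * (wproj \<omega> *\<^sub>v x) $ a) *
        wchar n \<omega> (\<lambda>i. complex_of_real (k i))) = 0"
      using torus_act[OF k hx a] torus_act[OF kh x a] torus_mult_act[OF k h x]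
      by (simp add: wchar_mult right_diff_distrib sum_subtractf mult.commute mult.left_commute)
  qed
  then show "(wproj \<omega> *\<^sub>v (\<pi> (mat_diag n h) *\<^sub>v x)) $ a = (wchar n \<omega> h \<cdot>\<^sub>v (wproj \<omega> *\<^sub>v x)) $ a"
    using a wproj_carrier[OF \<omega>] by simp
qed

definition weight_vec :: "int vec \<Rightarrow> complex vec \<Rightarrow> bool" where
  "weight_vec \<omega> x \<longleftrightarrow> x \<in> carrier_vec d \<and>
     (\<forall>h. (\<forall>i<n. h i \<noteq> 0) \<longrightarrow> \<pi> (mat_diag n h) *\<^sub>v x = wchar n \<omega> h \<cdot>\<^sub>v x)"

lemma weight_vec_carrier: "weight_vec \<omega> x \<Longrightarrow> x \<in> carrier_vec d"
  and weight_vec_act: "weight_vec \<omega> x \<Longrightarrow> \<forall>i<n. h i \<noteq> 0 \<Longrightarrow> \<pi> (mat_diag n h) *\<^sub>v x = wchar n \<omega> h \<cdot>\<^sub>v x"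
  unfolding weight_vec_def by blast+

lemma weight_vec_wproj:
  assumes \<omega>: "\<omega> \<in> weights" and x: "x \<in> carrier_vec d"
  shows "weight_vec \<omega> (wproj \<omega> *\<^sub>v x)"
  unfolding weight_vec_def
proof (intro conjI allI impI)
  show "wproj \<omega> *\<^sub>v x \<in> carrier_vec d" using assms by simp
  fix h :: "nat \<Rightarrow> complex" assume h: "\<forall>i<n. h i \<noteq> 0"
  have G: "mat_diag n h \<in> GL n" using h by (intro GL_diag) auto
  show "\<pi> (mat_diag n h) *\<^sub>v (wproj \<omega> *\<^sub>v x) = wchar n \<omega> h \<cdot>\<^sub>v (wproj \<omega> *\<^sub>v x)"
  proof (rule eq_vecI)
    show "dim_vec (\<pi> (mat_diag n h) *\<^sub>v (wproj \<omega> *\<^sub>v x)) = dim_vec (wchar n \<omega> h \<cdot>\<^sub>v (wproj \<omega> *\<^sub>v x))"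
      using wproj_carrier[OF \<omega>] pi_carrier[OF G] by simp
    fix a assume "a < dim_vec (wchar n \<omega> h \<cdot>\<^sub>v (wproj \<omega> *\<^sub>v x))"
    then have a: "a < d" using wproj_carrier[OF \<omega>] by simp
    define c where "c \<omega> = (\<Sum>b<d. \<pi> (mat_diag n h) $$ (a, b) * (wproj \<omega> *\<^sub>v x) $ b)" for \<omega>
    have c: "c \<omega> = (\<pi> (mat_diag n h) *\<^sub>v (wproj \<omega> *\<^sub>v x)) $ a" if "\<omega> \<in> weights" for \<omega>
      unfolding c_def using that x index_mult_vec_sum[OF pi_carrier[OF G] _ a] by simp
    have "c \<omega> - wchar n \<omega> h * (wproj \<omega> *\<^sub>v x) $ a = 0"
    proof (rule wchar_independent[OF weights_finite weights_carrier _ \<omega>])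
      fix k :: "nat \<Rightarrow> real" assume "\<And>i. k i > 0"
      then have k: "\<forall>i<n. complex_of_real (k i) \<noteq> 0" by (simp add: less_imp_neq[symmetric])
      let ?k = "\<lambda>i. complex_of_real (k i)"
      have hk: "\<forall>i<n. h i * ?k i \<noteq> 0" using k h by simp
      have K: "mat_diag n ?k \<in> GL n" using k by (intro GL_diag) auto
      have kx: "\<pi> (mat_diag n ?k) *\<^sub>v x \<in> carrier_vec d" using K x by simp
      have "(\<Sum>\<omega>\<in>weights. c \<omega> * wchar n \<omega> ?k)
        = (\<Sum>b<d. \<pi> (mat_diag n h) $$ (a, b) * (\<Sum>\<omega>\<in>weights. wchar n \<omega> ?k * (wproj \<omega> *\<^sub>v x) $ b))"
        unfolding c_def sum_distrib_left sum_distrib_right by (subst sum.swap) (simp add: algebra_simps)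
      also have "\<dots> = (\<pi> (mat_diag n h) *\<^sub>v (\<pi> (mat_diag n ?k) *\<^sub>v x)) $ a"
        unfolding index_mult_vec_sum[OF pi_carrier[OF G] kx a] by (intro sum.cong refl) (simp add: torus_act[OF k x])
      also have "\<dots> = (\<Sum>\<omega>\<in>weights. wchar n \<omega> h * (wproj \<omega> *\<^sub>v x) $ a * wchar n \<omega> ?k)"
        unfolding torus_mult_act[OF h k x] torus_act[OF hk x a] wchar_mult
        by (intro sum.cong) (auto simp: algebra_simps)
      finally show "(\<Sum>\<omega>\<in>weights. (c \<omega> - wchar n \<omega> h * (wproj \<omega> *\<^sub>v x) $ a) * wchar n \<omega> ?k) = 0"
        by (simp add: left_diff_distrib sum_subtractf)
    qed
    then show "(\<pi> (mat_diag n h) *\<^sub>v (wproj \<omega> *\<^sub>v x)) $ a = (wchar n \<omega> h \<cdot>\<^sub>v (wproj \<omega> *\<^sub>v x)) $ a"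
      using c[OF \<omega>] a wproj_carrier[OF \<omega>] by simp
  qed
qed

lemma weight_vec_orthogonal:
  assumes "weight_vec \<omega> x" "weight_vec \<omega>' y" "\<omega> \<in> carrier_vec n" "\<omega>' \<in> carrier_vec n" "\<omega> \<noteq> \<omega>'"
  shows "ip x y = 0"
proof -
  note c = weight_vec_carrier[OF assms(1)] weight_vec_carrier[OF assms(2)]
  obtain i where i: "i < n" "\<omega> $ i \<noteq> \<omega>' $ i" using assms by (metis carrier_vecD eq_vecI)
  define \<theta> where "\<theta> = pi / (\<omega>' $ i - \<omega> $ i)"
  \<comment> \<open>the angle makes the two characters take opposite values at the unitary diagonal \<open>h\<close>\<close>
  define h where "h j = (if j = i then cis \<theta> else 1)" for j
  have h: "\<forall>i<n. h i \<noteq> 0" by (simp add: h_def)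
  have hw: "wchar n \<alpha> h = cis (of_int (\<alpha> $ i) * \<theta>)" for \<alpha>
    unfolding h_def using wchar_single[OF i(1)] by (simp add: cis_power_int)
  have "of_int (\<omega>' $ i) * \<theta> = of_int (\<omega> $ i) * \<theta> + pi"
    using i(2) unfolding \<theta>_def by (simp add: field_simps)
  then have opp: "wchar n \<omega>' h = - wchar n \<omega> h" unfolding hw by (simp add: cis_mult[symmetric])
  have "mat_diag n h \<in> unitary_group n"
    unfolding unitary_group_def using h by (auto intro!: eq_matI simp: h_def cis_cnj cis_mult)
  then have "ip x y = ip (wchar n \<omega> h \<cdot>\<^sub>v x) (wchar n \<omega>' h \<cdot>\<^sub>v y)"
    using ip_unitary[OF _ c] weight_vec_act[OF assms(1) h] weight_vec_act[OF assms(2) h] by metis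
  also have "\<dots> = - (cnj (wchar n \<omega> h) * wchar n \<omega> h) * ip x y"
    using c by (simp add: ip_smult_left ip_smult_right opp)
  also have "cnj (wchar n \<omega> h) * wchar n \<omega> h = 1" unfolding hw by (simp add: cis_cnj cis_mult)
  finally show ?thesis by simp
qed

lemma ip_wproj_cross:
  assumes "\<omega> \<in> weights" "\<omega>' \<in> weights" "\<omega> \<noteq> \<omega>'" "x \<in> carrier_vec d" "y \<in> carrier_vec d"
  shows "ip (wproj \<omega> *\<^sub>v x) (wproj \<omega>' *\<^sub>v y) = 0"
  using weight_vec_orthogonal[OF weight_vec_wproj weight_vec_wproj] assms weights_carrier by blast

lemma ip_wproj_left:
  assumes \<omega>: "\<omega> \<in> weights" and x: "x \<in> carrier_vec d" and y: "y \<in> carrier_vec d"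
  shows "ip (wproj \<omega> *\<^sub>v x) y = ip (wproj \<omega> *\<^sub>v x) (wproj \<omega> *\<^sub>v y)"
proof -
  have "ip (wproj \<omega> *\<^sub>v x) y = (\<Sum>\<omega>'\<in>weights. 1 * ip (wproj \<omega> *\<^sub>v x) (wproj \<omega>' *\<^sub>v y))"
    using wproj_sum[OF y] assms by (intro ip_sum_right[OF weights_finite]) auto
  also have "\<dots> = (\<Sum>\<omega>'\<in>weights. if \<omega>' = \<omega> then ip (wproj \<omega> *\<^sub>v x) (wproj \<omega> *\<^sub>v y) else 0)"
    using ip_wproj_cross[OF \<omega> _ _ x y] by (intro sum.cong) auto
  finally show ?thesis using \<omega> weights_finite by simp
qed

lemma ip_wproj_right:
  assumes \<omega>: "\<omega> \<in> weights" and x: "x \<in> carrier_vec d" and y: "y \<in> carrier_vec d"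
  shows "ip x (wproj \<omega> *\<^sub>v y) = ip (wproj \<omega> *\<^sub>v x) (wproj \<omega> *\<^sub>v y)"
  using ip_wproj_left[OF \<omega> y x] ip_cnj[of "wproj \<omega> *\<^sub>v y" x] ip_cnj[of "wproj \<omega> *\<^sub>v y" "wproj \<omega> *\<^sub>v x"] assms
  by simp

lemma ip_torus:
  assumes h: "\<forall>i<n. h i \<noteq> 0" and x: "x \<in> carrier_vec d" and y: "y \<in> carrier_vec d"
  shows "ip x (\<pi> (mat_diag n h) *\<^sub>v y) = (\<Sum>\<omega>\<in>weights. wchar n \<omega> h * ip (wproj \<omega> *\<^sub>v x) (wproj \<omega> *\<^sub>v y))"
proof -
  have G: "mat_diag n h \<in> GL n" using h by (intro GL_diag) auto
  have "ip x (\<pi> (mat_diag n h) *\<^sub>v y) = (\<Sum>\<omega>\<in>weights. wchar n \<omega> h * ip x (wproj \<omega> *\<^sub>v y))"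
    using torus_act[OF h y] x y G by (intro ip_sum_right[OF weights_finite]) auto
  then show ?thesis using ip_wproj_right[OF _ x y] by simp
qed

text \<open>The inner product is only known to be invariant under unitary matrices.  The relation \<open>\<pi>(g)\<^sup>\<dagger> = \<pi>(g\<^sup>\<dagger>)\<close> is
  multiplicative in \<open>g\<close> and holds for diagonal matrices, where the weight decomposition is orthogonal.\<close>

definition adjointable :: "complex mat \<Rightarrow> bool" where
  "adjointable g \<longleftrightarrow> g \<in> GL n \<and> (\<forall>x\<in>carrier_vec d. \<forall>y\<in>carrier_vec d. ip x (\<pi> g *\<^sub>v y) = ip (\<pi> (mat_adjoint g) *\<^sub>v x) y)"

lemma adjointable_mult:
  assumes "adjointable g" "adjointable h"
  shows "adjointable (g * h)"
proof -
  have G: "g \<in> GL n" "h \<in> GL n" using assms by (auto simp: adjointable_def)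
  have "ip x (\<pi> (g * h) *\<^sub>v y) = ip (\<pi> (mat_adjoint (g * h)) *\<^sub>v x) y"
    if "x \<in> carrier_vec d" "y \<in> carrier_vec d" for x y
  proof -
    have "ip x (\<pi> (g * h) *\<^sub>v y) = ip (\<pi> (mat_adjoint h) *\<^sub>v (\<pi> (mat_adjoint g) *\<^sub>v x)) y"
      using assms that G GL_adjoint by (simp add: act_mult adjointable_def)
    then show ?thesis
      using that G GL_adjoint by (simp add: mat_adjoint_mult[OF GL_carrier[OF G(1)] GL_carrier[OF G(2)]] act_mult)
  qed
  then show ?thesis using GL_mult[OF G] by (simp add: adjointable_def)
qed

lemma adjointable_unitary:
  assumes u: "u \<in> unitary_group n"
  shows "adjointable u"
proof -
  have "ip x (\<pi> u *\<^sub>v y) = ip (\<pi> (mat_adjoint u) *\<^sub>v x) y"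
    if "x \<in> carrier_vec d" "y \<in> carrier_vec d" for x y
    using ip_unitary[OF unitary_adjoint[OF u], of x "\<pi> u *\<^sub>v y"] that unitary_GL[OF u]
      act_inverse[OF unitary_GL[OF unitary_adjoint[OF u]] unitary_GL[OF u] unitary_adj_mult[OF u]] by simp
  then show ?thesis using unitary_GL[OF u] by (simp add: adjointable_def)
qed

lemma adjointable_torus:
  assumes h: "\<forall>i<n. h i \<noteq> 0"
  shows "adjointable (mat_diag n h)"
proof -
  have h': "\<forall>i<n. cnj (h i) \<noteq> 0" using h by simp
  have G: "mat_diag n h \<in> GL n" "mat_diag n (\<lambda>i. cnj (h i)) \<in> GL n" using h h' by (auto intro: GL_diag)
  have "ip x (\<pi> (mat_diag n h) *\<^sub>v y) = ip (\<pi> (mat_diag n (\<lambda>i. cnj (h i))) *\<^sub>v x) y"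
    if xy: "x \<in> carrier_vec d" "y \<in> carrier_vec d" for x y
  proof -
    have "ip (\<pi> (mat_diag n (\<lambda>i. cnj (h i))) *\<^sub>v x) y = cnj (ip y (\<pi> (mat_diag n (\<lambda>i. cnj (h i))) *\<^sub>v x))"
      using xy G by (intro ip_cnj) auto
    also have "\<dots> = (\<Sum>\<omega>\<in>weights. wchar n \<omega> h * ip (wproj \<omega> *\<^sub>v x) (wproj \<omega> *\<^sub>v y))"
      unfolding ip_torus[OF h' xy(2,1)] wchar_cnj using xy
      by (simp add: ip_cnj[of "wproj _ *\<^sub>v y" "wproj _ *\<^sub>v x", symmetric])
    finally show ?thesis unfolding ip_torus[OF h xy] ..
  qed
  then show ?thesis using G by (simp add: adjointable_def)
qed

text \<open>By the polar decomposition \<open>GL n\<close> is generated by unitary and diagonal matrices.\<close>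

lemma ip_adjoint:
  assumes g: "g \<in> GL n" and xy: "x \<in> carrier_vec d" "y \<in> carrier_vec d"
  shows "ip x (\<pi> g *\<^sub>v y) = ip (\<pi> (mat_adjoint g) *\<^sub>v x) y"
proof -
  obtain q u D where q: "q \<in> unitary_group n" and u: "u \<in> unitary_group n" and D: "\<forall>i<n. D i > (0 :: real)"
    and gq: "g = q * hdiag n u D"
    using polar_decomposition[OF g] by auto
  have "adjointable (q * (u * mat_diag n (\<lambda>i. complex_of_real (D i)) * mat_adjoint u))"
    using q u D by (intro adjointable_mult adjointable_unitary unitary_adjoint adjointable_torus) auto
  then show ?thesis using xy unfolding gq udiag_def adjointable_def by blast
qed

lemma ip_udiag:
  assumes u: "u \<in> unitary_group n" and f: "\<forall>i<n. f i \<noteq> 0" and xy: "x \<in> carrier_vec d" "y \<in> carrier_vec d"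
  shows "ip x (\<pi> (udiag n u f) *\<^sub>v y) = (\<Sum>\<omega>\<in>weights. wchar n \<omega> f *
    ip (wproj \<omega> *\<^sub>v (\<pi> (mat_adjoint u) *\<^sub>v x)) (wproj \<omega> *\<^sub>v (\<pi> (mat_adjoint u) *\<^sub>v y)))"
proof -
  note G = unitary_GL[OF u] unitary_GL[OF unitary_adjoint[OF u]]
  have F: "mat_diag n f \<in> GL n" using f by (intro GL_diag) auto
  have "\<pi> (udiag n u f) *\<^sub>v y = \<pi> u *\<^sub>v (\<pi> (mat_diag n f) *\<^sub>v (\<pi> (mat_adjoint u) *\<^sub>v y))"
    unfolding udiag_def using G F xy by (simp add: act_mult GL_mult)
  then have "ip x (\<pi> (udiag n u f) *\<^sub>v y) = ip (\<pi> (mat_adjoint u) *\<^sub>v x) (\<pi> (mat_diag n f) *\<^sub>v (\<pi> (mat_adjoint u) *\<^sub>v y))"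
    using ip_adjoint[OF G(1), of x "\<pi> (mat_diag n f) *\<^sub>v (\<pi> (mat_adjoint u) *\<^sub>v y)"] G F xy by simp
  also have "\<dots> = (\<Sum>\<omega>\<in>weights. wchar n \<omega> f *
    ip (wproj \<omega> *\<^sub>v (\<pi> (mat_adjoint u) *\<^sub>v x)) (wproj \<omega> *\<^sub>v (\<pi> (mat_adjoint u) *\<^sub>v y)))"
    using G xy by (intro ip_torus[OF f]) auto
  finally show ?thesis .
qed

end

section \<open>Highest weights\<close>

lemma wchar_uminus:
  assumes "\<omega> \<in> carrier_vec n"
  shows "wchar n (- \<omega>) h = inverse (wchar n \<omega> h)"
  unfolding wchar_def prod_inversef[symmetric] o_def using assms
  by (intro prod.cong) (auto simp: power_int_minus)

lemma det_unitriangular: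
  assumes "M \<in> carrier_mat n n" "upper_triangular M" "\<And>i. i < n \<Longrightarrow> M $$ (i, i) = (1 :: complex)"
  shows "det M = 1"
proof -
  have "diag_mat M = map (\<lambda>_. 1) [0..<n]" using assms by (auto simp: diag_mat_def)
  then show ?thesis unfolding det_upper_triangular[OF assms(2,1)] by (simp add: map_replicate_const)
qed

lemma GL_of_det:
  assumes "M \<in> carrier_mat n n" "det M \<noteq> (0 :: complex)"
  shows "M \<in> GL n"
proof -
  from det_non_zero_imp_unit[OF assms, of "()"]
  obtain B where "B \<in> carrier_mat n n" "B * M = 1\<^sub>m n"
    unfolding Units_def ring_mat_def by auto
  then show ?thesis using GL_I'[OF assms(1)] by blast
qed

text \<open>A limit at the identity, used for curves that contract a unitriangular matrix to the identity.\<close>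

lemma lin_diff_curve_constant:
  assumes f: "lin_diff n f" and \<gamma>: "\<And>s. \<gamma> s \<in> GL n" "\<gamma> 0 = 1\<^sub>m n"
    and deriv: "\<And>i j. i < n \<Longrightarrow> j < n \<Longrightarrow> ((\<lambda>s::complex. \<gamma> s $$ (i, j)) has_field_derivative H i j) (at 0)"
    and const: "\<And>s. s \<noteq> 0 \<Longrightarrow> f (\<gamma> s) = c"
  shows "f (1\<^sub>m n) = c"
proof -
  obtain L where L: "curve_deriv n f L" using f unfolding lin_diff_def by blast
  have "isCont (\<lambda>s. f (\<gamma> s)) 0"
    by (rule DERIV_isCont, rule curve_derivD[OF L \<gamma> deriv])
  then have "((\<lambda>s. f (\<gamma> s)) \<longlongrightarrow> f (1\<^sub>m n)) (at 0)" using \<gamma>(2) by (simp add: isCont_def)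
  moreover have "((\<lambda>s. f (\<gamma> s)) \<longlongrightarrow> c) (at 0)"
    by (rule tendsto_eventually) (auto simp: eventually_at_filter const)
  ultimately show ?thesis using tendsto_unique[of "at (0::complex)"] by (simp add: at_neq_bot)
qed

definition weight_sqnorm :: "nat \<Rightarrow> int vec \<Rightarrow> int" where
  "weight_sqnorm n \<omega> = (\<Sum>i<n. (\<omega> $ i)\<^sup>2)"

definition swap_mat :: "nat \<Rightarrow> nat \<Rightarrow> nat \<Rightarrow> complex mat" where
  "swap_mat n k l = mat n n (\<lambda>(i, j). if i = Transposition.transpose k l j then 1 else 0)"

lemma transpose_less: "k < n \<Longrightarrow> l < n \<Longrightarrow> i < n \<Longrightarrow> Transposition.transpose k l i < (n :: nat)"
  by (simp add: Transposition.transpose_def)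

lemma swap_mat_GL:
  assumes "k < n" "l < n"
  shows "swap_mat n k l \<in> GL n"
proof (rule GL_I)
  show c: "swap_mat n k l \<in> carrier_mat n n" "swap_mat n k l \<in> carrier_mat n n"
    by (auto simp: swap_mat_def)
  show "swap_mat n k l * swap_mat n k l = 1\<^sub>m n"
  proof (rule eq_matI)
    fix i j assume "i < dim_row (1\<^sub>m n :: complex mat)" "j < dim_col (1\<^sub>m n :: complex mat)"
    then have ij: "i < n" "j < n" by auto
    let ?t = "Transposition.transpose k l"
    have tj: "?t j < n" using transpose_less assms ij by blast
    have "(swap_mat n k l * swap_mat n k l) $$ (i, j) = (\<Sum>m<n. if m = ?t j then (if i = ?t m then 1 else 0) else 0)"
      unfolding index_mult_sum[OF c ij] using ij by (intro sum.cong) (auto simp: swap_mat_def)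
    also have "\<dots> = (1\<^sub>m n :: complex mat) $$ (i, j)" using tj ij by simp
    finally show "(swap_mat n k l * swap_mat n k l) $$ (i, j) = (1\<^sub>m n :: complex mat) $$ (i, j)" .
  qed (auto simp: swap_mat_def)
qed

lemma diag_swap_mat:
  assumes "k < n" "l < n"
  shows "mat_diag n h * swap_mat n k l = swap_mat n k l * mat_diag n (\<lambda>i. h (Transposition.transpose k l i))"
proof -
  have c: "swap_mat n k l \<in> carrier_mat n n" by (simp add: swap_mat_def)
  show ?thesis
    unfolding mat_diag_mult_left[OF c] mat_diag_mult_right[OF c]
    by (intro eq_matI) (auto simp: swap_mat_def)
qed

context unitary_rep
begin

lemma wproj_other:
  assumes "weight_vec \<omega> x" "\<omega> \<in> carrier_vec n" "\<omega>' \<in> weights" "\<omega>' \<noteq> \<omega>"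
  shows "wproj \<omega>' *\<^sub>v x = 0\<^sub>v d"
proof (rule ip_self_zero)
  note x = weight_vec_carrier[OF assms(1)]
  show "wproj \<omega>' *\<^sub>v x \<in> carrier_vec d" using assms x by simp
  show "ip (wproj \<omega>' *\<^sub>v x) (wproj \<omega>' *\<^sub>v x) = 0"
    unfolding ip_wproj_left[OF assms(3) x x, symmetric]
    using weight_vec_orthogonal[OF weight_vec_wproj[OF assms(3) x] assms(1)] assms weights_carrier by blast
qed

lemma weight_vec_in_weights:
  assumes "weight_vec \<omega> x" "x \<noteq> 0\<^sub>v d" "\<omega> \<in> carrier_vec n"
  shows "\<omega> \<in> weights"
proof (rule ccontr)
  assume "\<omega> \<notin> weights"
  then have "wproj \<omega>' *\<^sub>v x = 0\<^sub>v d" if "\<omega>' \<in> weights" for \<omega>'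
    using wproj_other[OF assms(1,3) that] that by blast
  then have "x $ a = 0" if "a < d" for a
    using wproj_sum[OF weight_vec_carrier[OF assms(1)] that] that by simp
  then have "x = 0\<^sub>v d" using weight_vec_carrier[OF assms(1)] by (intro eq_vecI) auto
  then show False using assms(2) by simp
qed

lemma weight_vec_exists:
  assumes \<omega>: "\<omega> \<in> weights"
  obtains x where "weight_vec \<omega> x" "x \<noteq> 0\<^sub>v d"
proof -
  have "\<exists>a<d. \<exists>b<d. wproj \<omega> $$ (a, b) \<noteq> 0"
  proof (rule ccontr)
    assume "\<not> ?thesis"
    then have "wproj \<omega> = 0\<^sub>m d d" using wproj_carrier[OF \<omega>] by (intro eq_matI) auto
    then show False using wproj_nonzero[OF \<omega>] by simp
  qed
  then obtain a b where ab: "a < d" "b < d" "wproj \<omega> $$ (a, b) \<noteq> 0" by blast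
  have "(wproj \<omega> *\<^sub>v unit_vec d b) $ a = (\<Sum>k<d. if k = b then wproj \<omega> $$ (a, k) else 0)"
    unfolding index_mult_vec_sum[OF wproj_carrier[OF \<omega>] unit_vec_carrier ab(1)]
    using ab by (intro sum.cong) auto
  then have "(wproj \<omega> *\<^sub>v unit_vec d b) $ a \<noteq> 0" using ab by simp
  then have "wproj \<omega> *\<^sub>v unit_vec d b \<noteq> 0\<^sub>v d" using ab by auto
  then show ?thesis using that weight_vec_wproj[OF \<omega>, of "unit_vec d b"] by simp
qed

lemma weight_vec_swap:
  assumes x: "weight_vec \<omega> x" and k: "k < n" "l < n"
  shows "weight_vec (vec n (\<lambda>i. \<omega> $ Transposition.transpose k l i)) (\<pi> (swap_mat n k l) *\<^sub>v x)"
  unfolding weight_vec_def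
proof (intro conjI allI impI)
  note xc = weight_vec_carrier[OF x] and S = swap_mat_GL[OF k]
  let ?t = "Transposition.transpose k l"
  show "\<pi> (swap_mat n k l) *\<^sub>v x \<in> carrier_vec d" using S xc by simp
  fix h :: "nat \<Rightarrow> complex" assume h: "\<forall>i<n. h i \<noteq> 0"
  have h': "\<forall>i<n. h (?t i) \<noteq> 0" using h transpose_less[OF k] by blast
  have G: "mat_diag n h \<in> GL n" "mat_diag n (\<lambda>i. h (?t i)) \<in> GL n"
    using h h' by (auto intro: GL_diag)
  have bij: "bij_betw ?t {..<n} {..<n}"
    using transpose_less[OF k] by (intro bij_betw_byWitness[where f' = ?t]) auto
  have "wchar n \<omega> (\<lambda>i. h (?t i)) = (\<Prod>i<n. h (?t i) powi (\<omega> $ ?t (?t i)))"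
    unfolding wchar_def by simp
  also have "\<dots> = (\<Prod>i<n. h i powi (\<omega> $ ?t i))"
    using prod.reindex_bij_betw[OF bij, of "\<lambda>i. h i powi (\<omega> $ ?t i)"] .
  also have "\<dots> = wchar n (vec n (\<lambda>i. \<omega> $ ?t i)) h" unfolding wchar_def by simp
  finally have w: "wchar n \<omega> (\<lambda>i. h (?t i)) = wchar n (vec n (\<lambda>i. \<omega> $ ?t i)) h" .
  have "\<pi> (mat_diag n h) *\<^sub>v (\<pi> (swap_mat n k l) *\<^sub>v x) = \<pi> (swap_mat n k l) *\<^sub>v (\<pi> (mat_diag n (\<lambda>i. h (?t i))) *\<^sub>v x)"
    using G S xc diag_swap_mat[OF k] by (simp add: act_mult[symmetric])
  then show "\<pi> (mat_diag n h) *\<^sub>v (\<pi> (swap_mat n k l) *\<^sub>v x) = wchar n (vec n (\<lambda>i. \<omega> $ ?t i)) h \<cdot>\<^sub>v (\<pi> (swap_mat n k l) *\<^sub>v x)"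
    using weight_vec_act[OF x h'] S xc by (simp add: act_smult w)
qed

text \<open>Dominant weights of maximal length.\<close>

definition extremal :: "int vec \<Rightarrow> bool" where
  "extremal \<omega> \<longleftrightarrow> \<omega> \<in> weights \<and> (\<forall>\<omega>'\<in>weights. weight_sqnorm n \<omega>' \<le> weight_sqnorm n \<omega>) \<and>
     (\<forall>i j. i < j \<and> j < n \<longrightarrow> \<omega> $ j \<le> \<omega> $ i)"

lemma extremal_exists:
  assumes "weights \<noteq> {}"
  shows "\<exists>\<omega>. extremal \<omega>"
proof -
  define M where "M = Max (weight_sqnorm n ` weights)"
  define WM where "WM = {\<omega>\<in>weights. weight_sqnorm n \<omega> = M}"
  \<comment> \<open>exchanging two entries in the wrong order increases this functional and keeps the length\<close>
  define score where "score \<omega> = (\<Sum>i<n. (int n - int i) * \<omega> $ i)" for \<omega> :: "int vec"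
  have max: "weight_sqnorm n \<omega> \<le> M" if "\<omega> \<in> weights" for \<omega>
    unfolding M_def using that weights_finite by simp
  have "M \<in> weight_sqnorm n ` weights" unfolding M_def using assms weights_finite by (intro Max_in) auto
  then have WM: "finite WM" "WM \<noteq> {}" unfolding WM_def using weights_finite by auto
  obtain \<omega> where \<omega>: "\<omega> \<in> WM" "\<And>\<omega>'. \<omega>' \<in> WM \<Longrightarrow> score \<omega>' \<le> score \<omega>"
  proof -
    have "Max (score ` WM) \<in> score ` WM" using WM by (intro Max_in) auto
    then obtain \<omega> where "\<omega> \<in> WM" "score \<omega> = Max (score ` WM)" by auto
    then show ?thesis using that[of \<omega>] WM by auto
  qed
  have \<omega>w: "\<omega> \<in> weights" "weight_sqnorm n \<omega> = M" using \<omega>(1) by (auto simp: WM_def)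
  have "\<omega> $ j \<le> \<omega> $ i" if ij: "i < j" "j < n" for i j
  proof (rule ccontr)
    assume less: "\<not> \<omega> $ j \<le> \<omega> $ i"
    let ?t = "Transposition.transpose i j"
    define \<omega>' where "\<omega>' = vec n (\<lambda>k. \<omega> $ ?t k)"
    have i: "i < n" using ij by simp
    obtain x where x: "weight_vec \<omega> x" "x \<noteq> 0\<^sub>v d" using weight_vec_exists[OF \<omega>w(1)] by blast
    have "\<omega>' \<in> weights"
      using weight_vec_in_weights[OF weight_vec_swap[OF x(1) i ij(2)]]
        act_nonzero[OF swap_mat_GL[OF i ij(2)] weight_vec_carrier[OF x(1)] x(2)] by (simp add: \<omega>'_def)
    moreover have bij: "bij_betw ?t {..<n} {..<n}"
      using transpose_less[OF i ij(2)] by (intro bij_betw_byWitness[where f' = ?t]) auto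
    have "weight_sqnorm n \<omega>' = weight_sqnorm n \<omega>"
      unfolding weight_sqnorm_def using sum.reindex_bij_betw[OF bij, of "\<lambda>k. (\<omega> $ k)\<^sup>2"] by (simp add: \<omega>'_def)
    ultimately have "score \<omega>' \<le> score \<omega>" using \<omega>(2) \<omega>w(2) by (simp add: WM_def)
    moreover have "score \<omega>' - score \<omega> = (int j - int i) * (\<omega> $ j - \<omega> $ i)"
    proof -
      have "score \<omega>' - score \<omega> = (\<Sum>k<n. (int n - int k) * (\<omega> $ ?t k - \<omega> $ k))"
        unfolding score_def sum_subtractf[symmetric] by (intro sum.cong) (auto simp: \<omega>'_def algebra_simps)
      also have "\<dots> = (\<Sum>k\<in>{i, j}. (int n - int k) * (\<omega> $ ?t k - \<omega> $ k))"
        using ij by (intro sum.mono_neutral_right) (auto simp: Transposition.transpose_def)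
      also have "\<dots> = (int j - int i) * (\<omega> $ j - \<omega> $ i)" using ij by (simp add: algebra_simps)
      finally show ?thesis .
    qed
    moreover have "(int j - int i) * (\<omega> $ j - \<omega> $ i) > 0" using ij less by (intro mult_pos_pos) auto
    ultimately show False by linarith
  qed
  then have "extremal \<omega>" unfolding extremal_def using \<omega>w max by auto
  then show ?thesis ..
qed

text \<open>Conjugating a unitriangular \<open>u\<close> by the torus moves \<open>\<pi> u x\<close> into the span of weights
  \<open>\<omega> + \<beta>\<close> with \<open>\<beta>\<close> a nonnegative combination of positive roots; apart from \<open>\<omega>\<close> itself these are
  longer than the dominant \<open>\<omega>\<close>, hence are not weights.  So \<open>\<pi> u x\<close> has weight \<open>\<omega>\<close>, and contracting \<open>u\<close> to the
  identity along the torus shows that it is \<open>x\<close>.\<close>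

lemma extremal_weight_vec_fixed:
  assumes \<omega>: "extremal \<omega>" and x: "weight_vec \<omega> x"
    and u: "u \<in> carrier_mat n n" "upper_triangular u" "\<And>i. i < n \<Longrightarrow> u $$ (i, i) = 1"
  shows "\<pi> u *\<^sub>v x = x"
proof -
  have \<omega>w: "\<omega> \<in> weights" and \<omega>c: "\<omega> \<in> carrier_vec n" using \<omega> weights_carrier by (auto simp: extremal_def)
  note xc = weight_vec_carrier[OF x]
  have uG: "u \<in> GL n" using GL_of_det[OF u(1)] det_unitriangular[OF u] by simp
  define y where "y = \<pi> u *\<^sub>v x"
  have yc: "y \<in> carrier_vec d" unfolding y_def using uG xc by simp
  define cu where "cu h = mat n n (\<lambda>(i, j). h i * u $$ (i, j) * inverse (h j))" for h
  have cuc: "cu h \<in> carrier_mat n n" for h by (simp add: cu_def)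
  have cu_tri: "upper_triangular (cu h)" for h
    using u(2) u(1) by (intro upper_triangularI) (auto simp: cu_def)
  have cu_diag: "cu h $$ (i, i) = 1" if "\<forall>i<n. h i \<noteq> 0" "i < n" for h i
    using that u(3) by (simp add: cu_def)
  have cu_det: "det (cu h) = 1" if "\<forall>i<n. h i \<noteq> 0" for h
    using det_unitriangular[OF cuc cu_tri cu_diag] that by blast
  have cuG: "cu h \<in> GL n" if "\<forall>i<n. h i \<noteq> 0" for h
    using GL_of_det[OF cuc] cu_det[OF that] by simp
  have cu_act: "wchar n \<omega> h \<cdot>\<^sub>v (\<pi> (cu h) *\<^sub>v x) = \<pi> (mat_diag n h) *\<^sub>v y" if h: "\<forall>i<n. h i \<noteq> 0" for h
  proof -
    have G: "mat_diag n h \<in> GL n" using h by (intro GL_diag) auto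
    have "cu h * mat_diag n h = mat_diag n h * u"
      unfolding mat_diag_mult_right[OF cuc] mat_diag_mult_left[OF u(1)] using h
      by (intro eq_matI) (auto simp: cu_def)
    then have "\<pi> (cu h) *\<^sub>v (\<pi> (mat_diag n h) *\<^sub>v x) = \<pi> (mat_diag n h) *\<^sub>v y"
      using G cuG[OF h] uG xc by (simp add: act_mult[symmetric] y_def)
    then show ?thesis using weight_vec_act[OF x h] cuG[OF h] xc by (simp add: act_smult)
  qed
  define C where "C = {\<beta>\<in>carrier_vec n. (\<Sum>l<n. \<omega> $ l * \<beta> $ l) \<ge> 0}"
  have C0: "0\<^sub>v n \<in> C" by (simp add: C_def)
  have Cadd: "\<alpha> + \<beta> \<in> C" if "\<alpha> \<in> C" "\<beta> \<in> C" for \<alpha> \<beta>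
    using that by (auto simp: C_def distrib_left sum.distrib)
  have entry: "laurent n C (\<lambda>h. cu h $$ (i, j))" if ij: "i < n" "j < n" for i j
  proof (cases "i \<le> j")
    case True
    let ?\<beta> = "unit_vec n i + - unit_vec n j"
    have pick: "(\<Sum>l<n. \<omega> $ l * unit_vec n k $ l) = \<omega> $ k" if "k < n" for k
    proof -
      have "(\<Sum>l<n. \<omega> $ l * unit_vec n k $ l) = (\<Sum>l<n. if l = k then \<omega> $ l else 0)"
        using that by (intro sum.cong) auto
      then show ?thesis using that by simp
    qed
    have "(\<Sum>l<n. \<omega> $ l * ?\<beta> $ l) = (\<Sum>l<n. \<omega> $ l * unit_vec n i $ l - \<omega> $ l * unit_vec n j $ l)"
      using ij by (intro sum.cong) (auto simp: algebra_simps)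
    also have "\<dots> = \<omega> $ i - \<omega> $ j" using pick[OF ij(1)] pick[OF ij(2)] by (simp add: sum_subtractf)
    also have "\<dots> \<ge> 0" using \<omega> True ij by (cases "i = j") (auto simp: extremal_def)
    finally have \<beta>: "?\<beta> \<in> C" by (simp add: C_def)
    have "laurent n C (\<lambda>h. u $$ (i, j) * wchar n ?\<beta> h)" using \<beta> by (intro laurent_monomial) auto
    then show ?thesis
    proof (rule laurent_cong)
      fix h :: "nat \<Rightarrow> complex" assume h: "\<forall>i<n. h i \<noteq> 0"
      have "wchar n ?\<beta> h = h i * inverse (h j)"
        using ij h by (subst wchar_add) (auto simp: wchar_uminus wchar_unit_vec)
      then show "cu h $$ (i, j) = u $$ (i, j) * wchar n ?\<beta> h" using ij by (simp add: cu_def)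
    qed
  next
    case False
    then have "cu h $$ (i, j) = 0" for h using upper_triangularD0[OF cu_tri cuc, of i j h] ij by simp
    then show ?thesis using laurent_0 by simp
  qed
  have other: "wproj \<omega>' *\<^sub>v y = 0\<^sub>v d" if \<omega>': "\<omega>' \<in> weights" "\<omega>' \<noteq> \<omega>" for \<omega>'
  proof (rule eq_vecI)
    fix a assume "a < dim_vec (0\<^sub>v d :: complex vec)"
    then have a: "a < d" by simp
    have "laurent n C (\<lambda>h. \<pi> (cu h) $$ (a, b))" if b: "b < d" for b
      by (rule laurent_rational[OF pi_rational[OF a b] Cadd C0])
        (use cuG entry in auto, rule laurent_cong[OF laurent_const[OF C0, of 1]], simp add: cu_det)
    then have "laurent n C (\<lambda>h. \<Sum>b<d. \<pi> (cu h) $$ (a, b) * x $ b)"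
      by (intro laurent_sum laurent_mult[OF _ _ Cadd] laurent_const C0) auto
    then have "laurent n C (\<lambda>h. (\<pi> (cu h) *\<^sub>v x) $ a)"
      by (rule laurent_cong) (use cuG index_mult_vec_sum[OF pi_carrier xc a] in blast)
    from laurent_shift[OF this \<omega>c]
    have "(wproj \<omega>' *\<^sub>v y) $ a = 0"
    proof (rule laurent_coeff_zero[OF _ weights_finite weights_carrier _ \<omega>'(1)])
      fix h :: "nat \<Rightarrow> real" assume "\<And>i. h i > 0"
      then have h: "\<forall>i<n. complex_of_real (h i) \<noteq> 0" by (simp add: less_imp_neq[symmetric])
      have "wchar n \<omega> (\<lambda>i. complex_of_real (h i)) * (\<pi> (cu (\<lambda>i. complex_of_real (h i))) *\<^sub>v x) $ a
        = (wchar n \<omega> (\<lambda>i. complex_of_real (h i)) \<cdot>\<^sub>v (\<pi> (cu (\<lambda>i. complex_of_real (h i))) *\<^sub>v x)) $ a"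
        using a pi_carrier[OF cuG[OF h]] by simp
      then show "wchar n \<omega> (\<lambda>i. complex_of_real (h i)) * (\<pi> (cu (\<lambda>i. complex_of_real (h i))) *\<^sub>v x) $ a =
        (\<Sum>\<omega>\<in>weights. (wproj \<omega> *\<^sub>v y) $ a * wchar n \<omega> (\<lambda>i. complex_of_real (h i)))"
        unfolding cu_act[OF h] torus_act[OF h yc a] by (simp add: mult.commute)
    next
      show "\<omega>' \<notin> (+) \<omega> ` C"
      proof
        assume "\<omega>' \<in> (+) \<omega> ` C"
        then obtain \<beta> where \<beta>: "\<beta> \<in> carrier_vec n" "(\<Sum>l<n. \<omega> $ l * \<beta> $ l) \<ge> 0" "\<omega>' = \<omega> + \<beta>" by (auto simp: C_def)
        obtain i where i: "i < n" "\<beta> $ i \<noteq> 0"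
        proof (rule ccontr)
          assume "\<not> thesis"
          then have "\<beta> = 0\<^sub>v n" using that \<beta>(1) by (intro eq_vecI) auto
          then show False using \<omega>'(2) \<beta>(3) \<omega>c by simp
        qed
        have "weight_sqnorm n \<omega>' = (\<Sum>l<n. (\<omega> $ l)\<^sup>2 + 2 * (\<omega> $ l * \<beta> $ l) + (\<beta> $ l)\<^sup>2)"
          unfolding weight_sqnorm_def \<beta>(3) using \<omega>c \<beta>(1) by (intro sum.cong) (auto simp: power2_sum)
        also have "\<dots> = weight_sqnorm n \<omega> + 2 * (\<Sum>l<n. \<omega> $ l * \<beta> $ l) + weight_sqnorm n \<beta>"
          unfolding weight_sqnorm_def by (simp add: sum.distrib sum_distrib_left)
        finally have "weight_sqnorm n \<omega>' \<ge> weight_sqnorm n \<omega> + weight_sqnorm n \<beta>" using \<beta>(2) by linarith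
        moreover have "weight_sqnorm n \<beta> > 0"
          unfolding weight_sqnorm_def using i by (intro sum_pos2[of _ i]) auto
        moreover have "weight_sqnorm n \<omega>' \<le> weight_sqnorm n \<omega>" using \<omega> \<omega>'(1) by (auto simp: extremal_def)
        ultimately show False by linarith
      qed
    qed
    then show "(wproj \<omega>' *\<^sub>v y) $ a = 0\<^sub>v d $ a" using a by simp
  qed (use wproj_carrier[OF \<omega>'(1)] in simp)
  have "y = wproj \<omega> *\<^sub>v y"
  proof (rule eq_vecI)
    fix a assume "a < dim_vec (wproj \<omega> *\<^sub>v y)"
    then have a: "a < d" using wproj_carrier[OF \<omega>w] by simp
    have "y $ a = (\<Sum>\<omega>'\<in>weights. if \<omega>' = \<omega> then (wproj \<omega> *\<^sub>v y) $ a else 0)"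
      unfolding wproj_sum[OF yc a] using other a by (intro sum.cong) auto
    then show "y $ a = (wproj \<omega> *\<^sub>v y) $ a" using \<omega>w weights_finite by simp
  qed (use wproj_carrier[OF \<omega>w] yc in simp)
  then have y: "weight_vec \<omega> y" using weight_vec_wproj[OF \<omega>w yc] by simp
  define \<gamma> where "\<gamma> s = mat n n (\<lambda>(i, j). if i \<le> j then u $$ (i, j) * s ^ (j - i) else 0)" for s :: complex
  have \<gamma>0: "\<gamma> 0 = 1\<^sub>m n" unfolding \<gamma>_def using u by (intro eq_matI) (auto simp: power_0_left)
  have \<gamma>G: "\<gamma> s \<in> GL n" for s
  proof -
    have "det (\<gamma> s) = 1"
      by (rule det_unitriangular[of _ n]) (auto intro!: upper_triangularI simp: \<gamma>_def u)
    then show ?thesis by (intro GL_of_det) (auto simp: \<gamma>_def)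
  qed
  have \<gamma>_act: "\<pi> (\<gamma> s) *\<^sub>v x = y" if s: "s \<noteq> 0" for s
  proof -
    define h where "h i = inverse s ^ i" for i :: nat
    have h: "\<forall>i<n. h i \<noteq> 0" using s by (simp add: h_def)
    have "\<gamma> s = cu h"
    proof (rule eq_matI)
      fix i j assume "i < dim_row (cu h)" "j < dim_col (cu h)"
      then have ij: "i < n" "j < n" by (auto simp: cu_def)
      show "\<gamma> s $$ (i, j) = cu h $$ (i, j)"
      proof (cases "i \<le> j")
        case True
        then have "s ^ (j - i) = h i * inverse (h j)" using s
          by (simp add: h_def power_inverse power_diff field_simps)
        then show ?thesis using ij True by (simp add: \<gamma>_def cu_def)
      next
        case False
        then show ?thesis using ij upper_triangularD0[OF u(2,1), of i j] by (simp add: \<gamma>_def cu_def)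
      qed
    qed (auto simp: \<gamma>_def cu_def)
    then have "wchar n \<omega> h \<cdot>\<^sub>v (\<pi> (\<gamma> s) *\<^sub>v x) = wchar n \<omega> h \<cdot>\<^sub>v y"
      using cu_act[OF h] weight_vec_act[OF y h] by simp
    then have "inverse (wchar n \<omega> h) \<cdot>\<^sub>v (wchar n \<omega> h \<cdot>\<^sub>v (\<pi> (\<gamma> s) *\<^sub>v x)) = inverse (wchar n \<omega> h) \<cdot>\<^sub>v (wchar n \<omega> h \<cdot>\<^sub>v y)"
      by simp
    moreover have "wchar n \<omega> h \<noteq> 0" using h by (intro wchar_nonzero) auto
    ultimately show ?thesis by (simp add: smult_smult_assoc)
  qed
  show "\<pi> u *\<^sub>v x = x"
    unfolding y_def[symmetric]
  proof (rule eq_vecI)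
    fix a assume "a < dim_vec x"
    then have a: "a < d" using xc by simp
    have "lin_diff n (\<lambda>g. (\<pi> g *\<^sub>v x) $ a)"
    proof (rule lin_diff_cong)
      show "lin_diff n (\<lambda>g. \<Sum>b<d. \<pi> g $$ (a, b) * x $ b)"
        by (intro lin_diff_sum lin_diff_mult lin_diff_const lin_diff_rational pi_rational a) auto
    qed (rule index_mult_vec_sum[OF pi_carrier xc a])
    then have "(\<pi> (1\<^sub>m n) *\<^sub>v x) $ a = y $ a"
    proof (rule lin_diff_curve_constant[of n _ \<gamma>, OF _ \<gamma>G \<gamma>0])
      fix i j assume ij: "i < n" "j < n"
      show "((\<lambda>s. \<gamma> s $$ (i, j)) has_field_derivative
          (if i \<le> j then u $$ (i, j) * (of_nat (j - i) * 0 ^ (j - i - 1)) else 0)) (at 0)"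
        using ij by (auto simp: \<gamma>_def intro!: derivative_eq_intros)
    qed (simp add: \<gamma>_act)
    then show "y $ a = x $ a" using act_one[OF xc] by simp
  qed (use xc yc in simp)
qed

text \<open>A triangular matrix is a diagonal matrix times a unitriangular one.\<close>

lemma upper_triangular_act:
  assumes x: "weight_vec \<omega> x"
    and fixed: "\<And>u. u \<in> carrier_mat n n \<Longrightarrow> upper_triangular u \<Longrightarrow> (\<And>i. i < n \<Longrightarrow> u $$ (i, i) = 1) \<Longrightarrow> \<pi> u *\<^sub>v x = x"
    and R: "R \<in> GL n" "upper_triangular R"
  shows "\<pi> R *\<^sub>v x = wchar n \<omega> (\<lambda>i. R $$ (i, i)) \<cdot>\<^sub>v x"
proof -
  note Rc = GL_carrier[OF R(1)] and nz = upper_triangular_GL_diag[OF R]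
  define u where "u = mat n n (\<lambda>(i, j). inverse (R $$ (i, i)) * R $$ (i, j))"
  have u: "u \<in> carrier_mat n n" "upper_triangular u" "\<And>i. i < n \<Longrightarrow> u $$ (i, i) = 1"
    using Rc upper_triangularD0[OF R(2) Rc] nz by (auto simp: u_def intro!: upper_triangularI)
  have uG: "u \<in> GL n" using GL_of_det[OF u(1)] det_unitriangular[OF u] by simp
  have D: "mat_diag n (\<lambda>i. R $$ (i, i)) \<in> GL n" using nz by (rule GL_diag)
  have "R = mat_diag n (\<lambda>i. R $$ (i, i)) * u"
    unfolding mat_diag_mult_left[OF u(1)] using Rc nz by (intro eq_matI) (auto simp: u_def)
  then have "\<pi> R *\<^sub>v x = \<pi> (mat_diag n (\<lambda>i. R $$ (i, i))) *\<^sub>v (\<pi> u *\<^sub>v x)"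
    using act_mult[OF D uG weight_vec_carrier[OF x]] by simp
  then show ?thesis using fixed[OF u] weight_vec_act[OF x] nz by simp
qed

text \<open>For positive definite matrices this follows from the Cholesky factorisation.  In a fixed unitary
  eigenbasis the matrix coefficient is a Laurent polynomial in the eigenvalues that vanishes at positive
  arguments, so it vanishes identically and the claim extends to unitary matrices.\<close>

lemma extremal_orthogonal_orbit:
  assumes \<omega>: "extremal \<omega>" and x: "weight_vec \<omega> x" and y: "weight_vec \<omega> y" and xy: "ip y x = 0" and g: "g \<in> GL n"
  shows "ip y (\<pi> g *\<^sub>v x) = 0"
proof -
  note xc = weight_vec_carrier[OF x] and yc = weight_vec_carrier[OF y]
  have up: "\<pi> R *\<^sub>v z = wchar n \<omega> (\<lambda>i. R $$ (i, i)) \<cdot>\<^sub>v z"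
    if "weight_vec \<omega> z" "R \<in> GL n" "upper_triangular R" for R z
    by (rule upper_triangular_act[OF that(1) _ that(2,3)]) (rule extremal_weight_vec_fixed[OF \<omega> that(1)])
  have U: "ip y (\<pi> Q *\<^sub>v x) = 0" if Q: "Q \<in> unitary_group n" for Q
  proof -
    obtain u z where u: "u \<in> unitary_group n" and z: "\<forall>i<n. z i \<noteq> 0" and Qz: "Q = udiag n u z"
      using unitary_spectral[OF Q] unfolding udiag_def by auto
    let ?c = "\<lambda>\<omega>. ip (wproj \<omega> *\<^sub>v (\<pi> (mat_adjoint u) *\<^sub>v y)) (wproj \<omega> *\<^sub>v (\<pi> (mat_adjoint u) *\<^sub>v x))"
    have "?c \<omega>' = 0" if "\<omega>' \<in> weights" for \<omega>'
    proof (rule wchar_independent[OF weights_finite weights_carrier _ that])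
      fix h :: "nat \<Rightarrow> real" assume h: "\<And>i. h i > 0"
      then have h': "\<forall>i<n. complex_of_real (h i) \<noteq> 0" by (simp add: less_imp_neq[symmetric])
      obtain B where B: "B \<in> GL n" "upper_triangular B" "hdiag n u h = mat_adjoint B * B"
        using cholesky_udiag[OF u, of h] h by blast
      have "ip y (\<pi> (mat_adjoint B * B) *\<^sub>v x) = ip (\<pi> B *\<^sub>v y) (\<pi> B *\<^sub>v x)"
        using ip_adjoint[OF GL_adjoint[OF B(1)], of y "\<pi> B *\<^sub>v x"] B(1) xc yc GL_adjoint[OF B(1)]
        by (simp add: act_mult)
      also have "\<dots> = 0"
        using xy xc yc by (simp add: up[OF x B(1,2)] up[OF y B(1,2)] ip_smult_left ip_smult_right)
      finally show "(\<Sum>\<omega>\<in>weights. ?c \<omega> * wchar n \<omega> (\<lambda>i. complex_of_real (h i))) = 0"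
        unfolding B(3)[symmetric] ip_udiag[OF u h' yc xc] by (simp add: mult.commute)
    qed
    then show ?thesis unfolding Qz ip_udiag[OF u z yc xc] by simp
  qed
  obtain Q R where Q: "Q \<in> unitary_group n" and R: "R \<in> carrier_mat n n" "upper_triangular R" and QR: "g = Q * R"
    using QR_exists[OF GL_carrier[OF g]] by blast
  have "R = mat_adjoint Q * g" using QR unitary_cancel(1)[OF Q R(1)] by simp
  then have RG: "R \<in> GL n" using GL_mult[OF unitary_GL[OF unitary_adjoint[OF Q]] g] by simp
  have "\<pi> g *\<^sub>v x = wchar n \<omega> (\<lambda>i. R $$ (i, i)) \<cdot>\<^sub>v (\<pi> Q *\<^sub>v x)"
    unfolding QR using unitary_GL[OF Q] RG xc up[OF x RG R(2)] by (simp add: act_mult act_smult)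
  then show ?thesis using U[OF Q] unitary_GL[OF Q] xc yc by (simp add: ip_smult_right)
qed

inductive_set orbit_span :: "complex vec \<Rightarrow> complex vec set" for x where
  orbit: "g \<in> GL n \<Longrightarrow> \<pi> g *\<^sub>v x \<in> orbit_span x"
| add: "y \<in> orbit_span x \<Longrightarrow> z \<in> orbit_span x \<Longrightarrow> y + z \<in> orbit_span x"
| smult: "y \<in> orbit_span x \<Longrightarrow> a \<cdot>\<^sub>v y \<in> orbit_span x"

lemma orbit_span_carrier: "y \<in> orbit_span x \<Longrightarrow> x \<in> carrier_vec d \<Longrightarrow> y \<in> carrier_vec d"
  by (induction rule: orbit_span.induct) auto

lemma orbit_span_self: "x \<in> carrier_vec d \<Longrightarrow> x \<in> orbit_span x"
  using orbit_span.orbit[of "1\<^sub>m n" x] act_one by simp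

lemma subspace_iff:
  "VectorSpace.subspace class_ring W (module_vec TYPE(complex) d) \<longleftrightarrow>
    W \<subseteq> carrier_vec d \<and> 0\<^sub>v d \<in> W \<and> (\<forall>x\<in>W. \<forall>y\<in>W. x + y \<in> W) \<and> (\<forall>a. \<forall>x\<in>W. a \<cdot>\<^sub>v x \<in> W)"
  unfolding VectorSpace.subspace_def LinearCombinations.submodule_def
  using vec_vs[where 'a = complex, of d] vec_module[where 'a = complex, of d]
  by (auto simp: module_vec_simps)

lemma orbit_span_invariant:
  assumes "x \<in> carrier_vec d"
  shows "invariant_subspace n d \<pi> (orbit_span x)"
proof -
  have "0 \<cdot>\<^sub>v x = 0\<^sub>v d" using assms by (intro eq_vecI) auto
  then have "0\<^sub>v d \<in> orbit_span x" using orbit_span.smult[OF orbit_span_self[OF assms], of 0] by simp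
  moreover have "\<pi> g *\<^sub>v y \<in> orbit_span x" if g: "g \<in> GL n" and "y \<in> orbit_span x" for g y
    using that(2)
  proof (induction rule: orbit_span.induct)
    case (orbit h)
    then show ?case using orbit_span.orbit[OF GL_mult[OF g orbit], of x] act_mult[OF g orbit assms] by simp
  qed (use g assms orbit_span_carrier act_add act_smult in \<open>auto intro: orbit_span.intros\<close>)
  ultimately show ?thesis
    unfolding invariant_subspace_def subspace_iff
    using orbit_span_carrier[OF _ assms] by (auto intro: orbit_span.intros)
qed

text \<open>An invariant subspace contains the weight components of its elements: a torus element that
  separates \<open>\<omega>\<close> from another weight allows to remove that weight from a vector without changing its
  component of weight \<open>\<omega>\<close>.\<close>

lemma invariant_wproj:
  assumes U: "invariant_subspace n d \<pi> U" and \<omega>: "\<omega> \<in> weights" and y: "y \<in> U"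
  shows "wproj \<omega> *\<^sub>v y \<in> U"
proof -
  have sub: "U \<subseteq> carrier_vec d" "\<And>x y. x \<in> U \<Longrightarrow> y \<in> U \<Longrightarrow> x + y \<in> U" "\<And>a x. x \<in> U \<Longrightarrow> a \<cdot>\<^sub>v x \<in> U"
    "\<And>g x. g \<in> GL n \<Longrightarrow> x \<in> U \<Longrightarrow> \<pi> g *\<^sub>v x \<in> U"
    using U unfolding invariant_subspace_def subspace_iff by auto
  have "finite F \<Longrightarrow> y \<in> U \<Longrightarrow> (\<forall>\<omega>'\<in>weights - insert \<omega> F. wproj \<omega>' *\<^sub>v y = 0\<^sub>v d) \<Longrightarrow> F \<subseteq> weights - {\<omega>} \<Longrightarrow>
    wproj \<omega> *\<^sub>v y \<in> U" for F y
  proof (induction F arbitrary: y rule: finite_induct)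
    case empty
    have yc: "y \<in> carrier_vec d" using empty sub by auto
    have "wproj \<omega> *\<^sub>v y = y"
    proof (rule eq_vecI)
      fix a assume "a < dim_vec y"
      then have a: "a < d" using yc by simp
      have "y $ a = (\<Sum>\<omega>'\<in>weights. if \<omega>' = \<omega> then (wproj \<omega> *\<^sub>v y) $ a else 0)"
        unfolding wproj_sum[OF yc a] using empty a by (intro sum.cong) auto
      then show "(wproj \<omega> *\<^sub>v y) $ a = y $ a" using \<omega> weights_finite by simp
    qed (use wproj_carrier[OF \<omega>] yc in simp)
    then show ?case using empty by simp
  next
    case (insert \<omega>1 F)
    have yc: "y \<in> carrier_vec d" using insert.prems sub by auto
    have \<omega>1: "\<omega>1 \<in> weights" "\<omega> \<noteq> \<omega>1" using insert.prems by auto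
    obtain t :: "nat \<Rightarrow> real" where t: "\<And>i. t i > 0"
      "wchar n \<omega> (\<lambda>i. complex_of_real (t i)) \<noteq> wchar n \<omega>1 (\<lambda>i. complex_of_real (t i))"
      using wchar_separates[of \<omega> n \<omega>1] \<omega> \<omega>1 weights_carrier by blast
    let ?h = "\<lambda>i. complex_of_real (t i)"
    have h: "\<forall>i<n. ?h i \<noteq> 0" using t(1) by (simp add: less_imp_neq[symmetric])
    have G: "mat_diag n ?h \<in> GL n" using h by (intro GL_diag) auto
    define b where "b = inverse (wchar n \<omega> ?h - wchar n \<omega>1 ?h)"
    define y' where "y' = b \<cdot>\<^sub>v (\<pi> (mat_diag n ?h) *\<^sub>v y + (- wchar n \<omega>1 ?h) \<cdot>\<^sub>v y)"
    have y'U: "y' \<in> U" unfolding y'_def using insert.prems(1) sub G by auto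
    have pr: "wproj \<omega>' *\<^sub>v y' = (b * (wchar n \<omega>' ?h - wchar n \<omega>1 ?h)) \<cdot>\<^sub>v (wproj \<omega>' *\<^sub>v y)" if \<omega>': "\<omega>' \<in> weights" for \<omega>'
    proof -
      note P = wproj_carrier[OF \<omega>']
      have "wproj \<omega>' *\<^sub>v y' = b \<cdot>\<^sub>v (wchar n \<omega>' ?h \<cdot>\<^sub>v (wproj \<omega>' *\<^sub>v y) + (- wchar n \<omega>1 ?h) \<cdot>\<^sub>v (wproj \<omega>' *\<^sub>v y))"
        unfolding y'_def using G yc wproj_torus[OF \<omega>' h yc]
        by (simp add: mult_mat_vec[OF P] mult_add_distrib_mat_vec[OF P])
      then show ?thesis using P yc by (intro eq_vecI) (auto simp: algebra_simps)
    qed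
    have "wproj \<omega> *\<^sub>v y' \<in> U"
    proof (rule insert.IH[OF y'U])
      show "\<forall>\<omega>'\<in>weights - insert \<omega> F. wproj \<omega>' *\<^sub>v y' = 0\<^sub>v d"
      proof
        fix \<omega>' assume \<omega>': "\<omega>' \<in> weights - insert \<omega> F"
        show "wproj \<omega>' *\<^sub>v y' = 0\<^sub>v d"
        proof (cases "\<omega>' = \<omega>1")
          case True
          then show ?thesis using pr[of \<omega>'] \<omega>' wproj_carrier[of \<omega>'] by (intro eq_vecI) auto
        next
          case False
          then show ?thesis using pr[of \<omega>'] \<omega>' insert.prems(2) by auto
        qed
      qed
    qed (use insert.prems in auto)
    moreover have "b * (wchar n \<omega> ?h - wchar n \<omega>1 ?h) = 1" using t(2) by (simp add: b_def)
    ultimately show ?case using pr[OF \<omega>] by simp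
  qed
  from this[of "weights - {\<omega>}" y] show ?thesis using weights_finite y by auto
qed

text \<open>Let \<open>U\<close> be an invariant subspace of the span.  If \<open>U\<close> is orthogonal to \<open>x\<close>, it is orthogonal to the
  orbit and hence to itself.  Otherwise \<open>U\<close> contains a vector \<open>y0\<close> of weight \<open>\<omega>\<close> with a nonzero component along \<open>x\<close>; the
  remaining component is orthogonal to the orbit of \<open>x\<close> and lies in its span, so it vanishes and \<open>x\<close> lies in \<open>U\<close>.\<close>

lemma extremal_orbit_span_irreducible:
  assumes \<omega>: "extremal \<omega>" and x: "weight_vec \<omega> x" "x \<noteq> 0\<^sub>v d"
  shows "irreducible_subrepresentation n d \<pi> (orbit_span x)"
proof -
  note xc = weight_vec_carrier[OF x(1)]
  have \<omega>w: "\<omega> \<in> weights" using \<omega> by (simp add: extremal_def)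
  have orth: "ip y z = 0" if "z \<in> orbit_span x" "y \<in> carrier_vec d" "\<And>g. g \<in> GL n \<Longrightarrow> ip y (\<pi> g *\<^sub>v x) = 0" for y z
    using that(1)
    by (induction rule: orbit_span.induct)
      (use that xc orbit_span_carrier ip_add_right ip_smult_right in auto)
  have "U = {0\<^sub>v d} \<or> U = orbit_span x" if U: "invariant_subspace n d \<pi> U" and sub: "U \<subseteq> orbit_span x" for U
  proof -
    have Us: "U \<subseteq> carrier_vec d" "0\<^sub>v d \<in> U" "\<And>x y. x \<in> U \<Longrightarrow> y \<in> U \<Longrightarrow> x + y \<in> U" "\<And>a x. x \<in> U \<Longrightarrow> a \<cdot>\<^sub>v x \<in> U"
      "\<And>g x. g \<in> GL n \<Longrightarrow> x \<in> U \<Longrightarrow> \<pi> g *\<^sub>v x \<in> U"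
      using U unfolding invariant_subspace_def subspace_iff by auto
    show ?thesis
    proof (cases "\<forall>y\<in>U. ip y x = 0")
      case True
      have "y = 0\<^sub>v d" if y: "y \<in> U" for y
      proof -
        have yc: "y \<in> carrier_vec d" using y Us by auto
        have "ip y (\<pi> g *\<^sub>v x) = 0" if g: "g \<in> GL n" for g
          using ip_adjoint[OF g yc xc] True Us(5)[OF GL_adjoint[OF g] y] by simp
        then show ?thesis using orth[of y y] y sub yc ip_self_zero by auto
      qed
      then show ?thesis using Us(2) by blast
    next
      case False
      then obtain y where y: "y \<in> U" "ip y x \<noteq> 0" by auto
      have yc: "y \<in> carrier_vec d" using y Us by auto
      define y0 where "y0 = wproj \<omega> *\<^sub>v y"
      have y0U: "y0 \<in> U" unfolding y0_def by (rule invariant_wproj[OF U \<omega>w y(1)])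
      have y0w: "weight_vec \<omega> y0" unfolding y0_def by (rule weight_vec_wproj[OF \<omega>w yc])
      note y0c = weight_vec_carrier[OF y0w]
      have "ip y0 x = ip y x"
      proof -
        have "ip x y = (\<Sum>\<omega>'\<in>weights. 1 * ip x (wproj \<omega>' *\<^sub>v y))"
          using wproj_sum[OF yc] xc yc by (intro ip_sum_right[OF weights_finite]) auto
        also have "\<dots> = (\<Sum>\<omega>'\<in>weights. if \<omega>' = \<omega> then ip x y0 else 0)"
          using weight_vec_orthogonal[OF x(1) weight_vec_wproj[OF _ yc]] \<omega>w weights_carrier
          by (intro sum.cong) (auto simp: y0_def)
        finally have "ip x y = ip x y0" using \<omega>w weights_finite by simp
        then show ?thesis using ip_cnj[OF xc yc] ip_cnj[OF xc y0c] by simp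
      qed
      then have "ip x y0 \<noteq> 0" using y(2) ip_cnj[OF xc y0c] by auto
      define c where "c = ip x y0 / ip x x"
      have xx: "ip x x \<noteq> 0" using ip_self_zero[OF xc] x(2) by blast
      have c: "c \<noteq> 0" using \<open>ip x y0 \<noteq> 0\<close> xx by (simp add: c_def)
      define z where "z = y0 + (- c) \<cdot>\<^sub>v x"
      have zc: "z \<in> carrier_vec d" unfolding z_def using y0c xc by simp
      have zw: "weight_vec \<omega> z"
        unfolding weight_vec_def
      proof (intro conjI allI impI zc)
        fix h :: "nat \<Rightarrow> complex" assume h: "\<forall>i<n. h i \<noteq> 0"
        have G: "mat_diag n h \<in> GL n" using h by (intro GL_diag) auto
        show "\<pi> (mat_diag n h) *\<^sub>v z = wchar n \<omega> h \<cdot>\<^sub>v z"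
          unfolding z_def using y0c xc G weight_vec_act[OF x(1) h] weight_vec_act[OF y0w h]
          by (simp add: act_add act_smult smult_add_distrib_vec[of _ d] smult_smult_assoc mult.commute)
      qed
      have "ip x z = 0" unfolding z_def using y0c xc xx by (simp add: ip_add_right ip_smult_right c_def)
      then have zx: "ip z x = 0" using ip_cnj[OF xc zc] by simp
      have "z \<in> orbit_span x"
        unfolding z_def using y0U sub orbit_span_self[OF xc] by (auto intro: orbit_span.intros)
      then have "ip z z = 0"
        using orth[OF _ zc] extremal_orthogonal_orbit[OF \<omega> x(1) zw zx] by blast
      then have "z = 0\<^sub>v d" using ip_self_zero[OF zc] by blast
      then have "y0 = c \<cdot>\<^sub>v x"
      proof -
        have "y0 $ a = c * x $ a" if "a < d" for a
          using arg_cong[OF \<open>z = 0\<^sub>v d\<close>, of "\<lambda>v. v $ a"] that y0c xc by (simp add: z_def)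
        then show ?thesis using y0c xc by (intro eq_vecI) auto
      qed
      then have "inverse c \<cdot>\<^sub>v y0 = x" using c xc by (simp add: smult_smult_assoc)
      then have xU: "x \<in> U" using Us(4)[OF y0U, of "inverse c"] by simp
      have "z \<in> U" if "z \<in> orbit_span x" for z
        using that by (induction rule: orbit_span.induct) (use Us xU in auto)
      then show ?thesis using sub by auto
    qed
  qed
  moreover have "orbit_span x \<noteq> {0\<^sub>v d}" using orbit_span_self[OF xc] x(2) by auto
  ultimately show ?thesis
    unfolding irreducible_subrepresentation_def using orbit_span_invariant[OF xc] by blast
qed

lemma highest_weight_vector_weight_vec:
  assumes "highest_weight_vector n d \<pi> \<omega> w"
  shows "weight_vec \<omega> w" "w \<noteq> 0\<^sub>v d" "\<omega> \<in> carrier_vec n"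
proof -
  show "w \<noteq> 0\<^sub>v d" "\<omega> \<in> carrier_vec n" using assms by (auto simp: highest_weight_vector_def)
  show "weight_vec \<omega> w"
    unfolding weight_vec_def
  proof (intro conjI allI impI)
    show "w \<in> carrier_vec d" using assms by (auto simp: highest_weight_vector_def)
    fix h :: "nat \<Rightarrow> complex" assume h: "\<forall>i<n. h i \<noteq> 0"
    have "mat_diag n h \<in> GL n" using h by (intro GL_diag) auto
    moreover have "diagonal_mat (mat_diag n h)" by (auto simp: diagonal_mat_def)
    ultimately have "\<pi> (mat_diag n h) *\<^sub>v w = (\<Prod>i<n. (mat_diag n h $$ (i, i)) powi (\<omega> $ i)) \<cdot>\<^sub>v w"
      using assms unfolding highest_weight_vector_def by blast
    also have "(\<Prod>i<n. (mat_diag n h $$ (i, i)) powi (\<omega> $ i)) = wchar n \<omega> h"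
      unfolding wchar_def by (intro prod.cong) auto
    finally show "\<pi> (mat_diag n h) *\<^sub>v w = wchar n \<omega> h \<cdot>\<^sub>v w" .
  qed
qed

lemma extremal_highest_weight:
  assumes \<omega>: "extremal \<omega>"
  shows "\<omega> \<in> highest_weights n d \<pi>"
proof -
  have \<omega>w: "\<omega> \<in> weights" using \<omega> by (simp add: extremal_def)
  obtain x where x: "weight_vec \<omega> x" "x \<noteq> 0\<^sub>v d" using weight_vec_exists[OF \<omega>w] by blast
  have "highest_weight_vector n d \<pi> \<omega> x"
    unfolding highest_weight_vector_def
  proof (intro conjI ballI impI)
    show "\<omega> \<in> carrier_vec n" using \<omega>w weights_carrier by auto
    show "x \<in> carrier_vec d" by (rule weight_vec_carrier[OF x(1)])
    show "\<pi> u *\<^sub>v x = x" if "u \<in> carrier_mat n n" "upper_triangular u \<and> (\<forall>i<n. u $$ (i, i) = 1)" for u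
      using extremal_weight_vec_fixed[OF \<omega> x(1)] that by blast
    fix h assume h: "h \<in> GL n" "diagonal_mat h"
    note hc = GL_carrier[OF h(1)]
    have hd: "h = mat_diag n (\<lambda>i. h $$ (i, i))" using h(2) hc by (intro eq_matI) (auto simp: diagonal_mat_def)
    have "upper_triangular h" using h(2) hc by (intro upper_triangularI) (auto simp: diagonal_mat_def)
    then have "\<forall>i<n. h $$ (i, i) \<noteq> 0" using upper_triangular_GL_diag[OF h(1)] by blast
    from weight_vec_act[OF x(1) this]
    show "\<pi> h *\<^sub>v x = (\<Prod>i<n. (h $$ (i, i)) powi (\<omega> $ i)) \<cdot>\<^sub>v x"
      unfolding hd[symmetric] wchar_def .
  qed (rule x(2))
  then show ?thesis
    unfolding highest_weights_def mem_Collect_eq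
    using extremal_orbit_span_irreducible[OF \<omega> x] orbit_span_self[OF weight_vec_carrier[OF x(1)]]
    by (intro exI[of _ "orbit_span x"] conjI bexI[of _ x])
qed

lemma highest_weights_subset: "highest_weights n d \<pi> \<subseteq> weights"
  unfolding highest_weights_def
  using highest_weight_vector_weight_vec weight_vec_in_weights by blast

text \<open>A weight of maximal length can be permuted into a dominant one of the same length, which is the highest weight
  of an irreducible subrepresentation.\<close>

lemma weight_norm_bound:
  assumes "\<omega> \<in> weights"
  shows "l2_norm (map_vec real_of_int \<omega>) \<le> weight_norm n d \<pi>"
proof -
  have l2: "l2_norm (map_vec real_of_int \<alpha>) = sqrt (real_of_int (weight_sqnorm n \<alpha>))" if "\<alpha> \<in> carrier_vec n" for \<alpha>
    using that by (simp add: l2_norm_def weight_sqnorm_def)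
  obtain \<alpha> where \<alpha>: "extremal \<alpha>" using extremal_exists assms by blast
  have \<alpha>w: "\<alpha> \<in> weights" using \<alpha> by (simp add: extremal_def)
  have "l2_norm (map_vec real_of_int \<omega>) \<le> l2_norm (map_vec real_of_int \<alpha>)"
    using \<alpha> \<alpha>w assms weights_carrier by (auto simp: l2 extremal_def subset_iff)
  also have "\<dots> \<le> weight_norm n d \<pi>"
    unfolding weight_norm_def
    using finite_subset[OF highest_weights_subset weights_finite] extremal_highest_weight[OF \<alpha>] by (intro Max_ge) auto
  finally show ?thesis .
qed

end

section \<open>The moment map\<close>

lemma Cauchy_Schwarz_sum:
  fixes f g :: "'a \<Rightarrow> real"
  shows "\<bar>\<Sum>i\<in>A. f i * g i\<bar> \<le> sqrt (\<Sum>i\<in>A. (f i)\<^sup>2) * sqrt (\<Sum>i\<in>A. (g i)\<^sup>2)"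
proof -
  define a b s where "a = (\<Sum>i\<in>A. (f i)\<^sup>2)" and "b = (\<Sum>i\<in>A. (g i)\<^sup>2)" and "s = (\<Sum>i\<in>A. f i * g i)"
  have ab: "a \<ge> 0" "b \<ge> 0" unfolding a_def b_def by (simp_all add: sum_nonneg)
  have quad: "0 \<le> a - 2 * r * s + r\<^sup>2 * b" for r
  proof -
    have "0 \<le> (\<Sum>i\<in>A. (f i - r * g i)\<^sup>2)" by (simp add: sum_nonneg)
    also have "\<dots> = a - 2 * r * s + r\<^sup>2 * b"
      by (simp add: a_def b_def s_def power2_diff power_mult_distrib sum.distrib sum_subtractf
          sum_distrib_left algebra_simps)
    finally show ?thesis .
  qed
  have "s\<^sup>2 \<le> a * b"
  proof (cases "b = 0")
    case True
    have "s = 0"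
    proof (rule ccontr)
      assume "s \<noteq> 0"
      then show False using quad[of "(a + 1) / (2 * s)"] True by simp
    qed
    then show ?thesis using True by simp
  next
    case False
    then have "0 \<le> a - 2 * (s / b) * s + (s / b)\<^sup>2 * b" by (intro quad)
    also have "\<dots> = (a * b - s\<^sup>2) / b" using False by (simp add: field_simps power2_eq_square)
    finally show ?thesis using False ab by (simp add: zero_le_divide_iff)
  qed
  then have "\<bar>s\<bar> \<le> sqrt (a * b)" by (metis real_sqrt_abs real_sqrt_le_iff)
  then show ?thesis unfolding a_def b_def s_def real_sqrt_mult .
qed

definition wpair :: "nat \<Rightarrow> int vec \<Rightarrow> (nat \<Rightarrow> real) \<Rightarrow> real" where
  "wpair n \<omega> D = (\<Sum>i<n. real_of_int (\<omega> $ i) * D i)"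

lemma wchar_exp: "wchar n \<omega> (\<lambda>i. exp (z * complex_of_real (D i))) = exp (z * complex_of_real (wpair n \<omega> D))"
  unfolding wchar_def wpair_def exp_power_int of_real_sum sum_distrib_left
  by (subst exp_sum) (auto intro!: prod.cong simp: algebra_simps)

lemma abs_wpair_le:
  assumes "\<omega> \<in> carrier_vec n"
  shows "\<bar>wpair n \<omega> D\<bar> \<le> l2_norm (map_vec real_of_int \<omega>) * sqrt (\<Sum>i<n. (D i)\<^sup>2)"
  using Cauchy_Schwarz_sum[of "\<lambda>i. real_of_int (\<omega> $ i)" D "{..<n}"] assms
  by (simp add: wpair_def l2_norm_def)

lemma frobenius_zero:
  assumes "A \<in> carrier_mat n m" "frobenius_norm A = 0"
  shows "A = 0\<^sub>m n m"
proof (rule eq_matI)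
  fix i j assume "i < dim_row (0\<^sub>m n m :: complex mat)" "j < dim_col (0\<^sub>m n m :: complex mat)"
  then have ij: "i < n" "j < m" by auto
  have "(\<Sum>i<n. \<Sum>j<m. (cmod (A $$ (i, j)))\<^sup>2) = 0"
    using assms by (simp add: frobenius_norm_def)
  then have "(\<Sum>j<m. (cmod (A $$ (i, j)))\<^sup>2) = 0"
    using ij by (subst (asm) sum_nonneg_eq_0_iff) (auto simp: sum_nonneg)
  then have "(cmod (A $$ (i, j)))\<^sup>2 = 0" using ij by (subst (asm) sum_nonneg_eq_0_iff) auto
  then show "A $$ (i, j) = 0\<^sub>m n m $$ (i, j)" using ij by simp
qed (use assms in auto)

lemma tr_minus:
  assumes "A \<in> carrier_mat n n" "B \<in> carrier_mat n n"
  shows "tr (A - B) = tr A - tr B"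
  using assms by (simp add: tr_def sum_subtractf)

lemma Herm_minus:
  assumes "A \<in> Herm n" "B \<in> Herm n"
  shows "A - B \<in> Herm n"
proof -
  note c = Herm_carrier[OF assms(1)] Herm_carrier[OF assms(2)]
  have "mat_adjoint (A - B) = A - B"
  proof (rule eq_matI)
    fix i j assume "i < dim_row (A - B)" "j < dim_col (A - B)"
    then have ij: "i < n" "j < n" using c by auto
    have "cnj (A $$ (j, i)) = A $$ (i, j)" "cnj (B $$ (j, i)) = B $$ (i, j)"
      using ij c Herm_adjoint[OF assms(1)] Herm_adjoint[OF assms(2)]
        mat_adjoint_index[of i A j] mat_adjoint_index[of i B j] by auto
    then show "mat_adjoint (A - B) $$ (i, j) = (A - B) $$ (i, j)" using ij c by simp
  qed (use c in auto)
  then show ?thesis using minus_carrier_mat[OF c(2)] by (simp add: Herm_def)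
qed

lemma Herm_eqI:
  assumes "M \<in> Herm n" "M' \<in> Herm n" "\<And>H. H \<in> Herm n \<Longrightarrow> tr (M * H) = tr (M' * H)"
  shows "M = M'"
proof -
  note c = Herm_carrier[OF assms(1)] Herm_carrier[OF assms(2)]
  have K: "M - M' \<in> Herm n" using Herm_minus assms by blast
  have "tr ((M - M') * (M - M')) = tr (M * (M - M')) - tr (M' * (M - M'))"
    using minus_mult_distrib_mat[OF c Herm_carrier[OF K]] tr_minus[of "M * (M - M')" n "M' * (M - M')"] c
      Herm_carrier[OF K] by simp
  also have "\<dots> = 0" using assms(3)[OF K] by simp
  finally have "frobenius_norm (M - M') = 0" unfolding Herm_frobenius[OF K] by simp
  then have Z: "M - M' = 0\<^sub>m n n" using frobenius_zero Herm_carrier[OF K] by blast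
  show ?thesis
  proof (rule eq_matI)
    fix i j assume "i < dim_row M'" "j < dim_col M'"
    then show "M $$ (i, j) = M' $$ (i, j)"
      using arg_cong[OF Z, of "\<lambda>A. A $$ (i, j)"] c by simp
  qed (use c in auto)
qed

context unitary_rep
begin

text \<open>The squared norms of the weight components of \<open>x\<close> for the maximal torus conjugated by \<open>u\<close>.\<close>

definition wcoef :: "complex mat \<Rightarrow> complex vec \<Rightarrow> int vec \<Rightarrow> real" where
  "wcoef u x \<omega> = Re (ip (wproj \<omega> *\<^sub>v (\<pi> (mat_adjoint u) *\<^sub>v x)) (wproj \<omega> *\<^sub>v (\<pi> (mat_adjoint u) *\<^sub>v x)))"

lemma ip_udiag_exp:
  assumes u: "u \<in> unitary_group n" and x: "x \<in> carrier_vec d"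
  shows "ip x (\<pi> (udiag n u (\<lambda>i. exp (z * complex_of_real (D i)))) *\<^sub>v x)
    = (\<Sum>\<omega>\<in>weights. complex_of_real (wcoef u x \<omega>) * exp (z * complex_of_real (wpair n \<omega> D)))"
proof -
  have "\<pi> (mat_adjoint u) *\<^sub>v x \<in> carrier_vec d" using unitary_GL[OF unitary_adjoint[OF u]] x by simp
  then have "ip (wproj \<omega> *\<^sub>v (\<pi> (mat_adjoint u) *\<^sub>v x)) (wproj \<omega> *\<^sub>v (\<pi> (mat_adjoint u) *\<^sub>v x)) = complex_of_real (wcoef u x \<omega>)"
    if "\<omega> \<in> weights" for \<omega>
    unfolding wcoef_def using that by (intro ip_self_real) simp
  then show ?thesis
    unfolding ip_udiag[OF u, of "\<lambda>i. exp (z * complex_of_real (D i))", simplified, OF x x]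
    by (intro sum.cong refl) (simp add: wchar_exp mult.commute)
qed

lemma exp_sum_wcoef:
  assumes u: "u \<in> unitary_group n" and x: "x \<in> carrier_vec d" "x \<noteq> 0\<^sub>v d"
  shows "exp_sum weights (wcoef u x)"
proof
  have ux: "\<pi> (mat_adjoint u) *\<^sub>v x \<in> carrier_vec d" using unitary_GL[OF unitary_adjoint[OF u]] x by simp
  show "wcoef u x \<omega> \<ge> 0" if "\<omega> \<in> weights" for \<omega>
    unfolding wcoef_def using that ux by (intro ip_self_nonneg) simp
  have "complex_of_real (\<Sum>\<omega>\<in>weights. wcoef u x \<omega>) = ip x (\<pi> (1\<^sub>m n) *\<^sub>v x)"
    using ip_udiag_exp[OF u x(1), of 0] by (simp add: udiag_one[OF u])
  then have "complex_of_real (\<Sum>\<omega>\<in>weights. wcoef u x \<omega>) = ip x x" by (simp add: act_one[OF x(1)])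
  then have "(\<Sum>\<omega>\<in>weights. wcoef u x \<omega>) = Re (ip x x)" by (metis Re_complex_of_real)
  then show "(\<Sum>\<omega>\<in>weights. wcoef u x \<omega>) > 0" using ip_pos[OF x] by simp
qed (rule weights_finite)

text \<open>Along a one-parameter group generated by a Hermitian matrix the squared norm is a positive
  combination of real exponentials whose exponents are the pairings of the weights with the eigenvalues.\<close>

lemma ln_norm_exp:
  assumes u: "u \<in> unitary_group n" and x: "x \<in> carrier_vec d" "x \<noteq> 0\<^sub>v d"
  shows "ln (ip_norm ip (\<pi> (mat_exp (complex_of_real t \<cdot>\<^sub>m hdiag n u D)) *\<^sub>v x))
    = half_log_sum_exp weights (wcoef u x) (\<lambda>\<omega>. wpair n \<omega> D) t"
proof -
  define g where "g = udiag n u (\<lambda>i. exp (complex_of_real t * complex_of_real (D i)))"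
  have g: "g \<in> GL n" unfolding g_def using u by (intro udiag_GL) auto
  have adj: "mat_adjoint g = g" 
    unfolding g_def udiag_adjoint[OF u]
    by (intro udiag_cong) (metis complex_cnj_complex_of_real exp_of_real of_real_mult)
  have "g * g = udiag n u (\<lambda>i. exp (complex_of_real (2 * t) * complex_of_real (D i)))"
    unfolding g_def udiag_mult[OF u] by (intro udiag_cong) (simp add: exp_add[symmetric] algebra_simps)
  then have "ip x (\<pi> (g * g) *\<^sub>v x) = (\<Sum>\<omega>\<in>weights. complex_of_real (wcoef u x \<omega> * exp (2 * t * wpair n \<omega> D)))"
    using ip_udiag_exp[OF u x(1), of "complex_of_real (2 * t)"] by (simp add: exp_of_real[symmetric])
  moreover have "ip x (\<pi> (g * g) *\<^sub>v x) = ip (\<pi> g *\<^sub>v x) (\<pi> g *\<^sub>v x)"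
    using ip_adjoint[OF g x(1), of "\<pi> g *\<^sub>v x"] g x adj by (simp add: act_mult)
  ultimately have "Re (ip (\<pi> g *\<^sub>v x) (\<pi> g *\<^sub>v x)) = (\<Sum>\<omega>\<in>weights. wcoef u x \<omega> * exp (2 * t * wpair n \<omega> D))"
    by simp
  moreover have "Re (ip (\<pi> g *\<^sub>v x) (\<pi> g *\<^sub>v x)) > 0" using g x act_nonzero by (intro ip_pos) auto
  ultimately show ?thesis
    unfolding half_log_sum_exp_def ip_norm_def mat_exp_smult_udiag[OF u] g_def[symmetric]
    by (simp add: ln_sqrt)
qed

definition has_moment :: "complex vec \<Rightarrow> complex mat \<Rightarrow> bool" where
  "has_moment x M \<longleftrightarrow> M \<in> Herm n \<and>
     (\<forall>H\<in>Herm n. \<exists>D.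
        ((\<lambda>t. ln (ip_norm ip (\<pi> (mat_exp (complex_of_real t \<cdot>\<^sub>m H)) *\<^sub>v x)))
           has_real_derivative D) (at 0) \<and>
        tr (M * H) = complex_of_real D)"

lemma has_moment_unique:
  assumes "has_moment x M" "has_moment x M'"
  shows "M = M'"
proof (rule Herm_eqI)
  fix H assume H: "H \<in> Herm n"
  let ?f = "\<lambda>t. ln (ip_norm ip (\<pi> (mat_exp (complex_of_real t \<cdot>\<^sub>m H)) *\<^sub>v x))"
  obtain D where "(?f has_real_derivative D) (at 0)" "tr (M * H) = complex_of_real D"
    using assms(1) H unfolding has_moment_def by blast
  moreover obtain D' where "(?f has_real_derivative D') (at 0)" "tr (M' * H) = complex_of_real D'"
    using assms(2) H unfolding has_moment_def by blast
  ultimately show "tr (M * H) = tr (M' * H)" using DERIV_unique by metis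
qed (use assms in \<open>auto simp: has_moment_def\<close>)

text \<open>The derivative of the logarithmic norm is linear in the direction because the matrix
  coefficient \<open>g \<mapsto> \<langle>x, \<pi>(g) x\<rangle>\<close> is a rational function of the entries of \<open>g\<close>.\<close>

lemma has_moment_exists:
  assumes x: "x \<in> carrier_vec d" "x \<noteq> 0\<^sub>v d"
  shows "\<exists>M. has_moment x M"
proof -
  define f where "f g = ip x (\<pi> g *\<^sub>v x) / ip x x" for g
  have xx: "ip x x \<noteq> 0" using ip_self_zero x by blast
  have "lin_diff n f"
  proof (rule lin_diff_cong)
    show "lin_diff n (\<lambda>g. \<Sum>a<d. (\<Sum>b<d. \<pi> g $$ (a, b) * x $ b) * (ip x (unit_vec d a) / ip x x))"
      by (intro lin_diff_sum lin_diff_mult lin_diff_const lin_diff_rational pi_rational) auto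
    fix g assume g: "g \<in> GL n"
    have "ip x (\<pi> g *\<^sub>v x) = (\<Sum>a<d. (\<pi> g *\<^sub>v x) $ a * ip x (unit_vec d a))"
    proof (rule ip_sum_right)
      fix b assume b: "b < d"
      have "(\<Sum>a<d. (\<pi> g *\<^sub>v x) $ a * unit_vec d a $ b) = (\<Sum>a<d. if a = b then (\<pi> g *\<^sub>v x) $ a else 0)"
        using b by (intro sum.cong) auto
      then show "(\<pi> g *\<^sub>v x) $ b = (\<Sum>a<d. (\<pi> g *\<^sub>v x) $ a * unit_vec d a $ b)" using b by simp
    qed (use g x in auto)
    then show "f g = (\<Sum>a<d. (\<Sum>b<d. \<pi> g $$ (a, b) * x $ b) * (ip x (unit_vec d a) / ip x x))"
      unfolding f_def using index_mult_vec_sum[OF pi_carrier[OF g] x(1)] by (simp add: sum_divide_distrib)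
  qed
  then obtain L where L: "curve_deriv n f L" unfolding lin_diff_def by blast
  define M where "M = mat n n (\<lambda>(j, i). (L i j + cnj (L j i)) / 2)"
  have Mc: "M \<in> carrier_mat n n" by (simp add: M_def)
  have "has_moment x M"
    unfolding has_moment_def
  proof (intro conjI ballI)
    show "M \<in> Herm n"
      unfolding Herm_def by (auto intro!: eq_matI simp: M_def)
    fix H assume H: "H \<in> Herm n"
    then obtain u D where u: "u \<in> unitary_group n" and HD: "H = hdiag n u D"
      by (rule Herm_obtain_udiag)
    let ?c = "wcoef u x" and ?b = "\<lambda>\<omega>. wpair n \<omega> D"
    interpret es: exp_sum weights ?c ?b using exp_sum_wcoef[OF u x] .
    define \<gamma> where "\<gamma> z = udiag n u (\<lambda>i. exp (z * complex_of_real (D i)))" for z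
    have "((\<lambda>s. f (\<gamma> s)) has_field_derivative (\<Sum>i<n. \<Sum>j<n. L i j * H $$ (i, j))) (at 0)"
    proof (rule curve_derivD[OF L])
      show "\<gamma> s \<in> GL n" for s unfolding \<gamma>_def using u by (intro udiag_GL) auto
      show "\<gamma> 0 = 1\<^sub>m n" unfolding \<gamma>_def using udiag_one[OF u] by simp
      fix i j assume ij: "i < n" "j < n"
      show "((\<lambda>s. \<gamma> s $$ (i, j)) has_field_derivative H $$ (i, j)) (at 0)"
        unfolding \<gamma>_def HD udiag_index[OF unitary_carrier[OF u] ij]
        by (intro DERIV_sum) (auto intro!: derivative_eq_intros)
    qed
    moreover have Z: "ip x x = complex_of_real (exp_moment weights ?c ?b 0 0)"
      using ip_udiag_exp[OF u x(1), of 0] by (simp add: udiag_one[OF u] act_one[OF x(1)] exp_moment_def)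
    have "((\<lambda>s. f (\<gamma> s)) has_field_derivative complex_of_real (gibbs_mean weights ?c ?b 0)) (at 0)"
    proof -
      have "((\<lambda>s. \<Sum>\<omega>\<in>weights. complex_of_real (?c \<omega>) * exp (s * complex_of_real (?b \<omega>)))
          has_field_derivative (\<Sum>\<omega>\<in>weights. complex_of_real (?c \<omega> * ?b \<omega>))) (at 0)"
        by (intro DERIV_sum) (auto intro!: derivative_eq_intros)
      then have "((\<lambda>s. (\<Sum>\<omega>\<in>weights. complex_of_real (?c \<omega>) * exp (s * complex_of_real (?b \<omega>))) / ip x x)
          has_field_derivative (\<Sum>\<omega>\<in>weights. complex_of_real (?c \<omega> * ?b \<omega>)) / ip x x) (at 0)"
        by (rule DERIV_cdivide)
      moreover have "(\<Sum>\<omega>\<in>weights. complex_of_real (?c \<omega> * ?b \<omega>)) / ip x x = complex_of_real (gibbs_mean weights ?c ?b 0)"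
        unfolding Z gibbs_mean_def by (simp add: exp_moment_def)
      ultimately show ?thesis unfolding f_def \<gamma>_def ip_udiag_exp[OF u x(1)] by simp
    qed
    ultimately have LH: "(\<Sum>i<n. \<Sum>j<n. L i j * H $$ (i, j)) = complex_of_real (gibbs_mean weights ?c ?b 0)"
      by (rule DERIV_unique)
    have herm: "H $$ (i, j) = cnj (H $$ (j, i))" if "i < n" "j < n" for i j
      using that Herm_adjoint[OF H] mat_adjoint_index[of i H j] Herm_carrier[OF H] by simp
    have "tr (M * H) = (\<Sum>j<n. \<Sum>i<n. L i j * H $$ (i, j) / 2 + cnj (L j i * H $$ (j, i)) / 2)"
      unfolding tr_mult_sum[OF Mc Herm_carrier[OF H]]
    proof (intro sum.cong refl)
      fix j i assume "j \<in> {..<n}" "i \<in> {..<n}"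
      then show "M $$ (j, i) * H $$ (i, j) = L i j * H $$ (i, j) / 2 + cnj (L j i * H $$ (j, i)) / 2"
        using herm[of i j] by (simp add: M_def field_simps)
    qed
    also have "\<dots> = (\<Sum>i<n. \<Sum>j<n. L i j * H $$ (i, j)) / 2 + cnj (\<Sum>i<n. \<Sum>j<n. L i j * H $$ (i, j)) / 2"
      unfolding sum.distrib sum_divide_distrib cnj_sum by (subst sum.swap) simp
    also have "\<dots> = complex_of_real (gibbs_mean weights ?c ?b 0)" unfolding LH by simp
    finally have "tr (M * H) = complex_of_real (gibbs_mean weights ?c ?b 0)" .
    moreover have "((\<lambda>t. ln (ip_norm ip (\<pi> (mat_exp (complex_of_real t \<cdot>\<^sub>m H)) *\<^sub>v x)))
           has_real_derivative gibbs_mean weights ?c ?b 0) (at 0)"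
      unfolding HD ln_norm_exp[OF u x] by (rule es.half_log_sum_exp_deriv)
    ultimately show "\<exists>D. ((\<lambda>t. ln (ip_norm ip (\<pi> (mat_exp (complex_of_real t \<cdot>\<^sub>m H)) *\<^sub>v x)))
           has_real_derivative D) (at 0) \<and> tr (M * H) = complex_of_real D" by blast
  qed
  then show ?thesis ..
qed

lemma moment_map_has_moment:
  assumes "x \<in> carrier_vec d" "x \<noteq> 0\<^sub>v d"
  shows "has_moment x (moment_map n \<pi> ip x)"
proof -
  have "\<exists>!M. has_moment x M" using has_moment_exists[OF assms] has_moment_unique by blast
  from theI'[OF this] show ?thesis unfolding moment_map_def has_moment_def .
qed

lemma moment_map_Herm: "x \<in> carrier_vec d \<Longrightarrow> x \<noteq> 0\<^sub>v d \<Longrightarrow> moment_map n \<pi> ip x \<in> Herm n"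
  using moment_map_has_moment unfolding has_moment_def by blast

lemma tr_moment_map:
  assumes x: "x \<in> carrier_vec d" "x \<noteq> 0\<^sub>v d" and u: "u \<in> unitary_group n"
  shows "tr (moment_map n \<pi> ip x * hdiag n u D)
    = complex_of_real (gibbs_mean weights (wcoef u x) (\<lambda>\<omega>. wpair n \<omega> D) 0)"
proof -
  interpret es: exp_sum weights "wcoef u x" "\<lambda>\<omega>. wpair n \<omega> D" using exp_sum_wcoef[OF u x] .
  obtain D' where "((\<lambda>t. ln (ip_norm ip (\<pi> (mat_exp (complex_of_real t \<cdot>\<^sub>m hdiag n u D)) *\<^sub>v x)))
           has_real_derivative D') (at 0)"
    "tr (moment_map n \<pi> ip x * hdiag n u D) = complex_of_real D'"
    using moment_map_has_moment[OF x] udiag_real_Herm[OF u] unfolding has_moment_def by blast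
  then show ?thesis unfolding ln_norm_exp[OF u x] using DERIV_unique es.half_log_sum_exp_deriv by metis
qed

lemma abs_wpair_weight_le:
  assumes "\<omega> \<in> weights" and u: "u \<in> unitary_group n"
  shows "\<bar>wpair n \<omega> D\<bar> \<le> weight_norm n d \<pi> * frobenius_norm (hdiag n u D)"
proof -
  have "sqrt (\<Sum>i<n. (D i)\<^sup>2) = frobenius_norm (hdiag n u D)"
    unfolding frobenius_udiag[OF u, symmetric] by simp
  then have "\<bar>wpair n \<omega> D\<bar> \<le> l2_norm (map_vec real_of_int \<omega>) * frobenius_norm (hdiag n u D)"
    using abs_wpair_le[of \<omega> n D] assms(1) weights_carrier by auto
  also have "\<dots> \<le> weight_norm n d \<pi> * frobenius_norm (hdiag n u D)"
    by (rule mult_right_mono[OF weight_norm_bound[OF assms(1)] frobenius_nonneg])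
  finally show ?thesis .
qed

lemma abs_tr_moment_map_le:
  assumes x: "x \<in> carrier_vec d" "x \<noteq> 0\<^sub>v d" and H: "H \<in> Herm n"
  shows "cmod (tr (moment_map n \<pi> ip x * H)) \<le> weight_norm n d \<pi> * frobenius_norm H"
proof -
  obtain u D where u: "u \<in> unitary_group n" and HD: "H = hdiag n u D"
    using H by (rule Herm_obtain_udiag)
  interpret es: exp_sum weights "wcoef u x" "\<lambda>\<omega>. wpair n \<omega> D" using exp_sum_wcoef[OF u x] .
  show ?thesis
    unfolding HD tr_moment_map[OF x u] norm_of_real
    by (rule es.abs_gibbs_mean_le) (rule abs_wpair_weight_le[OF _ u])
qed

lemma ln_norm_quadratic_bound:
  assumes x: "x \<in> carrier_vec d" "x \<noteq> 0\<^sub>v d" and H: "H \<in> Herm n"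
  shows "ln (ip_norm ip (\<pi> (mat_exp (complex_of_real s \<cdot>\<^sub>m H)) *\<^sub>v x))
    \<le> ln (ip_norm ip x) + s * Re (tr (moment_map n \<pi> ip x * H)) + (weight_norm n d \<pi> * frobenius_norm H)\<^sup>2 * s\<^sup>2"
proof -
  obtain u D where u: "u \<in> unitary_group n" and HD: "H = hdiag n u D"
    using H by (rule Herm_obtain_udiag)
  let ?F = "half_log_sum_exp weights (wcoef u x) (\<lambda>\<omega>. wpair n \<omega> D)"
  interpret es: exp_sum weights "wcoef u x" "\<lambda>\<omega>. wpair n \<omega> D" using exp_sum_wcoef[OF u x] .
  have "?F s \<le> ?F 0 + s * gibbs_mean weights (wcoef u x) (\<lambda>\<omega>. wpair n \<omega> D) 0
      + (weight_norm n d \<pi> * frobenius_norm H)\<^sup>2 * s\<^sup>2"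
  proof (rule quadratic_upper_bound[OF es.half_log_sum_exp_deriv es.gibbs_mean_deriv])
    show "2 * gibbs_variance weights (wcoef u x) (\<lambda>\<omega>. wpair n \<omega> D) t \<le> 2 * (weight_norm n d \<pi> * frobenius_norm H)\<^sup>2" for t
      using es.gibbs_variance_le[OF abs_wpair_weight_le[OF _ u]] by (simp add: HD)
  qed
  moreover have "?F 0 = ln (ip_norm ip x)"
    using ln_norm_exp[OF u x, of 0 D] mat_exp_smult_udiag[OF u, of 0] udiag_one[OF u] act_one[OF x(1)] by simp
  ultimately show ?thesis unfolding HD tr_moment_map[OF x u] ln_norm_exp[OF u x] by simp
qed

end

section \<open>Orbits of highest weight vectors\<close>

lemma udiag_conj:
  assumes q: "q \<in> unitary_group n" and u: "u \<in> unitary_group n"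
  shows "mat_adjoint q * udiag n u f * q = udiag n (mat_adjoint q * u) f"
  unfolding udiag_def mat_adjoint_mult[OF mat_adjoint_carrier[OF unitary_carrier[OF q]] unitary_carrier[OF u]]
  using unitary_carrier[OF q] unitary_carrier[OF u] by (simp add: assoc_mult_mat[of _ n n _ n _ n])

lemma unitary_row_norm:
  assumes u: "u \<in> unitary_group n" and i: "i < n"
  shows "(\<Sum>k<n. (cmod (u $$ (i, k)))\<^sup>2) = 1"
proof -
  have "complex_of_real (\<Sum>k<n. (cmod (u $$ (i, k)))\<^sup>2) = udiag n u (\<lambda>_. 1) $$ (i, i)"
    unfolding udiag_index[OF unitary_carrier[OF u] i i] of_real_sum complex_norm_square by simp
  also have "\<dots> = 1" unfolding udiag_one[OF u] using i by simp
  finally show ?thesis using of_real_eq_1_iff by blast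
qed

lemma unitary_column_norm:
  assumes u: "u \<in> unitary_group n" and k: "k < n"
  shows "(\<Sum>i<n. (cmod (u $$ (i, k)))\<^sup>2) = 1"
  using unitary_row_norm[OF unitary_adjoint[OF u] k] unitary_carrier[OF u] k by simp

lemma udiag_diag_entry:
  assumes u: "u \<in> unitary_group n" and i: "i < n"
  shows "hdiag n u D $$ (i, i) = complex_of_real (\<Sum>k<n. (cmod (u $$ (i, k)))\<^sup>2 * D k)"
  unfolding udiag_index[OF unitary_carrier[OF u] i i] of_real_sum of_real_mult complex_norm_square
  by (intro sum.cong) (auto simp: algebra_simps)

lemma ln_powi: "x > 0 \<Longrightarrow> ln (x powi k) = real_of_int k * ln (x :: real)"
  using ln_powr[of x "real_of_int k"] powr_real_of_int'[of x k] by simp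

context unitary_rep
begin

lemma highest_weight_vector_upper_act:
  assumes "highest_weight_vector n d \<pi> \<omega> w" "R \<in> GL n" "upper_triangular R"
  shows "\<pi> R *\<^sub>v w = wchar n \<omega> (\<lambda>i. R $$ (i, i)) \<cdot>\<^sub>v w"
  using highest_weight_vector_weight_vec(1)[OF assms(1)]
  by (rule upper_triangular_act[OF _ _ assms(2,3)]) (use assms(1) in \<open>auto simp: highest_weight_vector_def\<close>)

lemma ln_norm_QR:
  assumes w: "highest_weight_vector n d \<pi> \<omega> w" and Q: "Q \<in> unitary_group n" and R: "R \<in> GL n" "upper_triangular R"
  shows "ln (ip_norm ip (\<pi> (Q * R) *\<^sub>v w)) = ln (ip_norm ip w) + (\<Sum>i<n. real_of_int (\<omega> $ i) * ln (cmod (R $$ (i, i))))"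
proof -
  note wc = weight_vec_carrier[OF highest_weight_vector_weight_vec(1)[OF w]]
    and w0 = highest_weight_vector_weight_vec(2)[OF w]
  note nz = upper_triangular_GL_diag[OF R]
  let ?\<chi> = "wchar n \<omega> (\<lambda>i. R $$ (i, i))"
  have "ip_norm ip (\<pi> (Q * R) *\<^sub>v w) = ip_norm ip (\<pi> R *\<^sub>v w)"
    unfolding ip_norm_def using act_mult[OF unitary_GL[OF Q] R(1) wc] ip_unitary[OF Q] R(1) wc by simp
  also have "\<dots> = cmod ?\<chi> * ip_norm ip w"
    unfolding highest_weight_vector_upper_act[OF w R] using wc by (rule ip_norm_smult)
  finally have "ln (ip_norm ip (\<pi> (Q * R) *\<^sub>v w)) = ln (cmod ?\<chi>) + ln (ip_norm ip w)"
    using wchar_nonzero[of n "\<lambda>i. R $$ (i, i)" \<omega>] nz ip_norm_pos[OF wc w0] by (simp add: ln_mult)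
  moreover have "ln (cmod ?\<chi>) = (\<Sum>i<n. real_of_int (\<omega> $ i) * ln (cmod (R $$ (i, i))))"
  proof -
    have "cmod ?\<chi> = (\<Prod>i<n. cmod (R $$ (i, i)) powi (\<omega> $ i))"
      unfolding wchar_def by (simp add: prod_norm[symmetric] norm_power_int)
    also have "ln \<dots> = (\<Sum>i<n. ln (cmod (R $$ (i, i)) powi (\<omega> $ i)))"
      using nz by (intro ln_prod) auto
    also have "\<dots> = (\<Sum>i<n. real_of_int (\<omega> $ i) * ln (cmod (R $$ (i, i))))"
      using nz by (intro sum.cong refl ln_powi) auto
    finally show ?thesis .
  qed
  ultimately show ?thesis by simp
qed

text \<open>The logarithmic norm of a translated highest weight vector is a combination of the logarithms of
  the diagonal entries of the triangular factor.  A diagonal entry is at most the norm of its column, and the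
  product of all of them is the determinant; for a dominant weight this yields an upper bound
  that only involves column norms.\<close>

lemma coherent_upper_bound:
  assumes w: "highest_weight_vector n d \<pi> \<omega> w" and n: "n \<ge> 1"
    and dom: "\<And>i j. i \<le> j \<Longrightarrow> j < n \<Longrightarrow> \<omega> $ j \<le> \<omega> $ i"
    and u: "u \<in> unitary_group n" and Q: "Q \<in> unitary_group n" and R: "R \<in> GL n" "upper_triangular R"
  defines "v \<equiv> mat_adjoint Q * u"
  shows "ln (ip_norm ip (\<pi> (hdiag n u (\<lambda>i. exp (t * D i))) *\<^sub>v (\<pi> (Q * R) *\<^sub>v w)))
    \<le> ln (ip_norm ip (\<pi> (Q * R) *\<^sub>v w))
      + (\<Sum>i<n. real_of_int (\<omega> $ i - \<omega> $ (n - 1)) * half_log_sum_exp {..<n} (\<lambda>k. (cmod (v $$ (i, k)))\<^sup>2) D t)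
      + real_of_int (\<omega> $ (n - 1)) * (t * (\<Sum>k<n. D k))"
proof -
  note wc = weight_vec_carrier[OF highest_weight_vector_weight_vec(1)[OF w]]
  have v: "v \<in> unitary_group n" unfolding v_def using unitary_mult unitary_adjoint Q u by blast
  note Qc = unitary_carrier[OF Q] and Rc = GL_carrier[OF R(1)]
  define E where "E = hdiag n u (\<lambda>i. exp (t * D i))"
  define E' where "E' = hdiag n v (\<lambda>i. exp (t * D i))"
  have E: "E \<in> GL n" "E' \<in> GL n" unfolding E_def E'_def using u v by (auto intro: udiag_GL)
  note Ec = GL_carrier[OF E(1)] GL_carrier[OF E(2)]
  have EE: "E' = mat_adjoint Q * (E * Q)"
    unfolding E_def E'_def v_def udiag_conj[OF Q u, symmetric] using Qc u by (simp add: assoc_mult_mat[of _ n n _ n _ n])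
  obtain Q2 R2 where Q2: "Q2 \<in> unitary_group n" and R2: "R2 \<in> carrier_mat n n" "upper_triangular R2" and QR2: "E' = Q2 * R2"
    using QR_exists[OF Ec(2)] by blast
  note Q2c = unitary_carrier[OF Q2]
  have "R2 = mat_adjoint Q2 * E'" using QR2 unitary_cancel(1)[OF Q2 R2(1)] by simp
  then have R2G: "R2 \<in> GL n" using GL_mult[OF unitary_GL[OF unitary_adjoint[OF Q2]] E(2)] by simp
  note nz = upper_triangular_GL_diag[OF R] and nz2 = upper_triangular_GL_diag[OF R2G R2(2)]
  have "E * (Q * R) = Q * (mat_adjoint Q * (E * Q)) * R"
    using unitary_cancel(2)[OF Q, of "E * Q" n] Ec Qc Rc by (simp add: assoc_mult_mat[of _ n n _ n _ n])
  also have "\<dots> = (Q * Q2) * (R2 * R)"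
    unfolding EE[symmetric] QR2 using Qc Q2c R2(1) Rc by (simp add: assoc_mult_mat[of _ n n _ n _ n])
  finally have EQR: "E * (Q * R) = (Q * Q2) * (R2 * R)" .
  have QRG: "Q * R \<in> GL n" using unitary_GL[OF Q] R(1) by (rule GL_mult)
  define a where "a i = ln (cmod (R2 $$ (i, i)))" for i
  have "ln (ip_norm ip (\<pi> E *\<^sub>v (\<pi> (Q * R) *\<^sub>v w))) = ln (ip_norm ip (\<pi> ((Q * Q2) * (R2 * R)) *\<^sub>v w))"
    using act_mult[OF E(1) QRG wc] EQR by simp
  also have "\<dots> = ln (ip_norm ip w) + (\<Sum>i<n. real_of_int (\<omega> $ i) * ln (cmod ((R2 * R) $$ (i, i))))"
    by (rule ln_norm_QR[OF w unitary_mult[OF Q Q2] GL_mult[OF R2G R(1)] upper_triangular_mult(1)[OF R2 Rc R(2)]])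
  also have "(\<Sum>i<n. real_of_int (\<omega> $ i) * ln (cmod ((R2 * R) $$ (i, i))))
      = (\<Sum>i<n. real_of_int (\<omega> $ i) * ln (cmod (R $$ (i, i)))) + (\<Sum>i<n. real_of_int (\<omega> $ i) * a i)"
    unfolding sum.distrib[symmetric] using upper_triangular_mult(2)[OF R2 Rc R(2)] nz nz2
    by (intro sum.cong) (auto simp: norm_mult ln_mult a_def algebra_simps)
  finally have eq: "ln (ip_norm ip (\<pi> E *\<^sub>v (\<pi> (Q * R) *\<^sub>v w)))
      = ln (ip_norm ip (\<pi> (Q * R) *\<^sub>v w)) + (\<Sum>i<n. real_of_int (\<omega> $ i) * a i)"
    unfolding ln_norm_QR[OF w Q R] by simp
  have gram: "mat_adjoint R2 * R2 = hdiag n v (\<lambda>i. exp (2 * t * D i))"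
  proof -
    have adjE: "mat_adjoint E' = E'" unfolding E'_def udiag_adjoint[OF v] by simp
    have "mat_adjoint R2 * R2 = mat_adjoint R2 * (mat_adjoint Q2 * (Q2 * R2))"
      using unitary_cancel(1)[OF Q2 R2(1)] by simp
    also have "\<dots> = mat_adjoint (Q2 * R2) * (Q2 * R2)"
      unfolding mat_adjoint_mult[OF Q2c R2(1)] using Q2c R2(1) by (simp add: assoc_mult_mat[of _ n n _ n _ n])
    also have "\<dots> = E' * E'" unfolding QR2[symmetric] adjE ..
    also have "\<dots> = hdiag n v (\<lambda>i. exp (2 * t * D i))"
      unfolding E'_def udiag_mult[OF v] of_real_mult[symmetric] exp_add[symmetric] by (simp add: algebra_simps)
    finally show ?thesis .
  qed
  have adjR2: "mat_adjoint R2 \<in> carrier_mat n n" using R2(1) by simp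
  have le: "a i \<le> half_log_sum_exp {..<n} (\<lambda>k. (cmod (v $$ (i, k)))\<^sup>2) D t" if i: "i < n" for i
  proof -
    have "complex_of_real (\<Sum>j<n. (cmod (R2 $$ (j, i)))\<^sup>2) = (mat_adjoint R2 * R2) $$ (i, i)"
      unfolding index_mult_sum[OF adjR2 R2(1) i i] of_real_sum complex_norm_square using R2(1) i
      by (intro sum.cong) (auto simp: mult.commute)
    also have "\<dots> = complex_of_real (\<Sum>k<n. (cmod (v $$ (i, k)))\<^sup>2 * exp (2 * t * D k))"
      unfolding gram by (rule udiag_diag_entry[OF v i])
    finally have col: "(\<Sum>j<n. (cmod (R2 $$ (j, i)))\<^sup>2) = (\<Sum>k<n. (cmod (v $$ (i, k)))\<^sup>2 * exp (2 * t * D k))"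
      unfolding of_real_eq_iff .
    have "(cmod (R2 $$ (i, i)))\<^sup>2 \<le> (\<Sum>k<n. (cmod (v $$ (i, k)))\<^sup>2 * exp (2 * t * D k))"
      unfolding col[symmetric] using i by (intro member_le_sum) auto
    then have "ln ((cmod (R2 $$ (i, i)))\<^sup>2) \<le> ln (\<Sum>k<n. (cmod (v $$ (i, k)))\<^sup>2 * exp (2 * t * D k))"
      using nz2[OF i] by (intro ln_mono) auto
    then show ?thesis using nz2[OF i] by (simp add: a_def half_log_sum_exp_def ln_realpow)
  qed
  have sum_a: "(\<Sum>i<n. a i) = t * (\<Sum>k<n. D k)"
  proof -
    have prod_diag: "prod_list (diag_mat A) = (\<Prod>i<n. A $$ (i, i))" if "A \<in> carrier_mat n n" for A :: "complex mat"
      using that by (simp add: diag_mat_def prod.distinct_set_conv_list[symmetric] atLeast0LessThan)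
    have "det (mat_adjoint R2) = (\<Prod>i<n. cnj (R2 $$ (i, i)))"
    proof -
      have "det (mat_adjoint R2) = prod_list (diag_mat (mat_adjoint R2))"
        using upper_triangularD0[OF R2(2,1)] R2(1) by (intro det_lower_triangular[OF _ adjR2]) auto
      then show ?thesis using R2(1) by (simp add: prod_diag[OF adjR2])
    qed
    moreover have "det R2 = (\<Prod>i<n. R2 $$ (i, i))" using det_upper_triangular[OF R2(2,1)] prod_diag[OF R2(1)] by simp
    ultimately have det1: "det (mat_adjoint R2 * R2) = complex_of_real (\<Prod>i<n. (cmod (R2 $$ (i, i)))\<^sup>2)"
      unfolding det_mult[OF adjR2 R2(1)] of_real_prod complex_norm_square by (simp add: prod.distrib mult.commute)
    have det2: "det (hdiag n v (\<lambda>i. exp (2 * t * D i))) = complex_of_real (\<Prod>i<n. exp (2 * t * D i))"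
    proof -
      note vc = unitary_carrier[OF v] mat_adjoint_carrier[OF unitary_carrier[OF v]]
      have "det v * det (mat_adjoint v) = 1"
        using det_mult[OF vc] unitary_mult_adj[OF v] by simp
      then show ?thesis
        unfolding udiag_def using vc by (simp add: det_mult[of _ n] det_mat_diag mult.commute mult.left_commute)
    qed
    have "(\<Prod>i<n. (cmod (R2 $$ (i, i)))\<^sup>2) = (\<Prod>i<n. exp (2 * t * D i))"
      using trans[OF sym[OF det1[unfolded gram]] det2] unfolding of_real_eq_iff .
    then have "ln (\<Prod>i<n. (cmod (R2 $$ (i, i)))\<^sup>2) = ln (\<Prod>i<n. exp (2 * t * D i))" by simp
    then have "(\<Sum>i<n. ln ((cmod (R2 $$ (i, i)))\<^sup>2)) = (\<Sum>i<n. 2 * t * D i)"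
      using nz2 by (subst (asm) (1 2) ln_prod) auto
    moreover have "(\<Sum>i<n. ln ((cmod (R2 $$ (i, i)))\<^sup>2)) = (\<Sum>i<n. 2 * a i)"
      using nz2 by (intro sum.cong) (auto simp: a_def ln_realpow)
    ultimately show ?thesis by (simp add: sum_distrib_left[symmetric] mult.assoc)
  qed
  have "(\<Sum>i<n. real_of_int (\<omega> $ i) * a i)
      = (\<Sum>i<n. real_of_int (\<omega> $ i - \<omega> $ (n - 1)) * a i) + real_of_int (\<omega> $ (n - 1)) * (\<Sum>i<n. a i)"
    unfolding sum_distrib_left sum.distrib[symmetric] by (intro sum.cong) (auto simp: algebra_simps)
  also have "(\<Sum>i<n. real_of_int (\<omega> $ i - \<omega> $ (n - 1)) * a i)
      \<le> (\<Sum>i<n. real_of_int (\<omega> $ i - \<omega> $ (n - 1)) * half_log_sum_exp {..<n} (\<lambda>k. (cmod (v $$ (i, k)))\<^sup>2) D t)"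
    using dom le n by (intro sum_mono mult_left_mono) auto
  finally show ?thesis unfolding E_def[symmetric] eq sum_a by simp
qed

text \<open>The upper bound touches the logarithmic norm at the base point, so it controls the first two
  derivatives there.  Translating the base point along the one-parameter group bounds the second derivative
  everywhere.\<close>

lemma coherent_derivatives:
  assumes w: "highest_weight_vector n d \<pi> \<omega> w" and n: "n \<ge> 1"
    and dom: "\<And>i j. i \<le> j \<Longrightarrow> j < n \<Longrightarrow> \<omega> $ j \<le> \<omega> $ i"
    and g: "g \<in> GL n" and u: "u \<in> unitary_group n" and Q: "Q \<in> unitary_group n" and R: "R \<in> GL n" "upper_triangular R"
    and QR: "hdiag n u (\<lambda>i. exp (t0 * D i)) * g = Q * R"
  defines "c \<equiv> wcoef u (\<pi> g *\<^sub>v w)" and "b \<equiv> \<lambda>\<alpha>. wpair n \<alpha> D"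
  shows "gibbs_mean weights c b t0 = (\<Sum>i<n. real_of_int (\<omega> $ i) * Re (hdiag n (mat_adjoint Q * u) D $$ (i, i)))"
    and "gibbs_variance weights c b t0 \<le> real_of_int (\<omega> $ 0 - \<omega> $ (n - 1)) * (\<Sum>k<n. (D k)\<^sup>2)"
proof -
  note ww = highest_weight_vector_weight_vec[OF w]
  note wc = weight_vec_carrier[OF ww(1)]
  define x where "x = \<pi> g *\<^sub>v w"
  have x: "x \<in> carrier_vec d" "x \<noteq> 0\<^sub>v d" unfolding x_def using g wc ww(2) act_nonzero by auto
  define E where "E t = hdiag n u (\<lambda>i. exp (t * D i))" for t
  have E: "E t \<in> GL n" for t unfolding E_def using u by (intro udiag_GL) auto
  define v where "v = mat_adjoint Q * u"
  have v: "v \<in> unitary_group n" unfolding v_def using unitary_mult unitary_adjoint Q u by blast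
  interpret es: exp_sum weights c b unfolding c_def x_def[symmetric] using exp_sum_wcoef[OF u x] .
  have F: "half_log_sum_exp weights c b t = ln (ip_norm ip (\<pi> (E t) *\<^sub>v x))" for t
    unfolding c_def b_def x_def[symmetric] ln_norm_exp[OF u x, symmetric] mat_exp_smult_udiag[OF u] E_def
    by (simp add: exp_of_real[symmetric])
  have rs: "exp_sum {..<n} (\<lambda>k. (cmod (v $$ (i, k)))\<^sup>2)" if "i < n" for i
    using unitary_row_norm[OF v that] by unfold_locales auto
  let ?m = "\<lambda>i. gibbs_mean {..<n} (\<lambda>k. (cmod (v $$ (i, k)))\<^sup>2) D"
  let ?V = "\<lambda>i. gibbs_variance {..<n} (\<lambda>k. (cmod (v $$ (i, k)))\<^sup>2) D"
  let ?l = "\<lambda>i. real_of_int (\<omega> $ i - \<omega> $ (n - 1))"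
  define F0 where "F0 = half_log_sum_exp weights c b t0"
  define q where "q t = half_log_sum_exp weights c b (t + t0)" for t
  define U where "U t = F0 + (\<Sum>i<n. ?l i * half_log_sum_exp {..<n} (\<lambda>k. (cmod (v $$ (i, k)))\<^sup>2) D t)
      + real_of_int (\<omega> $ (n - 1)) * (t * (\<Sum>k<n. D k))" for t
  define U' where "U' t = (\<Sum>i<n. ?l i * ?m i t) + real_of_int (\<omega> $ (n - 1)) * (\<Sum>k<n. D k)" for t
  have q1: "(q has_real_derivative gibbs_mean weights c b (t + t0)) (at t)" for t
    unfolding q_def using es.half_log_sum_exp_deriv[of "t + t0"] DERIV_shift by blast
  have q2: "((\<lambda>t. gibbs_mean weights c b (t + t0)) has_real_derivative 2 * gibbs_variance weights c b t0) (at 0)"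
    using es.gibbs_mean_deriv[of "0 + t0"] DERIV_shift[of "gibbs_mean weights c b" _ 0 t0] by simp
  have s1: "((\<lambda>t. \<Sum>i<n. ?l i * half_log_sum_exp {..<n} (\<lambda>k. (cmod (v $$ (i, k)))\<^sup>2) D t) has_real_derivative (\<Sum>i<n. ?l i * ?m i t)) (at t)" for t
    by (intro DERIV_sum DERIV_cmult exp_sum.half_log_sum_exp_deriv rs) auto
  have U1: "(U has_real_derivative U' t) (at t)" for t
  proof -
    have "((\<lambda>t. real_of_int (\<omega> $ (n - 1)) * (t * (\<Sum>k<n. D k))) has_real_derivative real_of_int (\<omega> $ (n - 1)) * (\<Sum>k<n. D k)) (at t)"
      by (auto intro!: derivative_eq_intros)
    from DERIV_add[OF DERIV_add[OF DERIV_const s1] this] show ?thesis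
      unfolding U_def[abs_def] U'_def by simp
  qed
  have U2: "(U' has_real_derivative (\<Sum>i<n. ?l i * (2 * ?V i 0)) + 0) (at 0)"
    unfolding U'_def[abs_def]
    by (intro DERIV_add DERIV_const DERIV_sum DERIV_cmult exp_sum.gibbs_mean_deriv rs) auto
  have qU: "q t \<le> U t" for t
  proof -
    have "E (t + t0) = E t * E t0"
      unfolding E_def udiag_mult[OF u] of_real_mult[symmetric] exp_add[symmetric] by (simp add: algebra_simps)
    then have "\<pi> (E (t + t0)) *\<^sub>v x = \<pi> (E t) *\<^sub>v (\<pi> (E t0 * g) *\<^sub>v w)"
      unfolding x_def using E g wc by (simp add: act_mult GL_mult)
    then have "q t = ln (ip_norm ip (\<pi> (E t) *\<^sub>v (\<pi> (Q * R) *\<^sub>v w)))"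
      unfolding q_def F using QR by (simp add: E_def)
    moreover have "F0 = ln (ip_norm ip (\<pi> (Q * R) *\<^sub>v w))"
      unfolding F0_def F x_def using QR act_mult[OF E g wc, of t0] by (simp add: E_def)
    ultimately show ?thesis
      using coherent_upper_bound[OF w n dom u Q R, of t D] unfolding U_def E_def v_def by simp
  qed
  have qU0: "q 0 = U 0"
  proof -
    have "half_log_sum_exp {..<n} (\<lambda>k. (cmod (v $$ (i, k)))\<^sup>2) D 0 = 0" if "i < n" for i
      unfolding half_log_sum_exp_def using unitary_row_norm[OF v that] by simp
    then show ?thesis unfolding q_def U_def F0_def by simp
  qed
  note touch = touching_second_order[OF q1 q2 U1 U2 qU qU0]
  have m0: "?m i 0 = (\<Sum>k<n. (cmod (v $$ (i, k)))\<^sup>2 * D k)" if "i < n" for i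
    using unitary_row_norm[OF v that] by (simp add: gibbs_mean_def exp_moment_def)
  have total: "(\<Sum>i<n. ?m i 0) = (\<Sum>k<n. D k)"
  proof -
    have "(\<Sum>i<n. ?m i 0) = (\<Sum>i<n. \<Sum>k<n. (cmod (v $$ (i, k)))\<^sup>2 * D k)"
      by (intro sum.cong) (simp_all add: m0)
    also have "\<dots> = (\<Sum>k<n. (\<Sum>i<n. (cmod (v $$ (i, k)))\<^sup>2) * D k)"
      by (subst sum.swap) (simp add: sum_distrib_right)
    finally show ?thesis using unitary_column_norm[OF v] by simp
  qed
  have "gibbs_mean weights c b t0 = U' 0" using touch(1) by simp
  also have "\<dots> = (\<Sum>i<n. real_of_int (\<omega> $ i) * ?m i 0)"
    unfolding U'_def total[symmetric] sum_distrib_left sum.distrib[symmetric]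
    by (intro sum.cong) (auto simp: algebra_simps)
  also have "\<dots> = (\<Sum>i<n. real_of_int (\<omega> $ i) * Re (hdiag n v D $$ (i, i)))"
    by (intro sum.cong) (auto simp: m0 udiag_diag_entry[OF v])
  finally show "gibbs_mean weights c b t0 = (\<Sum>i<n. real_of_int (\<omega> $ i) * Re (hdiag n (mat_adjoint Q * u) D $$ (i, i)))"
    unfolding v_def .
  have "gibbs_variance weights c b t0 \<le> (\<Sum>i<n. ?l i * ?V i 0)"
    using touch(2) by (simp add: sum_distrib_left[symmetric] mult.left_commute[of _ 2])
  also have "\<dots> \<le> (\<Sum>i<n. ?l 0 * (\<Sum>k<n. (cmod (v $$ (i, k)))\<^sup>2 * (D k)\<^sup>2))"
  proof (intro sum_mono)
    fix i assume "i \<in> {..<n}"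
    then have i: "i < n" by simp
    have V: "?V i 0 \<le> (\<Sum>k<n. (cmod (v $$ (i, k)))\<^sup>2 * (D k)\<^sup>2)"
      using unitary_row_norm[OF v i] by (simp add: gibbs_variance_def exp_moment_def)
    have "?l i * ?V i 0 \<le> ?l i * (\<Sum>k<n. (cmod (v $$ (i, k)))\<^sup>2 * (D k)\<^sup>2)"
      using V dom[of i "n - 1"] i n by (intro mult_left_mono) auto
    also have "\<dots> \<le> ?l 0 * (\<Sum>k<n. (cmod (v $$ (i, k)))\<^sup>2 * (D k)\<^sup>2)"
      using dom[of 0 i] i by (intro mult_right_mono) (auto simp: sum_nonneg)
    finally show "?l i * ?V i 0 \<le> ?l 0 * (\<Sum>k<n. (cmod (v $$ (i, k)))\<^sup>2 * (D k)\<^sup>2)" .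
  qed
  also have "\<dots> = ?l 0 * (\<Sum>k<n. (\<Sum>i<n. (cmod (v $$ (i, k)))\<^sup>2) * (D k)\<^sup>2)"
    unfolding sum_distrib_left[symmetric] sum_distrib_right by (subst sum.swap) simp
  finally show "gibbs_variance weights c b t0 \<le> ?l 0 * (\<Sum>k<n. (D k)\<^sup>2)"
    using unitary_column_norm[OF v] by simp
qed

text \<open>The variance of the exponents is here linear in the weight, whereas the range of the exponents would only
  give a bound that is quadratic in it.  Dividing by the common
  denominator of \<open>p\<close> therefore leaves a bound in terms of \<open>p\<close> alone.\<close>

lemma coherent_quadratic_bound:
  assumes w: "highest_weight_vector n d \<pi> \<omega> w" and n: "n \<ge> 1"
    and dom: "\<And>i j. i \<le> j \<Longrightarrow> j < n \<Longrightarrow> \<omega> $ j \<le> \<omega> $ i"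
    and Q: "Q \<in> unitary_group n" and R: "R \<in> GL n" "upper_triangular R" and H: "H \<in> Herm n"
  shows "ln (ip_norm ip (\<pi> (mat_exp (complex_of_real s \<cdot>\<^sub>m H)) *\<^sub>v (\<pi> (Q * R) *\<^sub>v w)))
    \<le> ln (ip_norm ip (\<pi> (Q * R) *\<^sub>v w))
      + s * (\<Sum>i<n. real_of_int (\<omega> $ i) * Re ((mat_adjoint Q * H * Q) $$ (i, i)))
      + real_of_int (\<omega> $ 0 - \<omega> $ (n - 1)) * (frobenius_norm H)\<^sup>2 * s\<^sup>2"
proof -
  obtain u D where u: "u \<in> unitary_group n" and HD: "H = hdiag n u D"
    using H by (rule Herm_obtain_udiag)
  note ww = highest_weight_vector_weight_vec[OF w]
  define x where "x = \<pi> (Q * R) *\<^sub>v w"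
  have g: "Q * R \<in> GL n" using unitary_GL[OF Q] R(1) by (rule GL_mult)
  have x: "x \<in> carrier_vec d" "x \<noteq> 0\<^sub>v d"
    unfolding x_def using g weight_vec_carrier[OF ww(1)] ww(2) act_nonzero by auto
  let ?c = "wcoef u x" and ?b = "\<lambda>\<alpha>. wpair n \<alpha> D"
  interpret es: exp_sum weights ?c ?b using exp_sum_wcoef[OF u x] .
  have "half_log_sum_exp weights ?c ?b s \<le> half_log_sum_exp weights ?c ?b 0 + s * gibbs_mean weights ?c ?b 0
      + (real_of_int (\<omega> $ 0 - \<omega> $ (n - 1)) * (\<Sum>k<n. (D k)\<^sup>2)) * s\<^sup>2"
  proof (rule quadratic_upper_bound[OF es.half_log_sum_exp_deriv es.gibbs_mean_deriv])
    fix t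
    let ?E = "hdiag n u (\<lambda>i. exp (t * D i))"
    have E: "?E * (Q * R) \<in> GL n" using u by (intro GL_mult g udiag_GL) auto
    obtain Q' R' where Q': "Q' \<in> unitary_group n" and R': "R' \<in> carrier_mat n n" "upper_triangular R'"
      and QR': "?E * (Q * R) = Q' * R'" using QR_exists[OF GL_carrier[OF E]] by blast
    have "R' = mat_adjoint Q' * (?E * (Q * R))" unfolding QR' using unitary_cancel(1)[OF Q' R'(1)] by simp
    then have "R' \<in> GL n" using GL_mult[OF unitary_GL[OF unitary_adjoint[OF Q']] E] by simp
    from coherent_derivatives(2)[OF w n dom g u Q' this R'(2) QR']
    show "2 * gibbs_variance weights ?c ?b t \<le> 2 * (real_of_int (\<omega> $ 0 - \<omega> $ (n - 1)) * (\<Sum>k<n. (D k)\<^sup>2))"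
      by (simp add: x_def)
  qed
  moreover have "gibbs_mean weights ?c ?b 0 = (\<Sum>i<n. real_of_int (\<omega> $ i) * Re ((mat_adjoint Q * H * Q) $$ (i, i)))"
    unfolding HD udiag_conj[OF Q u] x_def
    by (rule coherent_derivatives(1)[OF w n dom g u Q R]) (use udiag_one[OF u] left_mult_one_mat[OF GL_carrier[OF g]] in simp_all)
  moreover have "half_log_sum_exp weights ?c ?b 0 = ln (ip_norm ip x)"
    using ln_norm_exp[OF u x, of 0 D] mat_exp_smult_udiag[OF u, of 0] udiag_one[OF u] act_one[OF x(1)] by simp
  ultimately show ?thesis
    unfolding x_def[symmetric] HD ln_norm_exp[OF u x] frobenius_udiag[OF u] by simp
qed

end

section \<open>The Hoffman--Wielandt inequality\<close>

text \<open>Summation by parts.\<close>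

lemma abel_nonneg:
  fixes a d :: "nat \<Rightarrow> real"
  assumes a: "\<And>i j. i \<le> j \<Longrightarrow> j < n \<Longrightarrow> a j \<le> a i"
    and part: "\<And>k. k \<le> n \<Longrightarrow> (\<Sum>i<k. d i) \<ge> 0" and total: "(\<Sum>i<n. d i) = 0"
  shows "(\<Sum>i<n. a i * d i) \<ge> 0"
proof -
  have "k \<le> n \<Longrightarrow> (\<Sum>i<k. a i * d i) \<ge> a (k - 1) * (\<Sum>i<k. d i)" for k
  proof (induction k)
    case (Suc k)
    have "a k * (\<Sum>i<k. d i) \<le> a (k - 1) * (\<Sum>i<k. d i)"
      using a[of "k - 1" k] part[of k] Suc.prems by (intro mult_right_mono) auto
    then show ?case using Suc by (simp add: distrib_left)
  qed simp
  from this[of n] show ?thesis using total by simp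
qed

text \<open>The averages of a nonincreasing sequence against a doubly stochastic matrix are majorised by the
  sequence; summation by parts then compares the pairings.\<close>

lemma doubly_stochastic_rearrangement:
  fixes a b :: "nat \<Rightarrow> real" and S :: "nat \<Rightarrow> nat \<Rightarrow> real"
  assumes a: "\<And>i j. i \<le> j \<Longrightarrow> j < n \<Longrightarrow> a j \<le> a i" and b: "\<And>i j. i \<le> j \<Longrightarrow> j < n \<Longrightarrow> b j \<le> b i"
    and S: "\<And>i j. i < n \<Longrightarrow> j < n \<Longrightarrow> S i j \<ge> 0" and rows: "\<And>i. i < n \<Longrightarrow> (\<Sum>j<n. S i j) = 1"
    and cols: "\<And>j. j < n \<Longrightarrow> (\<Sum>i<n. S i j) = 1"
  shows "(\<Sum>i<n. \<Sum>j<n. a i * b j * S i j) \<le> (\<Sum>i<n. a i * b i)"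
proof -
  define c where "c i = (\<Sum>j<n. S i j * b j)" for i
  have maj: "(\<Sum>i<k. b i - c i) \<ge> 0" if k: "k \<le> n" for k
  proof (cases "k = 0")
    case False
    define w where "w j = (\<Sum>i<k. S i j)" for j
    define \<chi> where "\<chi> j = (if j < k then 1 else 0 :: real)" for j
    have w: "0 \<le> w j" "w j \<le> 1" if "j < n" for j
    proof -
      show "0 \<le> w j" unfolding w_def using k that S by (intro sum_nonneg) auto
      have "w j \<le> (\<Sum>i<n. S i j)" unfolding w_def using k that S by (intro sum_mono2) auto
      then show "w j \<le> 1" using cols[OF that] by simp
    qed
    have \<chi>: "(\<Sum>j<n. \<chi> j * f j) = (\<Sum>j<k. f j)" for f :: "nat \<Rightarrow> real"
      unfolding \<chi>_def using k by (intro sum.mono_neutral_cong_right) auto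
    have "(\<Sum>i<k. c i) = (\<Sum>j<n. w j * b j)"
      unfolding c_def w_def by (subst sum.swap) (simp add: sum_distrib_right)
    moreover have "(\<Sum>j<n. w j) = real k"
      unfolding w_def by (subst sum.swap) (use rows k in simp)
    ultimately have "(\<Sum>i<k. b i - c i) = (\<Sum>j<n. (\<chi> j - w j) * (b j - b (k - 1)))"
      using \<chi>[of b] \<chi>[of "\<lambda>_. 1"]
      by (simp add: sum_subtractf algebra_simps sum_distrib_left[symmetric] sum_distrib_right[symmetric])
    also have "\<dots> \<ge> 0"
    proof (rule sum_nonneg)
      fix j assume "j \<in> {..<n}"
      then show "0 \<le> (\<chi> j - w j) * (b j - b (k - 1))"
        using w[of j] b[of j "k - 1"] b[of "k - 1" j] k False
        by (cases "j < k") (auto simp: \<chi>_def intro!: mult_nonneg_nonneg mult_nonneg_nonpos)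
    qed
    finally show ?thesis .
  qed simp
  have "(\<Sum>i<n. c i) = (\<Sum>j<n. (\<Sum>i<n. S i j) * b j)"
    unfolding c_def by (subst sum.swap) (simp add: sum_distrib_right)
  then have "(\<Sum>i<n. b i - c i) = 0" using cols by (simp add: sum_subtractf)
  from abel_nonneg[of n a, OF a maj this]
  have "(\<Sum>i<n. a i * c i) \<le> (\<Sum>i<n. a i * b i)" by (simp add: algebra_simps sum_subtractf)
  then show ?thesis by (simp add: c_def sum_distrib_left algebra_simps)
qed

lemma spec_udiag:
  assumes u: "u \<in> unitary_group n"
  obtains \<sigma> where "\<sigma> permutes {..<n}" "spec (hdiag n u D) = vec n (\<lambda>i. D (\<sigma> i))"
    "\<And>i j. i \<le> j \<Longrightarrow> j < n \<Longrightarrow> D (\<sigma> j) \<le> D (\<sigma> i)"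
proof -
  let ?d = "mat_diag n (\<lambda>i. complex_of_real (D i))"
  note uc = unitary_carrier[OF u] mat_adjoint_carrier[OF unitary_carrier[OF u]]
  have "similar_mat (hdiag n u D) ?d"
    by (rule similar_matI[of _ _ u "mat_adjoint u" n])
      (use uc u unitary_mult_adj[OF u] unitary_adj_mult[OF u] in \<open>auto simp: udiag_def\<close>)
  then have "char_poly (hdiag n u D) = char_poly ?d" by (rule char_poly_similar)
  also have "\<dots> = (\<Prod>a\<leftarrow>diag_mat ?d. [:- a, 1:])"
    by (rule char_poly_upper_triangular[of _ n]) (auto intro!: upper_triangularI)
  also have "diag_mat ?d = map (\<lambda>i. complex_of_real (D i)) [0..<n]" by (simp add: diag_mat_def)
  finally have cp: "char_poly (hdiag n u D) = (\<Prod>a\<leftarrow>map (\<lambda>i. complex_of_real (D i)) [0..<n]. [:- a, 1:])" .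
  have roots: "proots (\<Prod>a\<leftarrow>xs. [:- a, 1:]) = mset xs" for xs :: "complex list"
  proof (induction xs)
    case (Cons x xs)
    have "(\<Prod>a\<leftarrow>xs. [:- a, 1:]) \<noteq> 0" by (auto simp: prod_list_zero_iff)
    then show ?case using Cons by (simp add: proots_mult del: mult_pCons_left)
  qed simp
  define ys where "ys = rev (sorted_list_of_multiset (mset (map D [0..<n])))"
  have spec: "spec (hdiag n u D) = vec_of_list ys"
    unfolding spec_def cp roots ys_def by (simp add: comp_def flip: mset_map)
  have ys: "mset ys = mset (map D [0..<n])" unfolding ys_def by simp
  then obtain \<sigma> where \<sigma>: "\<sigma> permutes {..<length (map D [0..<n])}" "permute_list \<sigma> (map D [0..<n]) = ys"
    by (rule mset_eq_permutation)
  have len: "length ys = n" using mset_eq_length[OF ys] by simp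
  have \<sigma>n: "\<sigma> permutes {..<n}" using \<sigma>(1) by simp
  have nth: "ys ! i = D (\<sigma> i)" if "i < n" for i
  proof -
    have "\<sigma> i < n" using permutes_in_image[OF \<sigma>n] that by auto
    then show ?thesis unfolding \<sigma>(2)[symmetric] using that by (simp add: permute_list_def)
  qed
  have sorted: "D (\<sigma> j) \<le> D (\<sigma> i)" if "i \<le> j" "j < n" for i j
  proof -
    have "sorted (rev ys)" unfolding ys_def by simp
    then have "ys ! j \<le> ys ! i" using sorted_rev_nth_mono[of ys i j] that len by simp
    then show ?thesis using nth that by simp
  qed
  have "vec_of_list ys = vec n (\<lambda>i. D (\<sigma> i))"
    using len nth by (intro eq_vecI) (auto simp: vec_of_list_index)
  then show ?thesis using that[OF \<sigma>n] spec sorted by simp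
qed

text \<open>The Hoffman--Wielandt inequality: the squared Frobenius distance of two Hermitian matrices
  depends on the eigenvectors only through the doubly stochastic matrix of squared inner products.\<close>

lemma hoffman_wielandt:
  assumes M: "M \<in> Herm n" and Q: "Q \<in> unitary_group n"
    and a: "\<And>i j. i \<le> j \<Longrightarrow> j < n \<Longrightarrow> a j \<le> a i"
  shows "l2_norm (spec M - vec n a) \<le> frobenius_norm (M - hdiag n Q (\<lambda>i. a (n - 1 - i)))"
proof -
  obtain u D where u: "u \<in> unitary_group n" and MD: "M = hdiag n u D"
    using M by (rule Herm_obtain_udiag)
  obtain \<sigma> where \<sigma>: "\<sigma> permutes {..<n}" and spec: "spec M = vec n (\<lambda>i. D (\<sigma> i))"
    and sorted: "\<And>i j. i \<le> j \<Longrightarrow> j < n \<Longrightarrow> D (\<sigma> j) \<le> D (\<sigma> i)"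
    using spec_udiag[OF u, of D] unfolding MD by metis
  define \<tau> where "\<tau> i = n - 1 - i" for i
  define K where "K = hdiag n Q (\<lambda>i. a (\<tau> i))"
  have K: "K \<in> Herm n" unfolding K_def by (rule udiag_real_Herm[OF Q])
  define v where "v = mat_adjoint u * Q"
  have v: "v \<in> unitary_group n" unfolding v_def using unitary_mult unitary_adjoint u Q by blast
  define S where "S i j = (cmod (v $$ (i, j)))\<^sup>2" for i j
  have b\<sigma>: "bij_betw \<sigma> {..<n} {..<n}" using \<sigma> by (rule permutes_imp_bij)
  have b\<tau>: "bij_betw \<tau> {..<n} {..<n}" by (rule bij_betw_byWitness[where f' = \<tau>]) (auto simp: \<tau>_def)
  have in_range: "\<sigma> i < n" "\<tau> i < n" if "i < n" for i
    using bij_betwE[OF b\<sigma>] bij_betwE[OF b\<tau>] that by auto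
  note uc = unitary_carrier[OF u] mat_adjoint_carrier[OF unitary_carrier[OF u]]
  note Mc = Herm_carrier[OF M] and Kc = Herm_carrier[OF K]
  have "tr (M * K) = tr (mat_diag n (\<lambda>i. complex_of_real (D i)) * hdiag n v (\<lambda>i. a (\<tau> i)))"
  proof -
    have "tr (M * K) = tr (mat_adjoint u * (M * K) * mat_adjoint (mat_adjoint u))"
      using Mc Kc by (intro tr_unitary_conj[OF unitary_adjoint[OF u], symmetric]) simp
    also have "mat_adjoint u * (M * K) * mat_adjoint (mat_adjoint u) = (mat_adjoint u * M * u) * (mat_adjoint u * K * u)"
      using unitary_cancel(2)[OF u, of "K * u" n] Mc Kc uc by (simp add: assoc_mult_mat[of _ n n _ n _ n])
    also have "mat_adjoint u * M * u = mat_diag n (\<lambda>i. complex_of_real (D i))"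
      unfolding MD udiag_conj[OF u u] unitary_adj_mult[OF u] by (simp add: udiag_def)
    also have "mat_adjoint u * K * u = hdiag n v (\<lambda>i. a (\<tau> i))"
      unfolding K_def udiag_conj[OF u Q] v_def ..
    finally show ?thesis .
  qed
  also have "\<dots> = (\<Sum>i<n. complex_of_real (D i) * hdiag n v (\<lambda>i. a (\<tau> i)) $$ (i, i))"
    unfolding mat_diag_mult_left[OF udiag_carrier[OF v]] tr_def by simp
  also have "\<dots> = complex_of_real (\<Sum>i<n. \<Sum>j<n. D i * a (\<tau> j) * S i j)"
    unfolding of_real_sum[of _ "{..<n}"]
    by (intro sum.cong) (auto simp: udiag_diag_entry[OF v] S_def sum_distrib_left algebra_simps simp flip: of_real_mult of_real_power)
  finally have trMK: "tr (M * K) = complex_of_real (\<Sum>i<n. \<Sum>j<n. D i * a (\<tau> j) * S i j)" .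
  have "(\<Sum>i<n. \<Sum>j<n. D i * a (\<tau> j) * S i j) = (\<Sum>i<n. \<Sum>j<n. D (\<sigma> i) * a j * S (\<sigma> i) (\<tau> j))"
  proof -
    have "(\<Sum>i<n. \<Sum>j<n. D i * a (\<tau> j) * S i j) = (\<Sum>i<n. \<Sum>j<n. D (\<sigma> i) * a (\<tau> j) * S (\<sigma> i) j)"
      by (rule sum.reindex_bij_betw[OF b\<sigma>, symmetric])
    also have "\<dots> = (\<Sum>i<n. \<Sum>j<n. D (\<sigma> i) * a (\<tau> (\<tau> j)) * S (\<sigma> i) (\<tau> j))"
      by (intro sum.cong refl sum.reindex_bij_betw[OF b\<tau>, symmetric])
    also have "\<dots> = (\<Sum>i<n. \<Sum>j<n. D (\<sigma> i) * a j * S (\<sigma> i) (\<tau> j))"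
      by (intro sum.cong refl) (simp add: \<tau>_def)
    finally show ?thesis .
  qed
  also have "\<dots> \<le> (\<Sum>i<n. D (\<sigma> i) * a i)"
  proof (rule doubly_stochastic_rearrangement[OF sorted a])
    show "(\<Sum>j<n. S (\<sigma> i) (\<tau> j)) = 1" if "i < n" for i
      using sum.reindex_bij_betw[OF b\<tau>, of "S (\<sigma> i)"] unitary_row_norm[OF v in_range(1)[OF that]] by (simp add: S_def)
    show "(\<Sum>i<n. S (\<sigma> i) (\<tau> j)) = 1" if "j < n" for j
      using sum.reindex_bij_betw[OF b\<sigma>, of "\<lambda>i. S i (\<tau> j)"] unitary_column_norm[OF v in_range(2)[OF that]] by (simp add: S_def)
  qed (auto simp: S_def)
  finally have key: "Re (tr (M * K)) \<le> (\<Sum>i<n. D (\<sigma> i) * a i)" unfolding trMK by simp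
  have fM: "(frobenius_norm M)\<^sup>2 = (\<Sum>i<n. (D (\<sigma> i))\<^sup>2)"
    unfolding MD frobenius_udiag[OF u] by (rule sum.reindex_bij_betw[OF b\<sigma>, symmetric])
  have fK: "(frobenius_norm K)\<^sup>2 = (\<Sum>i<n. (a i)\<^sup>2)"
    unfolding K_def frobenius_udiag[OF Q] by (rule sum.reindex_bij_betw[OF b\<tau>])
  have MK: "M - K \<in> Herm n" by (rule Herm_minus[OF M K])
  have "complex_of_real ((frobenius_norm (M - K))\<^sup>2) = tr (M * (M - K)) - tr (K * (M - K))"
    unfolding Herm_frobenius[OF MK, symmetric] minus_mult_distrib_mat[OF Mc Kc Herm_carrier[OF MK]]
    using Mc Kc Herm_carrier[OF MK] by (intro tr_minus[of _ n]) auto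
  also have "\<dots> = tr (M * M) - tr (M * K) - (tr (K * M) - tr (K * K))"
    unfolding mult_minus_distrib_mat[OF Mc Mc Kc] mult_minus_distrib_mat[OF Kc Mc Kc]
    using Mc Kc by (simp add: tr_minus[of _ n])
  also have "tr (K * M) = tr (M * K)" using Mc Kc by (intro tr_commute)
  finally have "complex_of_real ((frobenius_norm (M - K))\<^sup>2)
      = complex_of_real ((frobenius_norm M)\<^sup>2 - 2 * Re (tr (M * K)) + (frobenius_norm K)\<^sup>2)"
    unfolding Herm_frobenius[OF M] Herm_frobenius[OF K] trMK by simp
  then have "(frobenius_norm (M - K))\<^sup>2 = (frobenius_norm M)\<^sup>2 - 2 * Re (tr (M * K)) + (frobenius_norm K)\<^sup>2"
    unfolding of_real_eq_iff .
  also have "\<dots> \<ge> (\<Sum>i<n. (D (\<sigma> i))\<^sup>2) - 2 * (\<Sum>i<n. D (\<sigma> i) * a i) + (\<Sum>i<n. (a i)\<^sup>2)"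
    using key unfolding fM fK by simp
  also have "(\<Sum>i<n. (D (\<sigma> i))\<^sup>2) - 2 * (\<Sum>i<n. D (\<sigma> i) * a i) + (\<Sum>i<n. (a i)\<^sup>2) = (\<Sum>i<n. (D (\<sigma> i) - a i)\<^sup>2)"
    by (simp add: power2_diff sum.distrib sum_subtractf sum_distrib_left mult.assoc)
  finally have "sqrt (\<Sum>i<n. (D (\<sigma> i) - a i)\<^sup>2) \<le> frobenius_norm (M - K)"
    by (intro real_le_lsqrt) (auto simp: sum_nonneg)
  then show ?thesis unfolding spec K_def \<tau>_def l2_norm_def by simp
qed

section \<open>Descent of the potential\<close>

lemma complex_of_rat_eq: "(of_rat r :: complex) = complex_of_real (real_of_rat r)"
  by (cases r) (simp add: of_rat_rat)

lemma common_denominator_pos_integral: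
  "common_denominator p > 0 \<and> (\<forall>i<dim_vec p. of_nat (common_denominator p) * p $ i \<in> \<int>)"
  unfolding common_denominator_def
proof (rule LeastI_ex)
  define den where "den i = snd (quotient_of (p $ i))" for i
  have den: "den i > 0" for i unfolding den_def by (rule quotient_of_denom_pos')
  define l where "l = nat (\<Prod>i<dim_vec p. den i)"
  have l0: "(\<Prod>i<dim_vec p. den i) > 0" using den by (intro prod_pos) auto
  have "of_nat l * p $ i \<in> \<int>" if i: "i < dim_vec p" for i
  proof -
    have "(\<Prod>j<dim_vec p. den j) = den i * (\<Prod>j\<in>{..<dim_vec p} - {i}. den j)"
      using i by (intro prod.remove) auto
    moreover have "p $ i = of_int (fst (quotient_of (p $ i))) / of_int (den i)"
      unfolding den_def by (rule quotient_of_div) (simp add: surjective_pairing[symmetric])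
    ultimately have "of_int (\<Prod>j<dim_vec p. den j) * p $ i
        = of_int ((\<Prod>j\<in>{..<dim_vec p} - {i}. den j) * fst (quotient_of (p $ i)))"
      using den[of i] by (simp add: field_simps)
    moreover have "of_nat l = (of_int (\<Prod>j<dim_vec p. den j) :: rat)" unfolding l_def using l0 by (simp add: of_nat_nat)
    ultimately show ?thesis by (metis Ints_of_int)
  qed
  moreover have "l > 0" unfolding l_def using l0 by simp
  ultimately show "\<exists>l. l > 0 \<and> (\<forall>i<dim_vec p. of_nat l * p $ i \<in> \<int>)" by blast
qed

lemma dual_weight_entry:
  assumes p: "p \<in> carrier_vec n" and i: "i < n"
  shows "real_of_int (dual_weight p $ i) = - real (common_denominator p) * real_of_rat (p $ (n - 1 - i))"
proof -
  have "of_nat (common_denominator p) * p $ (n - 1 - i) \<in> \<int>"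
    using common_denominator_pos_integral[of p] p i by auto
  then have "of_int \<lfloor>of_nat (common_denominator p) * p $ (n - 1 - i)\<rfloor> = of_nat (common_denominator p) * p $ (n - 1 - i)"
    by (metis Ints_cases floor_of_int)
  then have "real_of_int \<lfloor>of_nat (common_denominator p) * p $ (n - 1 - i)\<rfloor> = real (common_denominator p) * real_of_rat (p $ (n - 1 - i))"
    by (metis of_rat_mult of_rat_of_int_eq of_rat_of_nat_eq)
  then show ?thesis using p i by (simp add: dual_weight_def)
qed

text \<open>The optimal constant is \<open>\<surd>2\<close>.  A constant smaller than \<open>2\<close> is required: the step size
  \<open>1 / (2 N2)\<close> decreases the potential only if its curvature stays below \<open>4 N2\<close>.\<close>

lemma spread_le_l2_norm:
  fixes a :: "nat \<Rightarrow> real"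
  assumes "i < n" "j < n"
  shows "a i - a j \<le> 3 / 2 * l2_norm (vec n a)"
proof (cases "i = j")
  case False
  have "(a i)\<^sup>2 + (a j)\<^sup>2 = (\<Sum>k\<in>{i, j}. (a k)\<^sup>2)" using False by simp
  also have "\<dots> \<le> (\<Sum>k<n. (a k)\<^sup>2)" using assms by (intro sum_mono2) auto
  also have "\<dots> = (l2_norm (vec n a))\<^sup>2" by (simp add: l2_norm_def sum_nonneg)
  finally have "(a i - a j)\<^sup>2 \<le> 2 * (l2_norm (vec n a))\<^sup>2"
    using zero_le_power2[of "a i + a j"] by (simp add: power2_sum power2_diff)
  also have "\<dots> \<le> (3 / 2 * l2_norm (vec n a))\<^sup>2" by (simp add: power_mult_distrib power2_eq_square)
  finally show ?thesis
    by (rule power2_le_imp_le) (simp add: l2_norm_def sum_nonneg)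
qed (simp add: l2_norm_def sum_nonneg)

lemma mat_exp_Herm_GL:
  assumes "H \<in> Herm n"
  shows "mat_exp (complex_of_real s \<cdot>\<^sub>m H) \<in> GL n"
proof -
  obtain u D where u: "u \<in> unitary_group n" and "H = hdiag n u D"
    using assms by (rule Herm_obtain_udiag)
  then show ?thesis by (simp add: mat_exp_smult_udiag[OF u] udiag_GL[OF u])
qed

text \<open>The representation \<open>\<rho>\<close> with highest weight vector \<open>w\<close> encodes the target spectrum \<open>p\<close>: its highest weight is
  \<open>p\<close> negated, reversed and scaled by the common denominator \<open>ell\<close>.\<close>

locale scaling = P: unitary_rep d ip n \<pi> + S: unitary_rep e ip' n \<rho>
  for d ip n \<pi> e ip' \<rho> +
  fixes v :: "complex vec" and p :: "rat vec" and w :: "complex vec"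
  assumes n: "n \<ge> 1" and v: "v \<in> carrier_vec d" "ip_norm ip v = 1"
    and p: "p \<in> carrier_vec n" and p_mono: "\<And>i j. i \<le> j \<Longrightarrow> j < n \<Longrightarrow> p $ j \<le> p $ i"
    and w: "highest_weight_vector n e \<rho> (dual_weight p) w" "ip_norm ip' w = 1"
begin

definition a :: "nat \<Rightarrow> real" where "a i = real_of_rat (p $ i)"

definition ell :: real where "ell = real (common_denominator p)"

text \<open>The logarithm of the function whose infimum is the capacity.\<close>

definition \<Phi> :: "complex mat \<Rightarrow> real" where
  "\<Phi> g = ln (ip_norm ip (\<pi> g *\<^sub>v v)) + ln (ip_norm ip' (\<rho> g *\<^sub>v w)) / ell"

lemma ell_pos: "ell > 0"
  unfolding ell_def using common_denominator_pos_integral[of p] by simp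

lemma a_mono: "i \<le> j \<Longrightarrow> j < n \<Longrightarrow> a j \<le> a i"
  unfolding a_def using p_mono by (simp add: of_rat_less_eq)

lemma a_vec: "map_vec real_of_rat p = vec n a"
  using p by (intro eq_vecI) (auto simp: a_def)

lemma dual_entry: "i < n \<Longrightarrow> real_of_int (dual_weight p $ i) = - ell * a (n - 1 - i)"
  unfolding ell_def a_def by (rule dual_weight_entry[OF p])

lemma dual_dominant:
  assumes "i \<le> j" "j < n"
  shows "dual_weight p $ j \<le> dual_weight p $ i"
proof -
  have "real_of_int (dual_weight p $ j) \<le> real_of_int (dual_weight p $ i)"
    using dual_entry[of i] dual_entry[of j] assms a_mono[of "n - 1 - j" "n - 1 - i"] ell_pos by simp
  then show ?thesis by simp
qed

lemma target_udiag:
  "Q * target_diag p * mat_adjoint Q = hdiag n Q (\<lambda>i. a (n - 1 - i))"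
proof -
  have "target_diag p = mat_diag n (\<lambda>i. complex_of_real (a (n - 1 - i)))"
    using p by (intro eq_matI) (auto simp: target_diag_def a_def complex_of_rat_eq)
  then show ?thesis by (simp add: udiag_def)
qed

lemma v_nonzero: "v \<noteq> 0\<^sub>v d"
  using v P.ip_zero_right[of "0\<^sub>v d"] by (auto simp: ip_norm_def)

lemma act_v: "g \<in> GL n \<Longrightarrow> \<pi> g *\<^sub>v v \<in> carrier_vec d" "g \<in> GL n \<Longrightarrow> \<pi> g *\<^sub>v v \<noteq> 0\<^sub>v d"
  using v(1) v_nonzero P.act_nonzero by auto

lemma act_w: "g \<in> GL n \<Longrightarrow> \<rho> g *\<^sub>v w \<in> carrier_vec e" "g \<in> GL n \<Longrightarrow> \<rho> g *\<^sub>v w \<noteq> 0\<^sub>v e"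
  using S.highest_weight_vector_weight_vec[OF w(1)] S.weight_vec_carrier S.act_nonzero by auto

lemma gradient_eq:
  "gradient n \<pi> ip p v g Q = moment_map n \<pi> ip (\<pi> g *\<^sub>v v) - hdiag n Q (\<lambda>i. a (n - 1 - i))"
  unfolding gradient_def target_udiag ..

lemma gradient_Herm:
  assumes "g \<in> GL n" "Q \<in> unitary_group n"
  shows "gradient n \<pi> ip p v g Q \<in> Herm n"
  unfolding gradient_eq
  by (intro Herm_minus P.moment_map_Herm act_v udiag_real_Herm assms)

lemma spec_distance_le_gradient:
  assumes "g \<in> GL n" "Q \<in> unitary_group n"
  shows "l2_norm (spec (moment_map n \<pi> ip (\<pi> g *\<^sub>v v)) - map_vec real_of_rat p)
    \<le> frobenius_norm (gradient n \<pi> ip p v g Q)"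
  unfolding gradient_eq a_vec using assms a_mono
  by (intro hoffman_wielandt P.moment_map_Herm act_v) auto

abbreviation N :: real where "N \<equiv> weight_norm n d \<pi>"

text \<open>The gradient is the derivative of \<open>\<Phi>\<close>: the first summand contributes the moment map, and the second one
  the diagonal of \<open>Q\<^sup>\<dagger> H Q\<close> weighted with the reversed negative of \<open>p\<close>, that is, minus the pairing of \<open>H\<close> with
  \<open>Q \<Lambda> Q\<^sup>\<dagger>\<close>.\<close>

lemma \<Phi>_descent:
  assumes Q: "Q \<in> unitary_group n" and R: "R \<in> GL n" "upper_triangular R" and g: "g = Q * R"
  defines "G \<equiv> gradient n \<pi> ip p v g Q"
  shows "\<Phi> (mat_exp (complex_of_real s \<cdot>\<^sub>m G) * g)
    \<le> \<Phi> g + s * (frobenius_norm G)\<^sup>2 + (N\<^sup>2 + 3 / 2 * l2_norm (vec n a)) * (frobenius_norm G)\<^sup>2 * s\<^sup>2"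
proof -
  have gG: "g \<in> GL n" unfolding g using unitary_GL[OF Q] R(1) by (rule GL_mult)
  have GH: "G \<in> Herm n" unfolding G_def by (rule gradient_Herm[OF gG Q])
  note Gc = Herm_carrier[OF GH] and Qc = unitary_carrier[OF Q]
  let ?E = "mat_exp (complex_of_real s \<cdot>\<^sub>m G)"
  let ?x = "\<pi> g *\<^sub>v v" and ?\<mu> = "moment_map n \<pi> ip (\<pi> g *\<^sub>v v)"
  let ?\<Lambda> = "\<lambda>i. complex_of_real (a (n - 1 - i))"
  let ?f = "frobenius_norm G"
  let ?q = "\<lambda>i. Re ((mat_adjoint Q * G * Q) $$ (i, i))"
  have E: "?E \<in> GL n" by (rule mat_exp_Herm_GL[OF GH])
  have wc: "w \<in> carrier_vec e" using act_w(1)[OF GL_one] S.act_one w(1) by (auto simp: highest_weight_vector_def)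
  have mc: "?\<mu> \<in> carrier_mat n n" by (rule Herm_carrier[OF P.moment_map_Herm[OF act_v[OF gG]]])
  have tr_target: "Re (tr (udiag n Q ?\<Lambda> * G)) = (\<Sum>i<n. a (n - 1 - i) * ?q i)"
  proof -
    have c: "mat_adjoint Q * G * Q \<in> carrier_mat n n" using Qc Gc by simp
    have "tr (udiag n Q ?\<Lambda> * G) = tr (mat_adjoint Q * (udiag n Q ?\<Lambda> * G) * mat_adjoint (mat_adjoint Q))"
      using Gc Q by (intro tr_unitary_conj[OF unitary_adjoint[OF Q], symmetric]) simp
    also have "mat_adjoint Q * (udiag n Q ?\<Lambda> * G) * mat_adjoint (mat_adjoint Q) = (mat_adjoint Q * udiag n Q ?\<Lambda> * Q) * (mat_adjoint Q * G * Q)"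
      using unitary_cancel(2)[OF Q, of "G * Q" n] Gc Qc Q by (simp add: assoc_mult_mat[of _ n n _ n _ n])
    also have "mat_adjoint Q * udiag n Q ?\<Lambda> * Q = mat_diag n ?\<Lambda>"
      unfolding udiag_conj[OF Q Q] unitary_adj_mult[OF Q] by (simp add: udiag_def)
    also have "tr (mat_diag n ?\<Lambda> * (mat_adjoint Q * G * Q)) = (\<Sum>i<n. ?\<Lambda> i * (mat_adjoint Q * G * Q) $$ (i, i))"
      unfolding mat_diag_mult_left[OF c] tr_def by simp
    finally show ?thesis by simp
  qed
  have "tr (G * G) = tr (?\<mu> * G) - tr (udiag n Q ?\<Lambda> * G)"
    unfolding G_def[unfolded gradient_eq, symmetric]
    using minus_mult_distrib_mat[OF mc udiag_carrier[OF Q] Gc, of ?\<Lambda>] mc Gc Q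
    by (simp add: G_def gradient_eq tr_minus[of _ n])
  then have trG: "?f\<^sup>2 = Re (tr (?\<mu> * G)) - (\<Sum>i<n. a (n - 1 - i) * ?q i)"
    unfolding Herm_frobenius[OF GH] tr_target[symmetric] by (metis Re_complex_of_real minus_complex.sel(1))
  have 1: "ln (ip_norm ip (\<pi> (?E * g) *\<^sub>v v)) \<le> ln (ip_norm ip ?x) + s * Re (tr (?\<mu> * G)) + (N * ?f)\<^sup>2 * s\<^sup>2"
    unfolding P.act_mult[OF E gG v(1)] by (rule P.ln_norm_quadratic_bound[OF act_v[OF gG] GH])
  have "ln (ip_norm ip' (\<rho> (?E * g) *\<^sub>v w))
    \<le> ln (ip_norm ip' (\<rho> g *\<^sub>v w)) + s * (\<Sum>i<n. real_of_int (dual_weight p $ i) * ?q i)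
      + real_of_int (dual_weight p $ 0 - dual_weight p $ (n - 1)) * ?f\<^sup>2 * s\<^sup>2"
    unfolding S.act_mult[OF E gG wc] unfolding g
    by (rule S.coherent_quadratic_bound[OF w(1) n dual_dominant Q R GH])
  also have "(\<Sum>i<n. real_of_int (dual_weight p $ i) * ?q i) = ell * - (\<Sum>i<n. a (n - 1 - i) * ?q i)"
    unfolding sum_negf[symmetric] sum_distrib_left by (intro sum.cong) (auto simp: dual_entry)
  also have "real_of_int (dual_weight p $ 0 - dual_weight p $ (n - 1)) = ell * (a 0 - a (n - 1))"
    using dual_entry[of 0] dual_entry[of "n - 1"] n by (simp add: algebra_simps)
  finally have "ln (ip_norm ip' (\<rho> (?E * g) *\<^sub>v w)) / ell \<le>
      (ln (ip_norm ip' (\<rho> g *\<^sub>v w)) + s * (ell * - (\<Sum>i<n. a (n - 1 - i) * ?q i)) + ell * (a 0 - a (n - 1)) * ?f\<^sup>2 * s\<^sup>2) / ell"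
    using ell_pos by (intro divide_right_mono) auto
  also have "\<dots> = ln (ip_norm ip' (\<rho> g *\<^sub>v w)) / ell - s * (\<Sum>i<n. a (n - 1 - i) * ?q i) + (a 0 - a (n - 1)) * (?f\<^sup>2 * s\<^sup>2)"
    using ell_pos by (simp add: field_simps)
  also have "(a 0 - a (n - 1)) * (?f\<^sup>2 * s\<^sup>2) \<le> 3 / 2 * l2_norm (vec n a) * (?f\<^sup>2 * s\<^sup>2)"
    using spread_le_l2_norm[of 0 n "n - 1" a] n by (intro mult_right_mono) auto
  finally have 2: "ln (ip_norm ip' (\<rho> (?E * g) *\<^sub>v w)) / ell \<le>
    ln (ip_norm ip' (\<rho> g *\<^sub>v w)) / ell - s * (\<Sum>i<n. a (n - 1 - i) * ?q i) + 3 / 2 * l2_norm (vec n a) * (?f\<^sup>2 * s\<^sup>2)"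
    by simp
  have "\<Phi> (?E * g) \<le> \<Phi> g + s * (Re (tr (?\<mu> * G)) - (\<Sum>i<n. a (n - 1 - i) * ?q i))
      + (N * ?f)\<^sup>2 * s\<^sup>2 + 3 / 2 * l2_norm (vec n a) * (?f\<^sup>2 * s\<^sup>2)"
    using add_mono[OF 1 2] unfolding \<Phi>_def right_diff_distrib by linarith
  then show ?thesis unfolding trG[symmetric] by (simp add: algebra_simps power_mult_distrib)
qed

lemma \<Phi>_one: "\<Phi> (1\<^sub>m n) = 0"
  using v w S.act_one P.act_one by (simp add: \<Phi>_def highest_weight_vector_def)

lemma \<Phi>_ge_capacity:
  assumes cap: "capacity n \<pi> ip \<rho> ip' w p v > 0" and g: "g \<in> GL n"
  shows "\<Phi> g \<ge> ln (capacity n \<pi> ip \<rho> ip' w p v)"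
proof -
  let ?f = "\<lambda>g. ip_norm ip (\<pi> g *\<^sub>v v) * ip_norm ip' (\<rho> g *\<^sub>v w) powr (1 / real (common_denominator p))"
  note pos = P.ip_norm_pos[OF act_v] S.ip_norm_pos[OF act_w]
  have "0 \<le> ?f h" if "h \<in> GL n" for h using pos[OF that that] by simp
  then have "bdd_below (?f ` GL n)" by (intro bdd_belowI[of _ 0]) blast
  then have "capacity n \<pi> ip \<rho> ip' w p v \<le> ?f g" unfolding capacity_def using g by (rule cINF_lower)
  then have "ln (capacity n \<pi> ip \<rho> ip' w p v) \<le> ln (?f g)" using cap by (intro ln_mono) auto
  also have "\<dots> = \<Phi> g"
    using pos[OF g g] pos(1)[OF g g] pos(2)[OF g g] by (simp add: \<Phi>_def ell_def ln_mult ln_powr)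
  finally show ?thesis .
qed

lemma run_start: "algorithm_run n \<pi> ip p v \<eta> T g Q R \<Longrightarrow> g 0 = 1\<^sub>m n"
  unfolding algorithm_run_def by (rule conjunct1)

lemma run_step:
  assumes "algorithm_run n \<pi> ip p v \<eta> T g Q R" "t < T"
  shows "Q t \<in> unitary_group n" "R t \<in> carrier_mat n n" "upper_triangular (R t)" "g t = Q t * R t"
    "g (Suc t) = mat_exp (complex_of_real (- \<eta>) \<cdot>\<^sub>m gradient n \<pi> ip p v (g t) (Q t)) * g t"
  using assms unfolding algorithm_run_def by blast+

lemma run_GL:
  assumes run: "algorithm_run n \<pi> ip p v \<eta> T g Q R" and "t \<le> T"
  shows "g t \<in> GL n"
  using assms(2)
proof (induction t)
  case 0
  then show ?case using run_start[OF run] by simp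
next
  case (Suc t)
  then have t: "t < T" and gt: "g t \<in> GL n" by auto
  from GL_mult[OF mat_exp_Herm_GL[OF gradient_Herm[OF gt run_step(1)[OF run t]]] gt]
  show ?case unfolding run_step(5)[OF run t] .
qed

lemma run_R_GL:
  assumes run: "algorithm_run n \<pi> ip p v \<eta> T g Q R" and t: "t < T"
  shows "R t \<in> GL n"
proof -
  note st = run_step[OF run t]
  have "R t = mat_adjoint (Q t) * g t" unfolding st(4) using unitary_cancel(1)[OF st(1,2)] by simp
  then show ?thesis
    using GL_mult[OF unitary_GL[OF unitary_adjoint[OF st(1)]] run_GL[OF run less_imp_le[OF t]]] by simp
qed

lemma run_exists: "\<exists>g Q R. algorithm_run n \<pi> ip p v \<eta> T g Q R"
proof -
  define q where "q g = (SOME q. \<exists>r. q \<in> unitary_group n \<and> r \<in> carrier_mat n n \<and> upper_triangular r \<and> g = q * r)" for g :: "complex mat"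
  define r where "r g = (SOME r. r \<in> carrier_mat n n \<and> upper_triangular r \<and> g = q g * r)" for g :: "complex mat"
  have "\<exists>r. q g \<in> unitary_group n \<and> r \<in> carrier_mat n n \<and> upper_triangular r \<and> g = q g * r" if "g \<in> carrier_mat n n" for g
    unfolding q_def
    by (rule someI_ex[of "\<lambda>q. \<exists>r. q \<in> unitary_group n \<and> r \<in> carrier_mat n n \<and> upper_triangular r \<and> g = q * r", OF QR_exists[OF that]])
  then have q: "q g \<in> unitary_group n" and ex: "\<exists>r. r \<in> carrier_mat n n \<and> upper_triangular r \<and> g = q g * r" if "g \<in> carrier_mat n n" for g
    using that by blast+
  have r: "r g \<in> carrier_mat n n \<and> upper_triangular (r g) \<and> g = q g * r g" if "g \<in> carrier_mat n n" for g
    using someI_ex[OF ex[OF that]] unfolding r_def .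
  define step where "step g = mat_exp (complex_of_real (- \<eta>) \<cdot>\<^sub>m gradient n \<pi> ip p v g (q g)) * g" for g
  define gs where "gs t = (step ^^ t) (1\<^sub>m n)" for t
  have gs: "gs t \<in> GL n" for t
  proof (induction t)
    case (Suc t)
    have "gs (Suc t) = step (gs t)" by (simp add: gs_def)
    then show ?case
      unfolding step_def using GL_mult[OF mat_exp_Herm_GL[OF gradient_Herm[OF Suc q[OF GL_carrier[OF Suc]]]] Suc]
      by (simp only:)
  qed (simp add: gs_def)
  have "algorithm_run n \<pi> ip p v \<eta> T gs (\<lambda>t. q (gs t)) (\<lambda>t. r (gs t))"
    unfolding algorithm_run_def
  proof (intro conjI allI impI)
    show "gs 0 = 1\<^sub>m n" by (simp add: gs_def)
    fix t
    note c = GL_carrier[OF gs[of t]]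
    show "q (gs t) \<in> unitary_group n" "r (gs t) \<in> carrier_mat n n" "upper_triangular (r (gs t))" "gs t = q (gs t) * r (gs t)"
      using q[OF c] r[OF c] by blast+
    show "gs (Suc t) = mat_exp (complex_of_real (- \<eta>) \<cdot>\<^sub>m gradient n \<pi> ip p v (gs t) (q (gs t))) * gs t"
      by (simp add: gs_def step_def)
  qed
  then show ?thesis by blast
qed

lemma output_exists:
  assumes "T \<ge> 1"
  shows "\<exists>g. algorithm_output n \<pi> ip p v \<eta> T g"
proof -
  obtain g Q R where run: "algorithm_run n \<pi> ip p v \<eta> T g Q R" using run_exists by blast
  let ?f = "\<lambda>t. frobenius_norm (gradient n \<pi> ip p v (g t) (Q t))"
  have "Min (?f ` {..<T}) \<in> ?f ` {..<T}" using assms by (intro Min_in) (auto simp: lessThan_empty_iff)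
  then obtain t where t: "t < T" "?f t = Min (?f ` {..<T})" by auto
  then have "\<forall>s<T. ?f t \<le> ?f s" by simp
  then show ?thesis unfolding algorithm_output_def using run t(1) by blast
qed

text \<open>With \<open>\<eta> = 1 / (2 N2)\<close> every step decreases the potential by a fixed multiple of the squared gradient, while
  the potential starts at zero and stays above the logarithm of the capacity.\<close>

lemma min_gradient_bound:
  assumes run: "algorithm_run n \<pi> ip p v \<eta> T g Q R" and cap: "capacity n \<pi> ip \<rho> ip' w p v > 0"
    and N2: "N2 = N\<^sup>2 + l2_norm (vec n a)" "N2 > 0" and \<eta>: "\<eta> = 1 / (2 * N2)"
    and m: "m \<ge> 0" "\<And>s. s < T \<Longrightarrow> m \<le> frobenius_norm (gradient n \<pi> ip p v (g s) (Q s))"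
  shows "real T * m\<^sup>2 \<le> 8 * N2 * \<bar>ln (capacity n \<pi> ip \<rho> ip' w p v)\<bar>"
proof -
  have "t \<le> T \<Longrightarrow> \<Phi> (g t) \<le> - real t * (m\<^sup>2 / (8 * N2))" for t
  proof (induction t)
    case 0
    then show ?case using run_start[OF run] \<Phi>_one by simp
  next
    case (Suc t)
    then have t: "t < T" by simp
    let ?f = "frobenius_norm (gradient n \<pi> ip p v (g t) (Q t))"
    have "\<Phi> (g (Suc t)) \<le> \<Phi> (g t) + (- \<eta>) * ?f\<^sup>2 + (N\<^sup>2 + 3 / 2 * l2_norm (vec n a)) * ?f\<^sup>2 * (- \<eta>)\<^sup>2"
      using \<Phi>_descent[OF run_step(1)[OF run t] run_R_GL[OF run t] run_step(3,4)[OF run t], of "- \<eta>"]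
      unfolding run_step(5)[OF run t] .
    also have "(N\<^sup>2 + 3 / 2 * l2_norm (vec n a)) * ?f\<^sup>2 * (- \<eta>)\<^sup>2 \<le> (3 / 2 * N2) * ?f\<^sup>2 * (- \<eta>)\<^sup>2"
      unfolding N2(1) by (intro mult_right_mono) auto
    also have "\<Phi> (g t) + (- \<eta>) * ?f\<^sup>2 + (3 / 2 * N2) * ?f\<^sup>2 * (- \<eta>)\<^sup>2 = \<Phi> (g t) - ?f\<^sup>2 / (8 * N2)"
      unfolding \<eta> using N2(2) by (simp add: field_simps power2_eq_square)
    also have "\<dots> \<le> \<Phi> (g t) - m\<^sup>2 / (8 * N2)"
      using m(1) m(2)[OF t] N2(2) by (intro diff_left_mono divide_right_mono power_mono) auto
    finally have "\<Phi> (g (Suc t)) \<le> - real t * (m\<^sup>2 / (8 * N2)) - m\<^sup>2 / (8 * N2)" using Suc.IH t by linarith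
    also have "\<dots> = - real (Suc t) * (m\<^sup>2 / (8 * N2))"
    proof -
      have "- x * c - c = - (1 + x) * c" for x c :: real by (simp add: algebra_simps)
      then show ?thesis unfolding of_nat_Suc .
    qed
    finally show ?case .
  qed
  from this[of T] have "real T * (m\<^sup>2 / (8 * N2)) \<le> - ln (capacity n \<pi> ip \<rho> ip' w p v)"
    using \<Phi>_ge_capacity[OF cap run_GL[OF run order_refl]] by simp
  also have "\<dots> \<le> \<bar>ln (capacity n \<pi> ip \<rho> ip' w p v)\<bar>" by simp
  finally show ?thesis using N2(2) by (simp add: field_simps)
qed

text \<open>In this degenerate case, in which the step size is arbitrary, all weights and the target vanish.\<close>

lemma gradient_zero:
  assumes N2: "N\<^sup>2 + l2_norm (vec n a) = 0" and g: "g \<in> GL n" and Q: "Q \<in> unitary_group n"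
  shows "frobenius_norm (gradient n \<pi> ip p v g Q) = 0"
proof -
  have l0: "l2_norm (vec n a) \<ge> 0" by (simp add: l2_norm_def sum_nonneg)
  then have N0: "N = 0" and a0: "l2_norm (vec n a) = 0"
    using N2 by (simp_all add: add_nonneg_eq_0_iff)
  let ?\<mu> = "moment_map n \<pi> ip (\<pi> g *\<^sub>v v)" and ?\<Lambda> = "hdiag n Q (\<lambda>i. a (n - 1 - i))"
  have \<mu>: "?\<mu> \<in> Herm n" by (intro P.moment_map_Herm act_v g)
  have "(frobenius_norm ?\<mu>)\<^sup>2 = cmod (tr (?\<mu> * ?\<mu>))"
    unfolding Herm_frobenius[OF \<mu>] norm_of_real by simp
  also have "\<dots> \<le> N * frobenius_norm ?\<mu>" by (rule P.abs_tr_moment_map_le[OF act_v[OF g] \<mu>])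
  finally have "frobenius_norm ?\<mu> = 0" using N0 by simp
  then have \<mu>0: "?\<mu> = 0\<^sub>m n n" by (rule frobenius_zero[OF Herm_carrier[OF \<mu>]])
  have "(\<Sum>i<n. (a i)\<^sup>2) = 0" using a0 by (simp add: l2_norm_def)
  then have "a i = 0" if "i < n" for i using that by (subst (asm) sum_nonneg_eq_0_iff) auto
  then have "(\<Sum>i<n. (a (n - 1 - i))\<^sup>2) = 0" by (intro sum.neutral) auto
  then have "frobenius_norm ?\<Lambda> = 0" unfolding frobenius_udiag[OF Q, symmetric] by simp
  then have "?\<Lambda> = 0\<^sub>m n n" by (rule frobenius_zero[OF udiag_carrier[OF Q]])
  then show ?thesis unfolding gradient_eq \<mu>0 by (simp add: frobenius_norm_def)
qed

lemma output_close:
  assumes out: "algorithm_output n \<pi> ip p v \<eta> T g'" and cap: "capacity n \<pi> ip \<rho> ip' w p v > 0"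
    and \<epsilon>: "\<epsilon> > 0" and N2: "N2 = N\<^sup>2 + l2_norm (vec n a)" and \<eta>: "N2 \<noteq> 0 \<Longrightarrow> \<eta> = 1 / (2 * N2)"
    and T: "T = max 1 (nat \<lceil>8 * (N2 / \<epsilon>\<^sup>2) * \<bar>ln (capacity n \<pi> ip \<rho> ip' w p v)\<bar>\<rceil>)"
  shows "g' \<in> GL n" "l2_norm (spec (moment_map n \<pi> ip (\<pi> g' *\<^sub>v v)) - map_vec real_of_rat p) \<le> \<epsilon>"
proof -
  obtain g Q R t where run: "algorithm_run n \<pi> ip p v \<eta> T g Q R" and t: "t < T" "g' = g t"
    and min: "\<And>s. s < T \<Longrightarrow> frobenius_norm (gradient n \<pi> ip p v (g t) (Q t)) \<le> frobenius_norm (gradient n \<pi> ip p v (g s) (Q s))"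
    using out unfolding algorithm_output_def by blast
  let ?m = "frobenius_norm (gradient n \<pi> ip p v (g t) (Q t))"
  let ?c = "\<bar>ln (capacity n \<pi> ip \<rho> ip' w p v)\<bar>"
  show g': "g' \<in> GL n" unfolding t(2) using run_GL[OF run] t(1) by simp
  have Qt: "Q t \<in> unitary_group n" by (rule run_step(1)[OF run t(1)])
  have "?m \<le> \<epsilon>"
  proof (cases "N2 = 0")
    case True
    then show ?thesis using gradient_zero[OF _ run_GL[OF run less_imp_le[OF t(1)]] Qt] \<epsilon> N2 by simp
  next
    case False
    have "l2_norm (vec n a) \<ge> 0" by (simp add: l2_norm_def sum_nonneg)
    then have pos: "N2 > 0" using False N2 by (simp add: less_le)
    have "real T \<ge> 8 * (N2 / \<epsilon>\<^sup>2) * ?c" unfolding T by linarith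
    then have "8 * N2 * ?c \<le> real T * \<epsilon>\<^sup>2" using \<epsilon> by (simp add: field_simps)
    moreover have "real T * ?m\<^sup>2 \<le> 8 * N2 * ?c"
      by (rule min_gradient_bound[OF run cap N2 pos \<eta>[OF False] frobenius_nonneg min])
    ultimately have "real T * ?m\<^sup>2 \<le> real T * \<epsilon>\<^sup>2" by linarith
    then have "?m\<^sup>2 \<le> \<epsilon>\<^sup>2" using t(1) by simp
    then show ?thesis by (rule power2_le_imp_le) (use \<epsilon> in simp)
  qed
  then show "l2_norm (spec (moment_map n \<pi> ip (\<pi> g' *\<^sub>v v)) - map_vec real_of_rat p) \<le> \<epsilon>"
    using spec_distance_le_gradient[OF g' Qt] unfolding t(2) by simp
qed

end

theorem theorem1p21:
  shows "\<exists>C::real. C > 0 \<and>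
    (\<forall>(n::nat) (d::nat) (\<pi> :: complex mat \<Rightarrow> complex mat) (ip :: complex vec \<Rightarrow> complex vec \<Rightarrow> complex)
      (v :: complex vec) (p :: rat vec)
      (e::nat) (\<rho> :: complex mat \<Rightarrow> complex mat) (ip' :: complex vec \<Rightarrow> complex vec \<Rightarrow> complex)
      (w :: complex vec) (\<epsilon>::real) (\<eta>::real) (cap_p::real) (N2::real) (T::nat).
      n \<ge> 1 \<and>
      rational_representation n d \<pi> \<and>
      hermitian_inner_product d ip \<and> unitary_invariant n d \<pi> ip \<and>
      v \<in> carrier_vec d \<and> ip_norm ip v = 1 \<and>
      p \<in> carrier_vec n \<and> (\<forall>i j. i \<le> j \<and> j < n \<longrightarrow> p $ j \<le> p $ i) \<and>
      highest_weight_model n (dual_weight p) e \<rho> ip' w \<and>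
      cap_p = capacity n \<pi> ip \<rho> ip' w p v \<and> cap_p > 0 \<and>
      \<epsilon> > 0 \<and>
      N2 = (weight_norm n d \<pi>)\<^sup>2 + l2_norm (map_vec real_of_rat p) \<and>
      (N2 \<noteq> 0 \<longrightarrow> \<eta> = 1 / (2 * N2)) \<and>
      T = max 1 (nat \<lceil>C * (N2 / \<epsilon>\<^sup>2) * \<bar>ln cap_p\<bar>\<rceil>)
      \<longrightarrow>
      (\<exists>g. algorithm_output n \<pi> ip p v \<eta> T g) \<and>
      (\<forall>g. algorithm_output n \<pi> ip p v \<eta> T g \<longrightarrow>
         g \<in> GL n \<and>
         l2_norm (spec (moment_map n \<pi> ip (\<pi> g *\<^sub>v v)) - map_vec real_of_rat p) \<le> \<epsilon>))"
proof (intro exI[of _ 8] conjI allI impI; (elim conjE)?)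
  show "(8 :: real) > 0" by simp
next
  fix n d :: nat and \<pi> \<rho> :: "complex mat \<Rightarrow> complex mat" and ip ip' :: "complex vec \<Rightarrow> complex vec \<Rightarrow> complex"
    and v w :: "complex vec" and p :: "rat vec" and e T :: nat and \<epsilon> \<eta> cap_p N2 :: real
  assume n: "n \<ge> 1" and rep: "rational_representation n d \<pi>"
    and ip: "hermitian_inner_product d ip" "unitary_invariant n d \<pi> ip"
    and v: "v \<in> carrier_vec d" "ip_norm ip v = 1"
    and p: "p \<in> carrier_vec n" "\<forall>i j. i \<le> j \<and> j < n \<longrightarrow> p $ j \<le> p $ i"
    and model: "highest_weight_model n (dual_weight p) e \<rho> ip' w"
    and cap_p: "cap_p = capacity n \<pi> ip \<rho> ip' w p v" "cap_p > 0"
    and eps: "\<epsilon> > 0"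
    and N2: "N2 = (weight_norm n d \<pi>)\<^sup>2 + l2_norm (map_vec real_of_rat p)"
    and \<eta>: "N2 \<noteq> 0 \<longrightarrow> \<eta> = 1 / (2 * N2)"
    and T: "T = max 1 (nat \<lceil>8 * (N2 / \<epsilon>\<^sup>2) * \<bar>ln cap_p\<bar>\<rceil>)"
  have model': "rational_representation n e \<rho>" "hermitian_inner_product e ip'" "unitary_invariant n e \<rho> ip'"
    "highest_weight_vector n e \<rho> (dual_weight p) w" "ip_norm ip' w = 1"
    using model unfolding highest_weight_model_def by blast+
  interpret scaling d ip n \<pi> e ip' \<rho> v p w
    by (intro scaling.intro unitary_rep.intro herm_space.intro unitary_rep_axioms.intro scaling_axioms.intro
        n rep ip v p(1) model') (rule p(2)[rule_format, OF conjI])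
  show "\<exists>g. algorithm_output n \<pi> ip p v \<eta> T g" by (rule output_exists) (simp add: T)
  fix g assume out: "algorithm_output n \<pi> ip p v \<eta> T g"
  note close = output_close[OF out cap_p(2)[unfolded cap_p(1)] eps N2[unfolded a_vec] \<eta>[rule_format] T[unfolded cap_p(1)]]
  show "g \<in> GL n" by (rule close(1))
  show "l2_norm (spec (moment_map n \<pi> ip (\<pi> g *\<^sub>v v)) - map_vec real_of_rat p) \<le> \<epsilon>" by (rule close(2))
qed

end
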